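(* Let $(\mathbb A,\mathsf E,\mathsf M)$ be a context, $(X,\mu)$, $(Y,\phi)$, $(Z,\psi)$ internal preneighbourhood spaces and $f:X\to Y$, $g:Y\to Z$ morphisms of $\mathbb A$. The following statements hold. (a) $f$ is dense if and only if $\widehat{\mathrm{cl}}_\phi f^{\mathsf M}=\mathrm{id}_Y$. (b) $\mathsf E\subseteq\mathrm{Dense}(\mathbb A)$ and $\mathrm{Dense}(\mathbb A)\cap\mathrm{ClEmb}(\mathbb A)=\mathrm{Iso}(\mathbb A)$. (c) If $g$ is dense and continuous and $f$ is dense then $g\circ f$ is dense. (d) If $g\circ f\in\mathrm{Dense}(\mathbb A)$ then $g\in\mathrm{Dense}(\mathbb A)$. (e) $\mathrm{Dense}(\mathbb A)^{\downarrow}\subseteq\mathrm{ClEmb}(\mathbb A)$ and $\mathrm{ClEmb}(\mathbb A)^{\uparrow}\subseteq\mathrm{Dense}(\mathbb A)$. (f) If every preneighbourhood morphism is continuous then $\mathrm{Dense}(\mathbb A)\subseteq\mathrm{ClEmb}(\mathbb A)^{\uparrow}$ and $(\mathrm{Dense}(\mathbb A),\mathrm{ClEmb}(\mathbb A))$ is a factorization system on $\mathbb A$. (g) If all preneighbourhood morphisms are continuous then dense morphisms are pushout stable. (h) If all preneighbourhood morphisms are continuous, $F,G:\mathbb X\to\mathbb A$ are functors, $\alpha:F\Rightarrow G$ is a natural transformation with $\alpha_X\in\mathrm{Dense}(\mathbb A)$ for every object $X$ of $\mathbb X$, and $\operatorname{colim}F$ and $\operatorname{colim}G$ exist, then $\operatorname{colim}\alpha\in\mathrm{Dense}(\mathbb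 A)$.
   Context: A context is a triple $(\mathbb A,\mathsf E,\mathsf M)$ where $\mathbb A$ is a finitely complete category with finite coproducts, $(\mathsf E,\mathsf M)$ is a proper factorization system on $\mathbb A$ ($\mathsf E\subseteq$ epimorphisms, $\mathsf M\subseteq$ monomorphisms), and for each object $X$ the poset $\mathrm{Sub}(X)$ of admissible subobjects of $X$ ($\mathsf M$-morphisms with codomain $X$, equivalent ones identified) is a complete lattice, with largest element $\mathrm{id}_X$ and smallest element $\sigma_X$ (the $\mathsf M$-part of the factorization of the unique morphism from the initial object to $X$). For $f:X\to Y$, $f^{\mathsf M}\in\mathrm{Sub}(Y)$ is the $\mathsf M$-part of the factorization of $f$ and $f^{-1}n$ is the pullback of $n\in\mathrm{Sub}(Y)$ along $f$. A filter on $X$ is an up-closed subset of $\mathrm{Sub}(X)$ closed under finite meets; filters $\mathrm{Fil}(X)$ are ordered by inclusion. A preneighbourhood system on $X$ is an order preserving map $\mu:\mathrm{Sub}(X)^{\mathrm{op}}\to\mathrm{Fil}(X)$ with $\mu(\sigma_X)=\mathrm{Sub}(X)$ and $p\in\mu(m)\Rightarrow m\leq p$; $(X,\mu)$ is then an internal preneighbourhood space. A preneighbourhood morphism $f:(X,\mu)\to(Y,\phi)$ is a morphism $f:X\to Y$ such that $p\in\phi(u)\Rightarrow f^{-1}p\in\mu(f^{-1}u)$. For $m:M\to X$ in $\mathsf M$, $M$ carries the restricted system $\mu|_m(a)=\{u\in\mathrm{Sub}(M):(\exists v\in\mu(m\circ a))(m^{-1}v\leq u)\}$. Colimit objects of diagrams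 of preneighbourhood spaces carry the largest preneighbourhood system making the components of the colimiting cocone preneighbourhood morphisms. Define $\mathtt{Far}_\mu p=\{x\in\mathrm{Sub}(X):(\exists u\in\mu(x))(u\wedge p=\sigma_X)\}$, $\mathrm{cl}_\mu p=\bigvee\{x\in\mathrm{Sub}(X): p\not< x\text{ and }x\notin\mathtt{Far}_\mu p\}$, $\mathfrak C_\mu=\{p:\mathrm{cl}_\mu p=p\}$, and $\widehat{\mathrm{cl}}_\mu p=\bigwedge\{t\in\mathfrak C_\mu: p\leq t\}$. For preneighbourhood spaces $(X,\mu)$, $(Y,\phi)$, a morphism $f:X\to Y$ is continuous if $t\in\mathfrak C_\phi\Rightarrow f^{-1}t\in\mathfrak C_\mu$; it is dense if $f=m\circ h$ with $m\in\mathfrak C_\phi$ implies that $m$ is an isomorphism. $\mathrm{Dense}(\mathbb A)$ is the collection of dense morphisms; $\mathrm{ClEmb}(\mathbb A)$ is the collection of closed embeddings, i.e. the $m\in\mathfrak C_\mu$ for preneighbourhood spaces $(X,\mu)$; $\mathrm{Iso}(\mathbb A)$ is the collection of isomorphisms. Morphism $f$ is orthogonal to $g$, $f\perp g$, if whenever $v\circ f=g\circ u$ there is a unique $w$ with $v=g\circ w$ and $u=w\circ f$. For a collection $\mathcal H$ of morphisms, $\mathcal H^{\uparrow}=\{f:f\perp h\text{ for all }h\in\mathcal H\}$ and $\mathcal H^{\downarrow}=\{f:h\perp f\text{ for all }h\in\mathcal H\}$. A factorization system is a pair $(\mathcal A,\mathcal B)$ with $\mathcal B=\mathcal A^{\downarrow}$,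 $\mathcal A=\mathcal B^{\uparrow}$ such that every morphism factors as an $\mathcal A$-morphism followed by a $\mathcal B$-morphism.
   Formalization: In (f), dense morphisms, squares and the factorization system are taken in the category of preneighbourhood spaces and preneighbourhood morphisms, closed embeddings carrying the restricted system; over all morphisms of A the claim fails (four-element Boolean algebra, E identities, M all). *)

theory Defs
  imports "HOL-Algebra.Complete_Lattice" "HOL-Library.FuncSet"
begin

section \<open>Categories\<close>

record ('o, 'm) cat =
  Ob :: "'o set"
  Ar :: "'m set"
  Dom :: "'m \<Rightarrow> 'o"
  Cod :: "'m \<Rightarrow> 'o"
  Id :: "'o \<Rightarrow> 'm"
  Comp :: "'m \<Rightarrow> 'm \<Rightarrow> 'm"  (infixl "\<cdot>\<index>" 70)

text \<open>Composition is in applicative order: \<open>g \<cdot> f\<close> is \<open>g\<close> after \<open>f\<close>. It is meaningful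
  only when \<open>Cod f = Dom g\<close>.\<close>

definition Hom :: "('o, 'm, 'z) cat_scheme \<Rightarrow> 'o \<Rightarrow> 'o \<Rightarrow> 'm set" where
  "Hom C X Y = {f \<in> Ar C. Dom C f = X \<and> Cod C f = Y}"

locale category =
  fixes C :: "('o, 'm, 'z) cat_scheme" (structure)
  assumes Dom_Ob: "f \<in> Ar C \<Longrightarrow> Dom C f \<in> Ob C"
    and Cod_Ob: "f \<in> Ar C \<Longrightarrow> Cod C f \<in> Ob C"
    and Id_Hom: "X \<in> Ob C \<Longrightarrow> Id C X \<in> Hom C X X"
    and Comp_Hom: "\<lbrakk>f \<in> Hom C X Y; g \<in> Hom C Y Z\<rbrakk> \<Longrightarrow> g \<cdot> f \<in> Hom C X Z"
    and Comp_Id_left: "f \<in> Hom C X Y \<Longrightarrow> Id C Y \<cdot> f = f"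
    and Comp_Id_right: "f \<in> Hom C X Y \<Longrightarrow> f \<cdot> Id C X = f"
    and Comp_assoc:
      "\<lbrakk>f \<in> Hom C W X; g \<in> Hom C X Y; h \<in> Hom C Y Z\<rbrakk> \<Longrightarrow> (h \<cdot> g) \<cdot> f = h \<cdot> (g \<cdot> f)"

definition Monos :: "('o, 'm, 'z) cat_scheme \<Rightarrow> 'm set" where
  "Monos C = {m \<in> Ar C. \<forall>W. \<forall>f \<in> Hom C W (Dom C m). \<forall>g \<in> Hom C W (Dom C m).
     m \<cdot>\<^bsub>C\<^esub> f = m \<cdot>\<^bsub>C\<^esub> g \<longrightarrow> f = g}"

definition Epis :: "('o, 'm, 'z) cat_scheme \<Rightarrow> 'm set" where
  "Epis C = {e \<in> Ar C. \<forall>W. \<forall>f \<in> Hom C (Cod C e) W. \<forall>g \<in> Hom C (Cod C e) W.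
     f \<cdot>\<^bsub>C\<^esub> e = g \<cdot>\<^bsub>C\<^esub> e \<longrightarrow> f = g}"

definition Isos :: "('o, 'm, 'z) cat_scheme \<Rightarrow> 'm set" where
  "Isos C = {f \<in> Ar C. \<exists>g \<in> Hom C (Cod C f) (Dom C f).
     g \<cdot>\<^bsub>C\<^esub> f = Id C (Dom C f) \<and> f \<cdot>\<^bsub>C\<^esub> g = Id C (Cod C f)}"


subsection \<open>Functors, limits and colimits\<close>

definition is_functor ::
  "('i, 'j, 'y) cat_scheme \<Rightarrow> ('o, 'm, 'z) cat_scheme \<Rightarrow> ('i \<Rightarrow> 'o) \<Rightarrow> ('j \<Rightarrow> 'm) \<Rightarrow> bool" where
  "is_functor J C Fo Fa \<longleftrightarrow>
     Fo ` Ob J \<subseteq> Ob C \<and>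
     (\<forall>a \<in> Ar J. Fa a \<in> Hom C (Fo (Dom J a)) (Fo (Cod J a))) \<and>
     (\<forall>i \<in> Ob J. Fa (Id J i) = Id C (Fo i)) \<and>
     (\<forall>a \<in> Ar J. \<forall>b \<in> Ar J. Cod J a = Dom J b \<longrightarrow> Fa (b \<cdot>\<^bsub>J\<^esub> a) = Fa b \<cdot>\<^bsub>C\<^esub> Fa a)"

definition is_nat_trans ::
  "('i, 'j, 'y) cat_scheme \<Rightarrow> ('o, 'm, 'z) cat_scheme \<Rightarrow> ('i \<Rightarrow> 'o) \<Rightarrow> ('j \<Rightarrow> 'm) \<Rightarrow>
   ('i \<Rightarrow> 'o) \<Rightarrow> ('j \<Rightarrow> 'm) \<Rightarrow> ('i \<Rightarrow> 'm) \<Rightarrow> bool" where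
  "is_nat_trans J C Fo Fa Go Ga \<alpha> \<longleftrightarrow>
     (\<forall>i \<in> Ob J. \<alpha> i \<in> Hom C (Fo i) (Go i)) \<and>
     (\<forall>a \<in> Ar J. \<alpha> (Cod J a) \<cdot>\<^bsub>C\<^esub> Fa a = Ga a \<cdot>\<^bsub>C\<^esub> \<alpha> (Dom J a))"

definition is_cone ::
  "('i, 'j, 'y) cat_scheme \<Rightarrow> ('o, 'm, 'z) cat_scheme \<Rightarrow> ('i \<Rightarrow> 'o) \<Rightarrow> ('j \<Rightarrow> 'm) \<Rightarrow>
   'o \<Rightarrow> ('i \<Rightarrow> 'm) \<Rightarrow> bool" where
  "is_cone J C Fo Fa L \<pi> \<longleftrightarrow> L \<in> Ob C \<and>
     (\<forall>i \<in> Ob J. \<pi> i \<in> Hom C L (Fo i)) \<and>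
     (\<forall>a \<in> Ar J. Fa a \<cdot>\<^bsub>C\<^esub> \<pi> (Dom J a) = \<pi> (Cod J a))"

definition is_limit ::
  "('i, 'j, 'y) cat_scheme \<Rightarrow> ('o, 'm, 'z) cat_scheme \<Rightarrow> ('i \<Rightarrow> 'o) \<Rightarrow> ('j \<Rightarrow> 'm) \<Rightarrow>
   'o \<Rightarrow> ('i \<Rightarrow> 'm) \<Rightarrow> bool" where
  "is_limit J C Fo Fa L \<pi> \<longleftrightarrow> is_cone J C Fo Fa L \<pi> \<and>
     (\<forall>K \<kappa>. is_cone J C Fo Fa K \<kappa> \<longrightarrow>
        (\<exists>!w. w \<in> Hom C K L \<and> (\<forall>i \<in> Ob J. \<pi> i \<cdot>\<^bsub>C\<^esub> w = \<kappa> i)))"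

definition is_cocone ::
  "('i, 'j, 'y) cat_scheme \<Rightarrow> ('o, 'm, 'z) cat_scheme \<Rightarrow> ('i \<Rightarrow> 'o) \<Rightarrow> ('j \<Rightarrow> 'm) \<Rightarrow>
   'o \<Rightarrow> ('i \<Rightarrow> 'm) \<Rightarrow> bool" where
  "is_cocone J C Fo Fa L \<iota> \<longleftrightarrow> L \<in> Ob C \<and>
     (\<forall>i \<in> Ob J. \<iota> i \<in> Hom C (Fo i) L) \<and>
     (\<forall>a \<in> Ar J. \<iota> (Cod J a) \<cdot>\<^bsub>C\<^esub> Fa a = \<iota> (Dom J a))"

definition is_colimit ::
  "('i, 'j, 'y) cat_scheme \<Rightarrow> ('o, 'm, 'z) cat_scheme \<Rightarrow> ('i \<Rightarrow> 'o) \<Rightarrow> ('j \<Rightarrow> 'm) \<Rightarrow>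
   'o \<Rightarrow> ('i \<Rightarrow> 'm) \<Rightarrow> bool" where
  "is_colimit J C Fo Fa L \<iota> \<longleftrightarrow> is_cocone J C Fo Fa L \<iota> \<and>
     (\<forall>K \<kappa>. is_cocone J C Fo Fa K \<kappa> \<longrightarrow>
        (\<exists>!w. w \<in> Hom C L K \<and> (\<forall>i \<in> Ob J. w \<cdot>\<^bsub>C\<^esub> \<iota> i = \<kappa> i)))"

text \<open>The arrow \<open>colim \<alpha> : L \<rightarrow> K\<close> induced by a natural transformation \<open>\<alpha>\<close> between functors with
  colimiting cocones \<open>(L, \<iota>)\<close> and \<open>(K, \<kappa>)\<close>.\<close>

definition colim_map ::
  "('i, 'j, 'y) cat_scheme \<Rightarrow> ('o, 'm, 'z) cat_scheme \<Rightarrow> 'o \<Rightarrow> ('i \<Rightarrow> 'm) \<Rightarrow>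
   'o \<Rightarrow> ('i \<Rightarrow> 'm) \<Rightarrow> ('i \<Rightarrow> 'm) \<Rightarrow> 'm" where
  "colim_map J C L \<iota> K \<kappa> \<alpha> =
     (THE w. w \<in> Hom C L K \<and> (\<forall>i \<in> Ob J. w \<cdot>\<^bsub>C\<^esub> \<iota> i = \<kappa> i \<cdot>\<^bsub>C\<^esub> \<alpha> i))"

text \<open>Every finite category is isomorphic to one whose objects and arrows are natural numbers,
  so the index categories below range over all finite shapes.\<close>

definition finitely_complete :: "('o, 'm, 'z) cat_scheme \<Rightarrow> bool" where
  "finitely_complete C \<longleftrightarrow>
     (\<forall>(J :: (nat, nat) cat) Fo Fa.
        category J \<and> finite (Ob J) \<and> finite (Ar J) \<and> is_functor J C Fo Fa \<longrightarrow>
        (\<exists>L \<pi>. is_limit J C Fo Fa L \<pi>))"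

definition is_coproduct ::
  "('o, 'm, 'z) cat_scheme \<Rightarrow> 'i set \<Rightarrow> ('i \<Rightarrow> 'o) \<Rightarrow> 'o \<Rightarrow> ('i \<Rightarrow> 'm) \<Rightarrow> bool" where
  "is_coproduct C I X L \<iota> \<longleftrightarrow> L \<in> Ob C \<and> (\<forall>i \<in> I. \<iota> i \<in> Hom C (X i) L) \<and>
     (\<forall>K \<in> Ob C. \<forall>\<kappa>. (\<forall>i \<in> I. \<kappa> i \<in> Hom C (X i) K) \<longrightarrow>
        (\<exists>!w. w \<in> Hom C L K \<and> (\<forall>i \<in> I. w \<cdot>\<^bsub>C\<^esub> \<iota> i = \<kappa> i)))"

definition has_finite_coproducts :: "('o, 'm, 'z) cat_scheme \<Rightarrow> bool" where
  "has_finite_coproducts C \<longleftrightarrow>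
     (\<forall>(I :: nat set) X. finite I \<and> X ` I \<subseteq> Ob C \<longrightarrow> (\<exists>L \<iota>. is_coproduct C I X L \<iota>))"

definition is_initial :: "('o, 'm, 'z) cat_scheme \<Rightarrow> 'o \<Rightarrow> bool" where
  "is_initial C Z \<longleftrightarrow> Z \<in> Ob C \<and> (\<forall>X \<in> Ob C. \<exists>!f. f \<in> Hom C Z X)"

text \<open>\<open>is_pullback C f g p q\<close>: the square \<open>f \<cdot> p = g \<cdot> q\<close> is a pullback of the cospan
  \<open>(f, g)\<close>; \<open>is_pushout C f g p q\<close>: the square \<open>p \<cdot> f = q \<cdot> g\<close> is a pushout of the span
  \<open>(f, g)\<close>.\<close>

definition is_pullback :: "('o, 'm, 'z) cat_scheme \<Rightarrow> 'm \<Rightarrow> 'm \<Rightarrow> 'm \<Rightarrow> 'm \<Rightarrow> bool" where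
  "is_pullback C f g p q \<longleftrightarrow>
     f \<in> Ar C \<and> g \<in> Ar C \<and> Cod C f = Cod C g \<and>
     p \<in> Hom C (Dom C p) (Dom C f) \<and> q \<in> Hom C (Dom C p) (Dom C g) \<and>
     f \<cdot>\<^bsub>C\<^esub> p = g \<cdot>\<^bsub>C\<^esub> q \<and>
     (\<forall>W. \<forall>a \<in> Hom C W (Dom C f). \<forall>b \<in> Hom C W (Dom C g). f \<cdot>\<^bsub>C\<^esub> a = g \<cdot>\<^bsub>C\<^esub> b \<longrightarrow>
        (\<exists>!w. w \<in> Hom C W (Dom C p) \<and> p \<cdot>\<^bsub>C\<^esub> w = a \<and> q \<cdot>\<^bsub>C\<^esub> w = b))"

definition is_pushout :: "('o, 'm, 'z) cat_scheme \<Rightarrow> 'm \<Rightarrow> 'm \<Rightarrow> 'm \<Rightarrow> 'm \<Rightarrow> bool" where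
  "is_pushout C f g p q \<longleftrightarrow>
     f \<in> Ar C \<and> g \<in> Ar C \<and> Dom C f = Dom C g \<and>
     p \<in> Hom C (Cod C f) (Cod C p) \<and> q \<in> Hom C (Cod C g) (Cod C p) \<and>
     p \<cdot>\<^bsub>C\<^esub> f = q \<cdot>\<^bsub>C\<^esub> g \<and>
     (\<forall>W. \<forall>a \<in> Hom C (Cod C f) W. \<forall>b \<in> Hom C (Cod C g) W. a \<cdot>\<^bsub>C\<^esub> f = b \<cdot>\<^bsub>C\<^esub> g \<longrightarrow>
        (\<exists>!w. w \<in> Hom C (Cod C p) W \<and> w \<cdot>\<^bsub>C\<^esub> p = a \<and> w \<cdot>\<^bsub>C\<^esub> q = b))"


subsection \<open>Orthogonality and factorization systems\<close>

definition orthogonal :: "('o, 'm, 'z) cat_scheme \<Rightarrow> 'm \<Rightarrow> 'm \<Rightarrow> bool" where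
  "orthogonal C f g \<longleftrightarrow>
     (\<forall>u \<in> Hom C (Dom C f) (Dom C g). \<forall>v \<in> Hom C (Cod C f) (Cod C g).
        v \<cdot>\<^bsub>C\<^esub> f = g \<cdot>\<^bsub>C\<^esub> u \<longrightarrow>
        (\<exists>!w. w \<in> Hom C (Cod C f) (Dom C g) \<and> v = g \<cdot>\<^bsub>C\<^esub> w \<and> u = w \<cdot>\<^bsub>C\<^esub> f))"

text \<open>\<open>orth_up C H\<close> is \<open>H\<^sup>\<up>\<close> and \<open>orth_down C H\<close> is \<open>H\<^sup>\<down>\<close>.\<close>

definition orth_up :: "('o, 'm, 'z) cat_scheme \<Rightarrow> 'm set \<Rightarrow> 'm set" where
  "orth_up C H = {f \<in> Ar C. \<forall>h \<in> H. orthogonal C f h}"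

definition orth_down :: "('o, 'm, 'z) cat_scheme \<Rightarrow> 'm set \<Rightarrow> 'm set" where
  "orth_down C H = {f \<in> Ar C. \<forall>h \<in> H. orthogonal C h f}"

definition factorization_system :: "('o, 'm, 'z) cat_scheme \<Rightarrow> 'm set \<Rightarrow> 'm set \<Rightarrow> bool" where
  "factorization_system C L R \<longleftrightarrow> R = orth_down C L \<and> L = orth_up C R \<and>
     (\<forall>f \<in> Ar C. \<exists>e \<in> L. \<exists>m \<in> R. Cod C e = Dom C m \<and> f = m \<cdot>\<^bsub>C\<^esub> e)"


section \<open>Contexts and admissible subobjects\<close>

record ('o, 'm) fact_cat = "('o, 'm) cat" +
  EE :: "'m set"
  MM :: "'m set"

text \<open>\<open>factors_through A f g\<close>: \<open>f = g \<cdot> k\<close> for some arrow \<open>k\<close>.\<close>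

definition factors_through :: "('o, 'm, 'z) cat_scheme \<Rightarrow> 'm \<Rightarrow> 'm \<Rightarrow> bool" where
  "factors_through A f g \<longleftrightarrow> (\<exists>k \<in> Hom A (Dom A f) (Dom A g). f = g \<cdot>\<^bsub>A\<^esub> k)"

text \<open>An admissible subobject is an equivalence class of \<open>MM\<close>-arrows; \<open>sub A m\<close> is the class
  of \<open>m\<close>.\<close>

definition sub :: "('o, 'm, 'z) fact_cat_scheme \<Rightarrow> 'm \<Rightarrow> 'm set" where
  "sub A m = {n \<in> MM A. Cod A n = Cod A m \<and> factors_through A m n \<and> factors_through A n m}"

definition Sub :: "('o, 'm, 'z) fact_cat_scheme \<Rightarrow> 'o \<Rightarrow> 'm set gorder" where
  "Sub A X = \<lparr> carrier = sub A ` {m \<in> MM A. Cod A m = X}, eq = (=),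
     le = (\<lambda>p q. \<exists>m \<in> p. \<exists>n \<in> q. factors_through A m n) \<rparr>"

locale pnbd_context = category A for A :: "('o, 'm, 'z) fact_cat_scheme" (structure) +
  assumes finitely_complete: "finitely_complete A"
    and finite_coproducts: "has_finite_coproducts A"
    and factorization: "factorization_system A (EE A) (MM A)"
    and EE_Epis: "EE A \<subseteq> Epis A"
    and MM_Monos: "MM A \<subseteq> Monos A"
    and Sub_complete: "X \<in> Ob A \<Longrightarrow> complete_lattice (Sub A X)"

text \<open>In a context each of the next four sets is a single equivalence class, because
  factorizations, pullbacks and initial objects are unique up to isomorphism: the \<open>M\<close>-part
  \<open>f\<^sup>M\<close> of an arrow, the smallest subobject \<open>\<sigma>\<close>, the inverse image \<open>f\<^sup>-\<^sup>1 n\<close> and the composite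
  \<open>m \<circ> a\<close> of a subobject \<open>a\<close> of \<open>Dom m\<close> with \<open>m \<in> MM A\<close>.\<close>

definition M_part :: "('o, 'm, 'z) fact_cat_scheme \<Rightarrow> 'm \<Rightarrow> 'm set" where
  "M_part A f = {m \<in> MM A. \<exists>e \<in> EE A. e \<in> Hom A (Dom A f) (Dom A m) \<and> f = m \<cdot>\<^bsub>A\<^esub> e}"

definition sub_bot :: "('o, 'm, 'z) fact_cat_scheme \<Rightarrow> 'o \<Rightarrow> 'm set" where
  "sub_bot A X = {m. \<exists>Z. is_initial A Z \<and> (\<exists>f \<in> Hom A Z X. m \<in> M_part A f)}"

definition inv_image_sub :: "('o, 'm, 'z) fact_cat_scheme \<Rightarrow> 'm \<Rightarrow> 'm set \<Rightarrow> 'm set" where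
  "inv_image_sub A f n = {k. \<exists>n' \<in> n. \<exists>h. is_pullback A f n' k h}"

definition comp_sub :: "('o, 'm, 'z) fact_cat_scheme \<Rightarrow> 'm \<Rightarrow> 'm set \<Rightarrow> 'm set" where
  "comp_sub A m a = {n. \<exists>a' \<in> a. n \<in> sub A (m \<cdot>\<^bsub>A\<^esub> a')}"


section \<open>Internal preneighbourhood spaces\<close>

text \<open>The meet of the empty set being the largest element, filters are non-empty.\<close>

definition Fil :: "('o, 'm, 'z) fact_cat_scheme \<Rightarrow> 'o \<Rightarrow> 'm set set set" where
  "Fil A X = {F. F \<subseteq> carrier (Sub A X) \<and>
     (\<forall>p \<in> F. \<forall>q \<in> carrier (Sub A X). p \<sqsubseteq>\<^bsub>Sub A X\<^esub> q \<longrightarrow> q \<in> F) \<and>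
     (\<forall>P. finite P \<and> P \<subseteq> F \<longrightarrow> \<Sqinter>\<^bsub>Sub A X\<^esub> P \<in> F)}"

type_synonym 'm system = "'m set \<Rightarrow> 'm set set"
type_synonym ('o, 'm) space = "'o \<times> 'm system"

text \<open>Preneighbourhood systems are extensional functions on \<open>Sub X\<close> (\<^term>\<open>undefined\<close> outside), so that
  equality of systems is equality of the underlying maps.\<close>

definition systems :: "('o, 'm, 'z) fact_cat_scheme \<Rightarrow> 'o \<Rightarrow> 'm system set" where
  "systems A X = {\<mu> \<in> carrier (Sub A X) \<rightarrow>\<^sub>E Fil A X.
     (\<forall>m \<in> carrier (Sub A X). \<forall>n \<in> carrier (Sub A X). m \<sqsubseteq>\<^bsub>Sub A X\<^esub> n \<longrightarrow> \<mu> n \<subseteq> \<mu> m) \<and>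
     \<mu> (sub_bot A X) = carrier (Sub A X) \<and>
     (\<forall>m \<in> carrier (Sub A X). \<forall>p \<in> \<mu> m. m \<sqsubseteq>\<^bsub>Sub A X\<^esub> p)}"

definition spaces :: "('o, 'm, 'z) fact_cat_scheme \<Rightarrow> ('o, 'm) space set" where
  "spaces A = {(X, \<mu>). X \<in> Ob A \<and> \<mu> \<in> systems A X}"

definition pnbd_morphism ::
  "('o, 'm, 'z) fact_cat_scheme \<Rightarrow> ('o, 'm) space \<Rightarrow> 'm \<Rightarrow> ('o, 'm) space \<Rightarrow> bool" where
  "pnbd_morphism A S f T \<longleftrightarrow> f \<in> Hom A (fst S) (fst T) \<and>
     (\<forall>u \<in> carrier (Sub A (fst T)). \<forall>p \<in> snd T u.
        inv_image_sub A f p \<in> snd S (inv_image_sub A f u))"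

text \<open>The system \<open>\<mu>|\<^sub>m\<close> on the domain of \<open>m \<in> MM A\<close>.\<close>

definition restricted :: "('o, 'm, 'z) fact_cat_scheme \<Rightarrow> 'm system \<Rightarrow> 'm \<Rightarrow> 'm system" where
  "restricted A \<mu> m = (\<lambda>a \<in> carrier (Sub A (Dom A m)).
     {u \<in> carrier (Sub A (Dom A m)).
        \<exists>v \<in> \<mu> (comp_sub A m a). inv_image_sub A m v \<sqsubseteq>\<^bsub>Sub A (Dom A m)\<^esub> u})"

text \<open>\<open>Spc A\<close> has all arrows of \<open>A\<close> between (the objects underlying) preneighbourhood
  spaces; \<open>pNbd A\<close> has the preneighbourhood morphisms only. An arrow carries its domain and
  codomain space.\<close>

definition Spc :: "('o, 'm, 'z) fact_cat_scheme \<Rightarrow>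
    (('o, 'm) space, ('o, 'm) space \<times> 'm \<times> ('o, 'm) space) cat" where
  "Spc A = \<lparr> Ob = spaces A,
     Ar = {(S, f, T). S \<in> spaces A \<and> T \<in> spaces A \<and> f \<in> Hom A (fst S) (fst T)},
     Dom = (\<lambda>(S, f, T). S), Cod = (\<lambda>(S, f, T). T), Id = (\<lambda>S. (S, Id A (fst S), S)),
     Comp = (\<lambda>(T', g, U) (S, f, T). (S, g \<cdot>\<^bsub>A\<^esub> f, U)) \<rparr>"

definition pNbd :: "('o, 'm, 'z) fact_cat_scheme \<Rightarrow>
    (('o, 'm) space, ('o, 'm) space \<times> 'm \<times> ('o, 'm) space) cat" where
  "pNbd A = (Spc A) \<lparr> Ar := {(S, f, T) \<in> Ar (Spc A). pnbd_morphism A S f T} \<rparr>"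

text \<open>\<open>final_system A P K \<pi>\<close>: \<open>\<pi>\<close> is the largest preneighbourhood system on \<open>P\<close>, for the
  pointwise order, making every \<open>k : S \<rightarrow> P\<close> with \<open>(S, k) \<in> K\<close> a preneighbourhood morphism.\<close>

definition final_system :: "('o, 'm, 'z) fact_cat_scheme \<Rightarrow> 'o \<Rightarrow>
    (('o, 'm) space \<times> 'm) set \<Rightarrow> 'm system \<Rightarrow> bool" where
  "final_system A P K \<pi> \<longleftrightarrow>
     \<pi> \<in> systems A P \<and> (\<forall>(S, k) \<in> K. pnbd_morphism A S k (P, \<pi>)) \<and>
     (\<forall>\<rho> \<in> systems A P. (\<forall>(S, k) \<in> K. pnbd_morphism A S k (P, \<rho>)) \<longrightarrow>
        (\<forall>u \<in> carrier (Sub A P). \<rho> u \<subseteq> \<pi> u))"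


section \<open>Closure, continuity, dense morphisms and closed embeddings\<close>

definition Far :: "('o, 'm, 'z) fact_cat_scheme \<Rightarrow> ('o, 'm) space \<Rightarrow> 'm set \<Rightarrow> 'm set set" where
  "Far A S p = {x \<in> carrier (Sub A (fst S)).
     \<exists>u \<in> snd S x. u \<sqinter>\<^bsub>Sub A (fst S)\<^esub> p = sub_bot A (fst S)}"

definition cl :: "('o, 'm, 'z) fact_cat_scheme \<Rightarrow> ('o, 'm) space \<Rightarrow> 'm set \<Rightarrow> 'm set" where
  "cl A S p = \<Squnion>\<^bsub>Sub A (fst S)\<^esub>
     {x \<in> carrier (Sub A (fst S)). \<not> p \<sqsubset>\<^bsub>Sub A (fst S)\<^esub> x \<and> x \<notin> Far A S p}"

definition closed_subs :: "('o, 'm, 'z) fact_cat_scheme \<Rightarrow> ('o, 'm) space \<Rightarrow> 'm set set" where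
  "closed_subs A S = {p \<in> carrier (Sub A (fst S)). cl A S p = p}"

definition cl_hat :: "('o, 'm, 'z) fact_cat_scheme \<Rightarrow> ('o, 'm) space \<Rightarrow> 'm set \<Rightarrow> 'm set" where
  "cl_hat A S p = \<Sqinter>\<^bsub>Sub A (fst S)\<^esub> {t \<in> closed_subs A S. p \<sqsubseteq>\<^bsub>Sub A (fst S)\<^esub> t}"

definition continuous_morphism ::
  "('o, 'm, 'z) fact_cat_scheme \<Rightarrow> ('o, 'm) space \<Rightarrow> 'm \<Rightarrow> ('o, 'm) space \<Rightarrow> bool" where
  "continuous_morphism A S f T \<longleftrightarrow> f \<in> Hom A (fst S) (fst T) \<and>
     (\<forall>t \<in> closed_subs A T. inv_image_sub A f t \<in> closed_subs A S)"

text \<open>\<open>MM\<close>-arrows \<open>m\<close> representing a closed subobject of the space \<open>T\<close>.\<close>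

definition closed_arrows :: "('o, 'm, 'z) fact_cat_scheme \<Rightarrow> ('o, 'm) space \<Rightarrow> 'm set" where
  "closed_arrows A T = {m \<in> MM A. Cod A m = fst T \<and> sub A m \<in> closed_subs A T}"

definition Dense :: "('o, 'm, 'z) fact_cat_scheme \<Rightarrow>
    (('o, 'm) space \<times> 'm \<times> ('o, 'm) space) set" where
  "Dense A = {(S, f, T) \<in> Ar (Spc A).
     \<forall>m \<in> closed_arrows A T. \<forall>h \<in> Hom A (fst S) (Dom A m). f = m \<cdot>\<^bsub>A\<^esub> h \<longrightarrow> m \<in> Isos A}"

text \<open>\<open>ClEmb A\<close> constrains the arrow and the codomain space only, as befits arrows of \<open>A\<close>. In
  \<open>pNbd A\<close> the domain of an embedding carries the restricted system.\<close>

definition ClEmb :: "('o, 'm, 'z) fact_cat_scheme \<Rightarrow>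
    (('o, 'm) space \<times> 'm \<times> ('o, 'm) space) set" where
  "ClEmb A = {(S, m, T) \<in> Ar (Spc A). m \<in> closed_arrows A T}"

definition pDense :: "('o, 'm, 'z) fact_cat_scheme \<Rightarrow>
    (('o, 'm) space \<times> 'm \<times> ('o, 'm) space) set" where
  "pDense A = Dense A \<inter> Ar (pNbd A)"

definition pClEmb :: "('o, 'm, 'z) fact_cat_scheme \<Rightarrow>
    (('o, 'm) space \<times> 'm \<times> ('o, 'm) space) set" where
  "pClEmb A = {(S, m, T) \<in> ClEmb A. S = (Dom A m, restricted A (snd T) m)}"

definition all_pnbd_continuous :: "('o, 'm, 'z) fact_cat_scheme \<Rightarrow> bool" where
  "all_pnbd_continuous A \<longleftrightarrow> (\<forall>(S, f, T) \<in> Ar (pNbd A). continuous_morphism A S f T)"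

end

theory Submission
  imports Defs
begin

text \<open>Everything rests on three facts about closed subobjects. The closure operation is monotone and
  increasing (\<open>cl_mono\<close>, \<open>cl_increasing\<close>), so closed subobjects are stable under meets and \<open>cl_hat\<close> is
  the closed hull. A closed subobject of a closed subobject is closed, for the restricted system
  (\<open>closed_subs_comp\<close>). The restricted system is the initial structure along the embedding
  (\<open>pnbd_into_restricted\<close>).

  An arrow is dense when the only closed subobject through which it factors is the whole space, that
  is, when the closed hull of its M-part is the whole space. For an arbitrary \<open>f\<close>, the closed hull
  \<open>c\<close> of its M-part gives \<open>f = c \<cdot> d\<close>, and \<open>d\<close> is dense, because a smaller closed subobject of
  the domain of \<open>c\<close> would be closed in the codomain of \<open>f\<close> and smaller than the hull
  (\<open>Dense_ClEmb_factorization\<close>). If all dense arrows are orthogonal to \<open>f\<close>, then so is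
  the dense part \<open>d\<close> of \<open>f\<close> itself, which therefore is invertible, and \<open>f\<close> is a closed embedding like
  \<open>c\<close>. Dually, an arrow orthogonal to a closed embedding through which it factors splits that
  embedding. This is (e).

  Continuity enters through \<open>Dense_factors_through\<close>: if \<open>d\<close> is dense, \<open>v\<close> continuous and \<open>v \<cdot> d\<close>
  factors through a closed \<open>m\<close>, then so does \<open>v\<close>, as the inverse image of \<open>m\<close> along \<open>v\<close> is closed and
  \<open>d\<close> factors through it. This gives (c) and the diagonals for (f). For (g) and (h) the lemma is
  applied to the components of a colimiting cocone, which are continuous for the final system: if
  the arrow in question factors through a closed \<open>m\<close>, then so does the whole cocone, and the
  universal property splits \<open>m\<close>.

  The categorical part works with representatives: for admissible subobjects, \<open>m \<le> n\<close> means that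
  \<open>m\<close> factors through \<open>n\<close>, inverse images are described by which arrows factor through them
  (\<open>inv_image_subE\<close>), and an \<open>M\<close>-arrow is an isomorphism when the identity factors through it.\<close>

section \<open>Monomorphisms and orthogonality\<close>

context category
begin

lemma Ar_Hom: "f \<in> Ar C \<Longrightarrow> f \<in> Hom C (Dom C f) (Cod C f)"
  by (simp add: Hom_def)

lemma HomD:
  assumes "f \<in> Hom C X Y"
  shows "f \<in> Ar C" "Dom C f = X" "Cod C f = Y" "X \<in> Ob C" "Y \<in> Ob C"
  using assms Dom_Ob Cod_Ob by (auto simp: Hom_def)

lemma Monos_cancel:
  assumes "m \<in> Monos C" "m \<in> Hom C X Y" "f \<in> Hom C W X" "g \<in> Hom C W X" "m \<cdot> f = m \<cdot> g"
  shows "f = g"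
  using assms by (auto simp: Monos_def Hom_def)

lemma factors_through_iff:
  assumes "f \<in> Hom C W X" "g \<in> Hom C M Y"
  shows "factors_through C f g \<longleftrightarrow> (\<exists>k \<in> Hom C W M. f = g \<cdot> k)"
  using assms by (simp add: factors_through_def HomD)

lemma factors_through_refl: "f \<in> Hom C W X \<Longrightarrow> factors_through C f f"
  by (metis HomD(2,4) Comp_Id_right Id_Hom factors_through_iff)

lemma factors_through_comp_right:
  assumes "f \<in> Hom C W X" "g \<in> Hom C M X" "h \<in> Hom C V W" "factors_through C f g"
  shows "factors_through C (f \<cdot> h) g"
proof -
  obtain k where k: "k \<in> Hom C W M" "f = g \<cdot> k"
    using assms factors_through_iff[OF assms(1,2)] by blast
  then have "f \<cdot> h = g \<cdot> (k \<cdot> h)" "k \<cdot> h \<in> Hom C V M"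
    using Comp_assoc[OF assms(3) k(1) assms(2)] Comp_Hom[OF assms(3) k(1)] by auto
  then show ?thesis
    using factors_through_iff[OF Comp_Hom[OF assms(3,1)] assms(2)] by blast
qed

lemma factors_through_comp_left:
  assumes "f \<in> Hom C W X" "g \<in> Hom C M X" "h \<in> Hom C X Y" "factors_through C f g"
  shows "factors_through C (h \<cdot> f) (h \<cdot> g)"
proof -
  obtain k where k: "k \<in> Hom C W M" "f = g \<cdot> k"
    using assms factors_through_iff[OF assms(1,2)] by blast
  then have "h \<cdot> f = (h \<cdot> g) \<cdot> k"
    using Comp_assoc[OF k(1) assms(2,3)] by simp
  then show ?thesis
    using k factors_through_iff[OF Comp_Hom[OF assms(1,3)] Comp_Hom[OF assms(2,3)]] by blast
qed

lemma factors_through_comp_cancel: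
  assumes "m \<in> Monos C" "m \<in> Hom C X Y" "f \<in> Hom C W X" "g \<in> Hom C M X"
    "factors_through C (m \<cdot> f) (m \<cdot> g)"
  shows "factors_through C f g"
proof -
  obtain k where k: "k \<in> Hom C W M" "m \<cdot> f = (m \<cdot> g) \<cdot> k"
    using factors_through_iff[OF Comp_Hom[OF assms(3,2)] Comp_Hom[OF assms(4,2)]] assms(5) by blast
  then have "f = g \<cdot> k"
    using Monos_cancel[OF assms(1,2,3) Comp_Hom[OF k(1) assms(4)]]
      Comp_assoc[OF k(1) assms(4,2)] by simp
  then show ?thesis
    using k factors_through_iff[OF assms(3,4)] by blast
qed

lemma factors_through_trans:
  assumes "f \<in> Hom C W X" "g \<in> Hom C M X" "h \<in> Hom C N X"
    "factors_through C f g" "factors_through C g h"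
  shows "factors_through C f h"
proof -
  obtain k where k: "k \<in> Hom C W M" "f = g \<cdot> k"
    using assms factors_through_iff[OF assms(1,2)] by blast
  then show ?thesis
    using factors_through_comp_right[OF assms(2,3) k(1) assms(5)] by simp
qed

lemma Monos_comp:
  assumes "m \<in> Monos C" "m \<in> Hom C X Y" "n \<in> Monos C" "n \<in> Hom C W X"
  shows "m \<cdot> n \<in> Monos C"
proof -
  have mn: "m \<cdot> n \<in> Hom C W Y"
    using assms Comp_Hom by blast
  have "f = g" if "f \<in> Hom C V W" "g \<in> Hom C V W" "(m \<cdot> n) \<cdot> f = (m \<cdot> n) \<cdot> g" for V f g
  proof -
    have "m \<cdot> (n \<cdot> f) = m \<cdot> (n \<cdot> g)"
      using that(3) Comp_assoc[OF that(1) assms(4,2)] Comp_assoc[OF that(2) assms(4,2)] by simp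
    then have "n \<cdot> f = n \<cdot> g"
      using Monos_cancel[OF assms(1,2) Comp_Hom[OF that(1) assms(4)] Comp_Hom[OF that(2) assms(4)]]
      by simp
    then show ?thesis
      using Monos_cancel[OF assms(3,4) that(1,2)] by simp
  qed
  then show ?thesis
    using mn HomD[OF mn] unfolding Monos_def by auto
qed

lemma Monos_cancel_right:
  assumes "m \<in> Hom C X Y" "n \<in> Hom C W X" "m \<cdot> n \<in> Monos C"
  shows "n \<in> Monos C"
proof -
  have "f = g" if "f \<in> Hom C V W" "g \<in> Hom C V W" "n \<cdot> f = n \<cdot> g" for V f g
  proof -
    have "(m \<cdot> n) \<cdot> f = (m \<cdot> n) \<cdot> g"
      using that(3) Comp_assoc[OF that(1) assms(2,1)] Comp_assoc[OF that(2) assms(2,1)] by simp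
    then show ?thesis
      using Monos_cancel[OF assms(3) Comp_Hom[OF assms(2,1)] that(1,2)] by simp
  qed
  then show ?thesis
    using HomD[OF assms(2)] unfolding Monos_def by auto
qed

lemma IsosI:
  assumes "f \<in> Hom C X Y" "g \<in> Hom C Y X" "g \<cdot> f = Id C X" "f \<cdot> g = Id C Y"
  shows "f \<in> Isos C"
  using assms HomD[OF assms(1)] unfolding Isos_def by auto

lemma IsosE:
  assumes "f \<in> Isos C" "f \<in> Hom C X Y"
  obtains g where "g \<in> Hom C Y X" "g \<cdot> f = Id C X" "f \<cdot> g = Id C Y"
  using assms HomD[OF assms(2)] unfolding Isos_def by auto

lemma Isos_Monos:
  assumes "f \<in> Isos C"
  shows "f \<in> Monos C"
proof -
  have f: "f \<in> Hom C (Dom C f) (Cod C f)"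
    using assms by (auto simp: Isos_def Ar_Hom)
  obtain g where g: "g \<in> Hom C (Cod C f) (Dom C f)" "g \<cdot> f = Id C (Dom C f)"
    using IsosE[OF assms f] by metis
  have "a = b" if "a \<in> Hom C W (Dom C f)" "b \<in> Hom C W (Dom C f)" "f \<cdot> a = f \<cdot> b" for W a b
    using Comp_assoc[OF that(1) f g(1)] Comp_assoc[OF that(2) f g(1)] that(3) g(2)
      Comp_Id_left[OF that(1)] Comp_Id_left[OF that(2)] by simp
  then show ?thesis
    using HomD(1)[OF f] unfolding Monos_def by auto
qed

lemma Monos_Isos_iff:
  assumes "m \<in> Monos C" "m \<in> Hom C X Y"
  shows "m \<in> Isos C \<longleftrightarrow> factors_through C (Id C Y) m"
proof -
  have id: "Id C Y \<in> Hom C Y Y"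
    using Id_Hom[OF HomD(5)[OF assms(2)]] .
  show ?thesis
  proof
    assume "m \<in> Isos C"
    then show "factors_through C (Id C Y) m"
      using IsosE[OF _ assms(2)] factors_through_iff[OF id assms(2)] by metis
  next
    assume "factors_through C (Id C Y) m"
    then obtain k where k: "k \<in> Hom C Y X" "Id C Y = m \<cdot> k"
      using factors_through_iff[OF id assms(2)] by blast
    have "m \<cdot> (k \<cdot> m) = m \<cdot> Id C X"
      using Comp_assoc[OF assms(2) k(1) assms(2)] k(2) Comp_Id_left[OF assms(2)]
        Comp_Id_right[OF assms(2)] by simp
    then have "k \<cdot> m = Id C X"
      using Monos_cancel[OF assms Comp_Hom[OF assms(2) k(1)] Id_Hom[OF HomD(4)[OF assms(2)]]] by simp
    then show "m \<in> Isos C"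
      using IsosI[OF assms(2) k(1)] k(2) by simp
  qed
qed

text \<open>Against a monomorphism the diagonal is unique, and its upper triangle commutes as soon as
  the lower one does. Orthogonality becomes a statement about factoring alone.\<close>

lemma orthogonal_Monos_iff:
  assumes f: "f \<in> Hom C X Y" and g: "g \<in> Hom C P Q" "g \<in> Monos C"
  shows "orthogonal C f g \<longleftrightarrow>
    (\<forall>v \<in> Hom C Y Q. factors_through C (v \<cdot> f) g \<longrightarrow> factors_through C v g)" (is "?L \<longleftrightarrow> ?R")
proof
  assume L: ?L
  show ?R
  proof (intro ballI impI)
    fix v assume v: "v \<in> Hom C Y Q" and fac: "factors_through C (v \<cdot> f) g"
    then obtain u where "u \<in> Hom C X P" "v \<cdot> f = g \<cdot> u"
      using factors_through_iff[OF Comp_Hom[OF f v] g(1)] by metis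
    then have "\<exists>w \<in> Hom C Y P. v = g \<cdot> w"
      using L v unfolding orthogonal_def HomD(2,3)[OF f] HomD(2,3)[OF g(1)] by blast
    then show "factors_through C v g"
      using factors_through_iff[OF v g(1)] by metis
  qed
next
  assume R: ?R
  show ?L
    unfolding orthogonal_def HomD(2,3)[OF f] HomD(2,3)[OF g(1)]
  proof (intro ballI impI)
    fix u v assume u: "u \<in> Hom C X P" and v: "v \<in> Hom C Y Q" and eq: "v \<cdot> f = g \<cdot> u"
    then have "factors_through C (v \<cdot> f) g"
      using factors_through_iff[OF Comp_Hom[OF f v] g(1)] by metis
    then obtain w where w: "w \<in> Hom C Y P" "v = g \<cdot> w"
      using R v factors_through_iff[OF v g(1)] by metis
    have "g \<cdot> u = g \<cdot> (w \<cdot> f)"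
      using w(2) eq Comp_assoc[OF f w(1) g(1)] by simp
    then have "u = w \<cdot> f"
      using Monos_cancel[OF g(2,1) u Comp_Hom[OF f w(1)]] by simp
    moreover have "w' = w" if "w' \<in> Hom C Y P" "v = g \<cdot> w'" for w'
      using Monos_cancel[OF g(2,1) that(1) w(1)] that(2) w(2) by simp
    ultimately show "\<exists>!w. w \<in> Hom C Y P \<and> v = g \<cdot> w \<and> u = w \<cdot> f"
      using w by metis
  qed
qed

lemma factors_through_pullback_iff:
  assumes pb: "is_pullback C f n k h" and a: "a \<in> Hom C W (Dom C f)"
  shows "factors_through C a k \<longleftrightarrow> factors_through C (f \<cdot> a) n"
proof -
  define P where "P = Dom C k"
  have f: "f \<in> Hom C (Dom C f) (Cod C n)" and n: "n \<in> Hom C (Dom C n) (Cod C n)"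
    and k: "k \<in> Hom C P (Dom C f)" and h: "h \<in> Hom C P (Dom C n)" and sq: "f \<cdot> k = n \<cdot> h"
    using pb unfolding is_pullback_def P_def by (auto simp: Hom_def)
  have univ: "\<exists>w. w \<in> Hom C W P \<and> k \<cdot> w = a" if "b \<in> Hom C W (Dom C n)" "f \<cdot> a = n \<cdot> b" for b
    using pb that a unfolding is_pullback_def P_def by blast
  have fa: "f \<cdot> a \<in> Hom C W (Cod C n)"
    using a f Comp_Hom by blast
  show ?thesis
  proof
    assume "factors_through C a k"
    then have "factors_through C (f \<cdot> a) (f \<cdot> k)"
      using a k f factors_through_comp_left by blast
    then obtain w where w: "w \<in> Hom C W P" "f \<cdot> a = (n \<cdot> h) \<cdot> w"
      using factors_through_iff[OF fa Comp_Hom[OF k f]] sq by auto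
    then have "f \<cdot> a = n \<cdot> (h \<cdot> w)" "h \<cdot> w \<in> Hom C W (Dom C n)"
      using Comp_assoc[OF w(1) h n] Comp_Hom[OF w(1) h] by auto
    then show "factors_through C (f \<cdot> a) n"
      using factors_through_iff[OF fa n] by metis
  next
    assume "factors_through C (f \<cdot> a) n"
    then show "factors_through C a k"
      using univ factors_through_iff[OF fa n] factors_through_iff[OF a k] by metis
  qed
qed

lemma pullback_Monos:
  assumes pb: "is_pullback C f n k h" and "n \<in> Monos C"
  shows "k \<in> Monos C"
proof -
  define P where "P = Dom C k"
  have f: "f \<in> Hom C (Dom C f) (Cod C n)" and n: "n \<in> Hom C (Dom C n) (Cod C n)"
    and k: "k \<in> Hom C P (Dom C f)" and h: "h \<in> Hom C P (Dom C n)" and sq: "f \<cdot> k = n \<cdot> h"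
    using pb unfolding is_pullback_def P_def by (auto simp: Hom_def)
  have "a = b" if a: "a \<in> Hom C W P" and b: "b \<in> Hom C W P" and eq: "k \<cdot> a = k \<cdot> b" for W a b
  proof -
    have "n \<cdot> (h \<cdot> a) = n \<cdot> (h \<cdot> b)"
      using Comp_assoc[OF a h n] Comp_assoc[OF b h n] Comp_assoc[OF a k f] Comp_assoc[OF b k f] eq sq
      by simp
    then have hab: "h \<cdot> a = h \<cdot> b"
      using Monos_cancel[OF assms(2) n Comp_Hom[OF a h] Comp_Hom[OF b h]] by simp
    have "f \<cdot> (k \<cdot> a) = n \<cdot> (h \<cdot> a)"
      using Comp_assoc[OF a h n] Comp_assoc[OF a k f] sq by simp
    then have "\<exists>!w. w \<in> Hom C W P \<and> k \<cdot> w = k \<cdot> a \<and> h \<cdot> w = h \<cdot> a"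
      using pb a k h Comp_Hom unfolding is_pullback_def P_def by blast
    then show "a = b"
      using a b eq hab by metis
  qed
  then show ?thesis
    using HomD(1)[OF k] unfolding Monos_def P_def by auto
qed

end


section \<open>Pullbacks and initial objects\<close>

text \<open>The shape of a cospan. Identities carry the numbers of their objects; the two legs are the arrows 3 and 4. In a
  composite at most one factor is not an identity, and the first argument of \<open>Comp\<close> is kept
  exactly when the second one is an identity.\<close>

definition cospan :: "(nat, nat) cat" where
  "cospan = \<lparr> Ob = {0, 1, 2}, Ar = {0, 1, 2, 3, 4},
     Dom = (\<lambda>a. if a \<le> 2 then a else if a = 3 then 0 else 1),
     Cod = (\<lambda>a. if a \<le> 2 then a else 2),
     Id = (\<lambda>i. i), Comp = (\<lambda>b a. if a \<le> 2 then b else a) \<rparr>"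

lemma category_cospan: "category cospan"
  unfolding category_def Hom_def cospan_def by auto

lemma (in category) pullback_exists:
  assumes lim: "finitely_complete C" and f: "f \<in> Hom C X Z" and g: "g \<in> Hom C Y Z"
  shows "\<exists>p q. is_pullback C f g p q"
proof -
  define Fo where "Fo = (\<lambda>i::nat. if i = 0 then X else if i = 1 then Y else Z)"
  define Fa where "Fa = (\<lambda>a::nat. if a = 3 then f else if a = 4 then g else Id C (Fo a))"
  have ids: "Id C X \<in> Hom C X X" "Id C Y \<in> Hom C Y Y" "Id C Z \<in> Hom C Z Z"
    using HomD[OF f] HomD[OF g] Id_Hom by auto
  have "is_functor cospan C Fo Fa"
    unfolding is_functor_def cospan_def Fo_def Fa_def
    using f g HomD[OF f] HomD[OF g] ids Comp_Id_left Comp_Id_right by auto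
  moreover have "finite (Ob cospan)" "finite (Ar cospan)"
    by (auto simp: cospan_def)
  ultimately obtain L \<pi> where lim: "is_limit cospan C Fo Fa L \<pi>"
    using lim category_cospan unfolding finitely_complete_def by blast
  then have "is_cone cospan C Fo Fa L \<pi>"
    by (simp add: is_limit_def)
  then have \<pi>: "\<pi> 0 \<in> Hom C L X" "\<pi> 1 \<in> Hom C L Y" "f \<cdot> \<pi> 0 = \<pi> 2" "g \<cdot> \<pi> 1 = \<pi> 2"
    unfolding is_cone_def cospan_def Fo_def Fa_def by auto
  have univ: "\<exists>!w. w \<in> Hom C W L \<and> \<pi> 0 \<cdot> w = a \<and> \<pi> 1 \<cdot> w = b"
    if a: "a \<in> Hom C W X" and b: "b \<in> Hom C W Y" and eq: "f \<cdot> a = g \<cdot> b" for W a b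
  proof -
    define \<kappa> where "\<kappa> = (\<lambda>i::nat. if i = 0 then a else if i = 1 then b else f \<cdot> a)"
    have fa: "f \<cdot> a \<in> Hom C W Z"
      using a f Comp_Hom by blast
    have "is_cone cospan C Fo Fa W \<kappa>"
      unfolding is_cone_def cospan_def Fo_def Fa_def \<kappa>_def
      using a b eq fa HomD[OF a] Comp_Id_left by auto
    then have "\<exists>!w. w \<in> Hom C W L \<and> (\<forall>i \<in> Ob cospan. \<pi> i \<cdot> w = \<kappa> i)"
      using lim unfolding is_limit_def by blast
    moreover have "(\<forall>i \<in> Ob cospan. \<pi> i \<cdot> w = \<kappa> i) \<longleftrightarrow> \<pi> 0 \<cdot> w = a \<and> \<pi> 1 \<cdot> w = b"
      if w: "w \<in> Hom C W L" for w
    proof -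
      have "\<pi> 2 \<cdot> w = f \<cdot> (\<pi> 0 \<cdot> w)"
        using Comp_assoc[OF w \<pi>(1) f] \<pi>(3) by simp
      then show ?thesis
        unfolding cospan_def \<kappa>_def by auto
    qed
    ultimately show ?thesis
      by metis
  qed
  have "is_pullback C f g (\<pi> 0) (\<pi> 1)"
    unfolding is_pullback_def
    using f g \<pi> univ HomD[OF f] HomD[OF g] HomD[OF \<pi>(1)] by auto
  then show ?thesis
    by blast
qed

lemma (in category) initial_exists:
  assumes "has_finite_coproducts C"
  shows "\<exists>Z. is_initial C Z"
proof -
  obtain L \<iota> where "is_coproduct C ({} :: nat set) (\<lambda>_. undefined) L \<iota>"
    using assms unfolding has_finite_coproducts_def by blast
  then show ?thesis
    unfolding is_coproduct_def is_initial_def by auto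
qed


section \<open>Closure properties of admissible monomorphisms\<close>

context pnbd_context
begin

lemma MM_Hom: "m \<in> MM A \<Longrightarrow> m \<in> Hom A (Dom A m) (Cod A m)"
  using MM_Monos by (auto simp: Monos_def Hom_def)

lemma EE_Hom: "e \<in> EE A \<Longrightarrow> e \<in> Hom A (Dom A e) (Cod A e)"
  using EE_Epis by (auto simp: Epis_def Hom_def)

lemma MM_mono: "m \<in> MM A \<Longrightarrow> m \<in> Monos A"
  using MM_Monos by auto

lemma MM_iff:
  assumes "m \<in> Monos A" "m \<in> Hom A M X"
  shows "m \<in> MM A \<longleftrightarrow> (\<forall>e \<in> EE A. \<forall>v \<in> Hom A (Cod A e) X.
    factors_through A (v \<cdot> e) m \<longrightarrow> factors_through A v m)"
proof -
  have "MM A = orth_down A (EE A)"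
    using factorization unfolding factorization_system_def by (elim conjE)
  then have "m \<in> MM A \<longleftrightarrow> (\<forall>e \<in> EE A. orthogonal A e m)"
    using HomD(1)[OF assms(2)] by (auto simp: orth_down_def)
  also have "\<dots> \<longleftrightarrow> (\<forall>e \<in> EE A. \<forall>v \<in> Hom A (Cod A e) X.
    factors_through A (v \<cdot> e) m \<longrightarrow> factors_through A v m)"
    by (intro ball_cong refl orthogonal_Monos_iff[OF EE_Hom assms(2,1)])
  finally show ?thesis .
qed

lemma MM_diagonal:
  assumes "e \<in> EE A" "m \<in> MM A" "v \<in> Hom A (Cod A e) (Cod A m)" "factors_through A (v \<cdot> e) m"
  shows "factors_through A v m"
  using assms MM_iff[OF MM_mono MM_Hom] by blast

lemma EE_I:
  assumes "e \<in> Hom A W X"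
    and "\<And>m v. \<lbrakk>m \<in> MM A; v \<in> Hom A X (Cod A m); factors_through A (v \<cdot> e) m\<rbrakk>
      \<Longrightarrow> factors_through A v m"
  shows "e \<in> EE A"
proof -
  have "EE A = orth_up A (MM A)"
    using factorization unfolding factorization_system_def by (elim conjE)
  then show ?thesis
    using assms orthogonal_Monos_iff[OF assms(1) MM_Hom MM_mono] HomD(1)[OF assms(1)]
    by (auto simp: orth_up_def)
qed

lemma factorizationE:
  assumes "f \<in> Hom A X Y"
  obtains e m where "e \<in> EE A" "m \<in> MM A" "e \<in> Hom A X (Dom A m)" "Cod A m = Y" "f = m \<cdot> e"
proof -
  obtain e m where em: "e \<in> EE A" "m \<in> MM A" "Cod A e = Dom A m" "f = m \<cdot> e"
    using factorization HomD(1)[OF assms] unfolding factorization_system_def by blast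
  have e: "e \<in> Hom A (Dom A e) (Dom A m)"
    using EE_Hom[OF em(1)] em(3) by simp
  then have "f \<in> Hom A (Dom A e) (Cod A m)"
    using Comp_Hom[OF _ MM_Hom[OF em(2)]] em(4) by simp
  then have "Dom A e = X" "Cod A m = Y"
    using assms by (auto simp: Hom_def)
  then show ?thesis
    using em e that by simp
qed

lemma MM_Isos:
  assumes "m \<in> Isos A"
  shows "m \<in> MM A"
proof -
  have m: "m \<in> Hom A (Dom A m) (Cod A m)" "m \<in> Monos A"
    using Isos_Monos[OF assms] by (auto simp: Monos_def Ar_Hom)
  obtain g where g: "g \<in> Hom A (Cod A m) (Dom A m)" "m \<cdot> g = Id A (Cod A m)"
    using IsosE[OF assms m(1)] by metis
  have "factors_through A v m" if v: "v \<in> Hom A W (Cod A m)" for v W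
    using factors_through_iff[OF v m(1)] Comp_assoc[OF v g(1) m(1)] g(2) Comp_Id_left[OF v]
      Comp_Hom[OF v g(1)] by metis
  then show ?thesis
    using MM_iff[OF m(2,1)] by blast
qed

lemma MM_Id: "X \<in> Ob A \<Longrightarrow> Id A X \<in> MM A"
  using MM_Isos IsosI Id_Hom Comp_Id_left by metis

lemma MM_comp:
  assumes "m \<in> MM A" "n \<in> MM A" "Cod A n = Dom A m"
  shows "m \<cdot> n \<in> MM A"
proof -
  have m: "m \<in> Hom A (Dom A m) (Cod A m)" and n: "n \<in> Hom A (Dom A n) (Dom A m)"
    using MM_Hom assms by metis+
  note mn = Comp_Hom[OF n m]
  have "factors_through A v (m \<cdot> n)"
    if e: "e \<in> EE A" and v: "v \<in> Hom A (Cod A e) (Cod A m)"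
      and fac: "factors_through A (v \<cdot> e) (m \<cdot> n)" for e v
  proof -
    note ve = Comp_Hom[OF EE_Hom[OF e] v]
    obtain u where u: "u \<in> Hom A (Dom A e) (Dom A n)" "v \<cdot> e = m \<cdot> n \<cdot> u"
      using fac factors_through_iff[OF ve mn] by blast
    then have "v \<cdot> e = m \<cdot> (n \<cdot> u)"
      using Comp_assoc[OF u(1) n m] by simp
    then have "factors_through A (v \<cdot> e) m"
      using Comp_Hom[OF u(1) n] factors_through_iff[OF ve m] by blast
    then obtain w where w: "w \<in> Hom A (Cod A e) (Dom A m)" "v = m \<cdot> w"
      using MM_diagonal[OF e assms(1) v] factors_through_iff[OF v m] by blast
    have "factors_through A (m \<cdot> (w \<cdot> e)) (m \<cdot> n)"
      using fac w(2) Comp_assoc[OF EE_Hom[OF e] w(1) m] by simp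
    then have "factors_through A (w \<cdot> e) n"
      using factors_through_comp_cancel[OF MM_mono[OF assms(1)] m Comp_Hom[OF EE_Hom[OF e] w(1)] n]
      by simp
    then have "factors_through A w n"
      using MM_diagonal[OF e assms(2), of w] w(1) assms(3) by simp
    then show ?thesis
      using factors_through_comp_left[OF w(1) n m] w(2) by simp
  qed
  then show ?thesis
    using MM_iff[OF Monos_comp[OF MM_mono[OF assms(1)] m MM_mono[OF assms(2)] n] mn] by blast
qed

lemma MM_cancel:
  assumes "m \<in> MM A" "n \<in> Hom A W (Dom A m)" "m \<cdot> n \<in> MM A"
  shows "n \<in> MM A"
proof -
  note m = MM_Hom[OF assms(1)]
  note mn = Comp_Hom[OF assms(2) m]
  have "factors_through A v n"
    if e: "e \<in> EE A" and v: "v \<in> Hom A (Cod A e) (Dom A m)"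
      and fac: "factors_through A (v \<cdot> e) n" for e v
  proof -
    have "factors_through A (m \<cdot> v \<cdot> e) (m \<cdot> n)"
      using factors_through_comp_left[OF Comp_Hom[OF EE_Hom[OF e] v] assms(2) m fac]
        Comp_assoc[OF EE_Hom[OF e] v m] by simp
    then have "factors_through A (m \<cdot> v) (m \<cdot> n)"
      using MM_diagonal[OF e assms(3), of "m \<cdot> v"] HomD(3)[OF mn] Comp_Hom[OF v m] by simp
    then show ?thesis
      using factors_through_comp_cancel[OF MM_mono[OF assms(1)] m v assms(2)] by simp
  qed
  then show ?thesis
    using MM_iff[OF Monos_cancel_right[OF m assms(2) MM_mono[OF assms(3)]] assms(2)] by blast
qed

lemma MM_pullback:
  assumes pb: "is_pullback A f n k h" and n: "n \<in> MM A"
  shows "k \<in> MM A"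
proof -
  have f: "f \<in> Hom A (Dom A f) (Cod A n)" and k: "k \<in> Hom A (Dom A k) (Dom A f)"
    using pb unfolding is_pullback_def by (auto simp: Hom_def)
  have "factors_through A v k"
    if e: "e \<in> EE A" and v: "v \<in> Hom A (Cod A e) (Dom A f)"
      and fac: "factors_through A (v \<cdot> e) k" for e v
  proof -
    have "factors_through A (f \<cdot> v \<cdot> e) n"
      using factors_through_pullback_iff[OF pb Comp_Hom[OF EE_Hom[OF e] v]] fac
        Comp_assoc[OF EE_Hom[OF e] v f] by simp
    then have "factors_through A (f \<cdot> v) n"
      using MM_diagonal[OF e n Comp_Hom[OF v f]] by simp
    then show ?thesis
      using factors_through_pullback_iff[OF pb v] by simp
  qed
  then show ?thesis
    using MM_iff[OF pullback_Monos[OF pb MM_mono[OF n]] k] by blast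
qed

section \<open>The order on subobjects\<close>

abbreviation MM_to :: "'o \<Rightarrow> 'm set" where
  "MM_to X \<equiv> {m \<in> MM A. Cod A m = X}"

lemma MM_toD:
  assumes "m \<in> MM_to X"
  shows "m \<in> Hom A (Dom A m) X"
  using assms MM_Hom by auto

lemma Id_MM_to: "X \<in> Ob A \<Longrightarrow> Id A X \<in> MM_to X"
  using MM_Id HomD(3)[OF Id_Hom] by simp

lemma factors_through_Id: "f \<in> Hom A X Y \<Longrightarrow> factors_through A f (Id A Y)"
  using factors_through_iff[OF _ Id_Hom[OF HomD(5)]] Comp_Id_left by metis

lemma sub_in_carrier: "m \<in> MM_to X \<Longrightarrow> sub A m \<in> carrier (Sub A X)"
  by (auto simp: Sub_def)

lemma Sub_cases:
  assumes "p \<in> carrier (Sub A X)"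
  obtains m where "m \<in> MM_to X" "p = sub A m"
  using assms by (auto simp: Sub_def)

lemma mem_sub_iff:
  "m \<in> MM_to X \<Longrightarrow> n \<in> sub A m \<longleftrightarrow>
    n \<in> MM_to X \<and> factors_through A m n \<and> factors_through A n m"
  by (auto simp: sub_def)

lemma sub_self: "m \<in> MM_to X \<Longrightarrow> m \<in> sub A m"
  using factors_through_refl[OF MM_Hom] by (auto simp: sub_def)

lemma sub_le_iff:
  assumes "m \<in> MM_to X" "n \<in> MM_to X"
  shows "sub A m \<sqsubseteq>\<^bsub>Sub A X\<^esub> sub A n \<longleftrightarrow> factors_through A m n"
proof
  assume "sub A m \<sqsubseteq>\<^bsub>Sub A X\<^esub> sub A n"
  then obtain m' n' where mn: "m' \<in> sub A m" "n' \<in> sub A n" "factors_through A m' n'"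
    by (auto simp: Sub_def)
  then have "m' \<in> MM_to X" "n' \<in> MM_to X" "factors_through A m m'" "factors_through A n' n"
    using assms by (auto simp: sub_def)
  then show "factors_through A m n"
    using factors_through_trans[OF MM_toD MM_toD MM_toD] assms mn(3) by meson
next
  assume "factors_through A m n"
  then show "sub A m \<sqsubseteq>\<^bsub>Sub A X\<^esub> sub A n"
    using assms[THEN sub_self] by (auto simp: Sub_def)
qed

lemma sub_eq_iff:
  assumes "m \<in> MM_to X" "n \<in> MM_to X"
  shows "sub A m = sub A n \<longleftrightarrow> factors_through A m n \<and> factors_through A n m"
proof
  assume "sub A m = sub A n"
  then have "m \<in> sub A n"
    using sub_self[OF assms(1)] by simp
  then show "factors_through A m n \<and> factors_through A n m"
    by (simp add: sub_def)
next
  assume eq: "factors_through A m n \<and> factors_through A n m"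
  have "factors_through A m k \<longleftrightarrow> factors_through A n k" if "k \<in> MM_to X" for k
    using factors_through_trans[OF MM_toD MM_toD MM_toD] that assms eq by meson
  moreover have "factors_through A k m \<longleftrightarrow> factors_through A k n" if "k \<in> MM_to X" for k
    using factors_through_trans[OF MM_toD MM_toD MM_toD] that assms eq by meson
  ultimately show "sub A m = sub A n"
    using assms by (auto simp: sub_def)
qed

lemma sub_eqI:
  assumes "m \<in> MM_to X" "K \<subseteq> MM_to X" "m \<in> K"
    and "\<And>k. k \<in> K \<Longrightarrow> factors_through A m k \<and> factors_through A k m"
    and "\<And>k. k \<in> MM_to X \<Longrightarrow> factors_through A m k \<Longrightarrow> factors_through A k m \<Longrightarrow> k \<in> K"
  shows "K = sub A m"
proof (rule Set.set_eqI)
  fix k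
  show "k \<in> K \<longleftrightarrow> k \<in> sub A m"
    unfolding mem_sub_iff[OF assms(1)] using assms(2,4,5) by blast
qed

lemma sub_Id_top:
  assumes "X \<in> Ob A" "p \<in> carrier (Sub A X)"
  shows "p \<sqsubseteq>\<^bsub>Sub A X\<^esub> sub A (Id A X)"
proof -
  have id: "Id A X \<in> MM_to X"
    by (rule Id_MM_to[OF assms(1)])
  obtain m where m: "m \<in> MM_to X" "p = sub A m"
    by (rule Sub_cases[OF assms(2)])
  then show ?thesis
    using sub_le_iff[OF m(1) id] factors_through_Id[OF MM_toD[OF m(1)]] by simp
qed

lemma Isos_iff_sub_Id:
  assumes "m \<in> MM_to X" "X \<in> Ob A"
  shows "m \<in> Isos A \<longleftrightarrow> sub A m = sub A (Id A X)"
proof -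
  have "m \<in> Monos A"
    using assms(1) MM_mono by blast
  then show ?thesis
    using Monos_Isos_iff[OF _ MM_toD[OF assms(1)]] sub_eq_iff[OF assms(1) Id_MM_to[OF assms(2)]]
      factors_through_Id[OF MM_toD[OF assms(1)]] by simp
qed

section \<open>The M-part and the smallest subobject\<close>

text \<open>Two \<open>(E, M)\<close>-factorizations of one arrow are compared by the diagonal property in both
  directions. Conversely an equivalent \<open>M\<close>-arrow \<open>k = m \<cdot> j\<close> yields another factorization,
  since composing \<open>e\<close> with the isomorphism inverse to \<open>j\<close> stays in \<open>E\<close>.\<close>

lemma M_part_eq:
  assumes e: "e \<in> EE A" "e \<in> Hom A W (Dom A m)" and m: "m \<in> MM_to X"
  shows "M_part A (m \<cdot> e) = sub A m"
proof (rule sub_eqI[OF m])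
  have mH: "m \<in> Hom A (Dom A m) X" using MM_toD[OF m] .
  note f = Comp_Hom[OF e(2) mH]
  show K: "M_part A (m \<cdot> e) \<subseteq> MM_to X"
  proof
    fix k assume "k \<in> M_part A (m \<cdot> e)"
    then obtain d where k: "k \<in> MM A" "d \<in> Hom A W (Dom A k)" "m \<cdot> e = k \<cdot> d"
      using HomD[OF f] by (auto simp: M_part_def)
    then have "Cod A k = X"
      using Comp_Hom[OF k(2) MM_Hom[OF k(1)]] f by (auto simp: Hom_def)
    then show "k \<in> MM_to X" using k by simp
  qed
  show "m \<in> M_part A (m \<cdot> e)"
    using e m HomD[OF f] by (auto simp: M_part_def)
  show "factors_through A m k \<and> factors_through A k m" if mem: "k \<in> M_part A (m \<cdot> e)" for k
  proof
    obtain d where k: "k \<in> MM A" "d \<in> EE A" "d \<in> Hom A W (Dom A k)" "m \<cdot> e = k \<cdot> d"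
      using mem unfolding M_part_def HomD(2)[OF f] by blast
    have kX: "k \<in> MM_to X" using K mem by blast
    have "factors_through A (m \<cdot> e) k"
      using factors_through_iff[OF f MM_toD[OF kX]] k by blast
    then show "factors_through A m k"
      using MM_diagonal[OF e(1) k(1), of m] mH HomD(3)[OF e(2)] kX by simp
    have "factors_through A (k \<cdot> d) m"
      using factors_through_iff[OF f mH] k(4) e(2) by metis
    then show "factors_through A k m"
      using MM_diagonal[OF k(2), of m k] MM_toD[OF kX] HomD(3)[OF k(3)] m by simp
  qed
  fix k assume k: "k \<in> MM_to X" "factors_through A m k" "factors_through A k m"
  note kH = MM_toD[OF k(1)]
  obtain i where i: "i \<in> Hom A (Dom A m) (Dom A k)" "m = k \<cdot> i"
    using k factors_through_iff[OF mH kH] by blast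
  obtain j where j: "j \<in> Hom A (Dom A k) (Dom A m)" "k = m \<cdot> j"
    using k factors_through_iff[OF kH mH] by blast
  have "k \<cdot> (i \<cdot> j) = k \<cdot> Id A (Dom A k)"
    using Comp_assoc[OF j(1) i(1) kH] i(2)[symmetric] j(2)[symmetric] Comp_Id_right[OF kH] by simp
  then have ij: "i \<cdot> j = Id A (Dom A k)"
    using Monos_cancel[OF MM_mono kH Comp_Hom[OF j(1) i(1)] Id_Hom[OF HomD(4)[OF kH]]] k(1) by simp
  have ie: "i \<cdot> e \<in> Hom A W (Dom A k)"
    using Comp_Hom[OF e(2) i(1)] .
  have "i \<cdot> e \<in> EE A"
  proof (rule EE_I[OF ie])
    fix n v assume n: "n \<in> MM A" and v: "v \<in> Hom A (Dom A k) (Cod A n)"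
      and fac: "factors_through A (v \<cdot> (i \<cdot> e)) n"
    note vi = Comp_Hom[OF i(1) v]
    have "factors_through A (v \<cdot> i) n"
      using MM_diagonal[OF e(1) n, of "v \<cdot> i"] vi HomD(3)[OF e(2)] fac Comp_assoc[OF e(2) i(1) v]
      by simp
    then have "factors_through A (v \<cdot> i \<cdot> j) n"
      using factors_through_comp_right[OF vi MM_Hom[OF n] j(1)] by simp
    then show "factors_through A v n"
      using Comp_assoc[OF j(1) i(1) v] ij Comp_Id_right[OF v] by simp
  qed
  moreover have "m \<cdot> e = k \<cdot> (i \<cdot> e)"
    using Comp_assoc[OF e(2) i(1) kH] i(2) by simp
  ultimately show "k \<in> M_part A (m \<cdot> e)"
    using k(1) ie HomD[OF f] by (auto simp: M_part_def)
qed

lemma M_partE: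
  assumes "f \<in> Hom A X Y"
  obtains m where "m \<in> MM_to Y" "M_part A f = sub A m"
    "\<And>n. n \<in> MM_to Y \<Longrightarrow> factors_through A f n \<longleftrightarrow> factors_through A m n"
proof -
  obtain e m where em: "e \<in> EE A" "m \<in> MM A" "e \<in> Hom A X (Dom A m)" "Cod A m = Y" "f = m \<cdot> e"
    using factorizationE[OF assms] .
  then have m: "m \<in> MM_to Y" by simp
  have "factors_through A f n \<longleftrightarrow> factors_through A m n" if n: "n \<in> MM_to Y" for n
    using factors_through_comp_right[OF MM_toD[OF m] MM_toD[OF n] em(3)] em(5)
      MM_diagonal[OF em(1), of n m] n MM_toD[OF m] HomD(3)[OF em(3)] by auto
  then show ?thesis
    using that[OF m] M_part_eq[OF em(1,3) m] em(5) by simp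
qed

text \<open>Different initial objects give the same class because the M-part of an arrow out of any of
  them lies below every admissible subobject.\<close>

lemma sub_bot_M_part:
  assumes Z: "is_initial A Z" and z: "z \<in> Hom A Z X"
  shows "sub_bot A X = M_part A z"
proof -
  have least: "factors_through A w n" if init: "is_initial A W" "w \<in> Hom A W X" "n \<in> MM_to X" for W w n
  proof -
    have n: "n \<in> Hom A (Dom A n) X" using MM_toD[OF init(3)] .
    obtain k where k: "k \<in> Hom A W (Dom A n)"
      using init(1) HomD(4)[OF n] unfolding is_initial_def by (meson ex1_implies_ex)
    have "n \<cdot> k = w"
      using init(1,2) Comp_Hom[OF k n] HomD(5)[OF init(2)] unfolding is_initial_def by blast
    then show ?thesis
      using factors_through_iff[OF init(2) n] k by blast
  qed
  have "M_part A w \<subseteq> M_part A w'"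
    if init: "is_initial A W" "w \<in> Hom A W X" "is_initial A W'" "w' \<in> Hom A W' X" for W w W' w'
  proof -
    obtain m where m: "m \<in> MM_to X" "M_part A w = sub A m"
      "\<And>n. n \<in> MM_to X \<Longrightarrow> factors_through A w n \<longleftrightarrow> factors_through A m n"
      using M_partE[OF init(2)] by blast
    obtain m' where m': "m' \<in> MM_to X" "M_part A w' = sub A m'"
      "\<And>n. n \<in> MM_to X \<Longrightarrow> factors_through A w' n \<longleftrightarrow> factors_through A m' n"
      using M_partE[OF init(4)] by blast
    have "sub A m = sub A m'"
      using sub_eq_iff[OF m(1) m'(1)] m m' least init by blast
    then show ?thesis
      using m m' by simp
  qed
  then show ?thesis
    using Z z unfolding sub_bot_def by blast
qed

lemma sub_botE:
  assumes "X \<in> Ob A"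
  obtains Z z m where "is_initial A Z" "z \<in> EE A" "z \<in> Hom A Z (Dom A m)" "m \<in> MM_to X"
    "sub_bot A X = sub A m"
proof -
  obtain Z where Z: "is_initial A Z"
    using initial_exists[OF finite_coproducts] by blast
  then obtain f where f: "f \<in> Hom A Z X"
    using assms unfolding is_initial_def by blast
  obtain e m where em: "e \<in> EE A" "m \<in> MM A" "e \<in> Hom A Z (Dom A m)" "Cod A m = X" "f = m \<cdot> e"
    using factorizationE[OF f] .
  then have "sub_bot A X = sub A m"
    using sub_bot_M_part[OF Z f] M_part_eq[OF em(1,3), of X] by simp
  then show ?thesis
    using that[OF Z em(1,3)] em by simp
qed

lemma sub_bot_in_carrier: "X \<in> Ob A \<Longrightarrow> sub_bot A X \<in> carrier (Sub A X)"
  by (rule sub_botE[of X]) (use sub_in_carrier in auto)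

lemma sub_bot_least:
  assumes "X \<in> Ob A" "p \<in> carrier (Sub A X)"
  shows "sub_bot A X \<sqsubseteq>\<^bsub>Sub A X\<^esub> p"
proof -
  obtain Z z m where b: "is_initial A Z" "z \<in> EE A" "z \<in> Hom A Z (Dom A m)" "m \<in> MM_to X"
    "sub_bot A X = sub A m"
    using sub_botE[OF assms(1)] .
  obtain n where n: "n \<in> MM_to X" "p = sub A n"
    by (rule Sub_cases[OF assms(2)])
  note nH = MM_toD[OF n(1)] and mH = MM_toD[OF b(4)]
  obtain k where k: "k \<in> Hom A Z (Dom A n)"
    using b(1) HomD(4)[OF nH] unfolding is_initial_def by (meson ex1_implies_ex)
  have "n \<cdot> k = m \<cdot> z"
    using b(1) Comp_Hom[OF k nH] Comp_Hom[OF b(3) mH] assms(1) unfolding is_initial_def by blast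
  then have "factors_through A (m \<cdot> z) n"
    using factors_through_iff[OF Comp_Hom[OF b(3) mH] nH] k by metis
  then have "factors_through A m n"
    using MM_diagonal[OF b(2), of n m] n(1) mH HomD(3)[OF b(3)] by simp
  then show ?thesis
    using sub_le_iff[OF b(4) n(1)] b(5) n(2) by simp
qed

section \<open>Inverse images\<close>

lemma inv_image_sub_eq:
  assumes n: "n \<in> MM_to Y" and pb: "is_pullback A f n k h"
  shows "inv_image_sub A f (sub A n) = sub A k"
proof -
  define X where "X = Dom A f"
  have f: "f \<in> Hom A X Y"
    using pb n unfolding is_pullback_def X_def by (auto simp: Hom_def)
  have k: "k \<in> MM_to X"
    using MM_pullback[OF pb] n pb unfolding is_pullback_def X_def by (auto simp: Hom_def)
  have other: "k' \<in> MM_to X \<and> factors_through A k k' \<and> factors_through A k' k"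
    if n': "n' \<in> sub A n" and pb': "is_pullback A f n' k' h'" for n' k' h'
  proof -
    have n'Y: "n' \<in> MM_to Y" and nn': "factors_through A n n'" "factors_through A n' n"
      using n' n by (auto simp: sub_def)
    have k': "k' \<in> MM_to X"
      using MM_pullback[OF pb'] n'Y pb' unfolding is_pullback_def X_def by (auto simp: Hom_def)
    note kH = MM_toD[OF k] and k'H = MM_toD[OF k']
    have "factors_through A (f \<cdot> k) n"
      using factors_through_pullback_iff[OF pb] kH factors_through_refl[OF kH] X_def by blast
    then have "factors_through A (f \<cdot> k) n'"
      using factors_through_trans[OF Comp_Hom[OF kH f] MM_toD[OF n] MM_toD[OF n'Y]] nn' by blast
    then have 1: "factors_through A k k'"
      using factors_through_pullback_iff[OF pb'] kH X_def by blast
    have "factors_through A (f \<cdot> k') n'"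
      using factors_through_pullback_iff[OF pb'] k'H factors_through_refl[OF k'H] X_def by blast
    then have "factors_through A (f \<cdot> k') n"
      using factors_through_trans[OF Comp_Hom[OF k'H f] MM_toD[OF n'Y] MM_toD[OF n]] nn' by blast
    then have "factors_through A k' k"
      using factors_through_pullback_iff[OF pb] k'H X_def by blast
    then show ?thesis
      using k' 1 by blast
  qed
  show ?thesis
  proof (rule sub_eqI[OF k])
    show "inv_image_sub A f (sub A n) \<subseteq> MM_to X"
      using other unfolding inv_image_sub_def by blast
    show "k \<in> inv_image_sub A f (sub A n)"
      using pb sub_self[OF n] unfolding inv_image_sub_def by blast
    show "factors_through A k k' \<and> factors_through A k' k" if "k' \<in> inv_image_sub A f (sub A n)" for k'
      using other that unfolding inv_image_sub_def by blast
    fix k' assume k': "k' \<in> MM_to X" "factors_through A k k'" "factors_through A k' k"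
    note kH = MM_toD[OF k] and k'H = MM_toD[OF k'(1)] and nH = MM_toD[OF n]
    have "factors_through A (f \<cdot> k') n"
      using factors_through_pullback_iff[OF pb] k'H k'(3) X_def by blast
    then obtain h' where h': "h' \<in> Hom A (Dom A k') (Dom A n)" "f \<cdot> k' = n \<cdot> h'"
      using factors_through_iff[OF Comp_Hom[OF k'H f] nH] by blast
    have "\<exists>!w. w \<in> Hom A W (Dom A k') \<and> k' \<cdot> w = a \<and> h' \<cdot> w = b"
      if a: "a \<in> Hom A W X" and b: "b \<in> Hom A W (Dom A n)" and eq: "f \<cdot> a = n \<cdot> b" for W a b
    proof -
      have "factors_through A (f \<cdot> a) n"
        using factors_through_iff[OF Comp_Hom[OF a f] nH] b eq by blast
      then have "factors_through A a k"
        using factors_through_pullback_iff[OF pb] a X_def by blast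
      then have "factors_through A a k'"
        using factors_through_trans[OF a kH k'H] k' by blast
      then obtain w where w: "w \<in> Hom A W (Dom A k')" "a = k' \<cdot> w"
        using factors_through_iff[OF a k'H] by blast
      have "n \<cdot> (h' \<cdot> w) = n \<cdot> b"
        using Comp_assoc[OF w(1) h'(1) nH] Comp_assoc[OF w(1) k'H f] h'(2) w(2) eq by simp
      then have "h' \<cdot> w = b"
        using Monos_cancel[OF MM_mono nH Comp_Hom[OF w(1) h'(1)] b] n by simp
      moreover have "w' = w" if "w' \<in> Hom A W (Dom A k')" "k' \<cdot> w' = a" for w'
        using Monos_cancel[OF MM_mono k'H that(1) w(1)] that(2) w(2) k'(1) by simp
      ultimately show ?thesis
        using w by blast
    qed
    then have "is_pullback A f n k' h'"
      unfolding is_pullback_def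
      using HomD[OF f] HomD[OF k'H] HomD[OF nH] k'H h' by simp
    then show "k' \<in> inv_image_sub A f (sub A n)"
      using sub_self[OF n] unfolding inv_image_sub_def by blast
  qed
qed

text \<open>The third property determines the subobject and is all that is used of a pullback from here
  on. It concerns arbitrary arrows \<open>a\<close>, not only admissible ones: density is tested on such arrows,
  and the composition law for inverse images needs it too.\<close>

lemma inv_image_subE:
  assumes "f \<in> Hom A X Y" "n \<in> MM_to Y"
  obtains k where "k \<in> MM_to X" "inv_image_sub A f (sub A n) = sub A k"
    "\<And>W a. a \<in> Hom A W X \<Longrightarrow> factors_through A a k \<longleftrightarrow> factors_through A (f \<cdot> a) n"
proof -
  obtain k h where pb: "is_pullback A f n k h"
    using pullback_exists[OF finitely_complete assms(1) MM_toD[OF assms(2)]] by blast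
  have "k \<in> MM_to X"
    using MM_pullback[OF pb] assms pb unfolding is_pullback_def by (auto simp: Hom_def)
  moreover have "factors_through A a k \<longleftrightarrow> factors_through A (f \<cdot> a) n" if "a \<in> Hom A W X" for W a
    using factors_through_pullback_iff[OF pb, of a W] HomD(2)[OF assms(1)] that by simp
  ultimately show ?thesis
    using that inv_image_sub_eq[OF assms(2) pb] by blast
qed

lemma inv_image_in_carrier:
  assumes "f \<in> Hom A X Y" "p \<in> carrier (Sub A Y)"
  shows "inv_image_sub A f p \<in> carrier (Sub A X)"
proof -
  obtain n where n: "n \<in> MM_to Y" "p = sub A n"
    by (rule Sub_cases[OF assms(2)])
  obtain k where "k \<in> MM_to X" "inv_image_sub A f (sub A n) = sub A k"
    by (rule inv_image_subE[OF assms(1) n(1)])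
  then show ?thesis
    using sub_in_carrier[of k X] n(2) by simp
qed

lemma Sub_eqI:
  assumes "p \<in> carrier (Sub A X)" "q \<in> carrier (Sub A X)"
    and "\<And>m. m \<in> MM_to X \<Longrightarrow> sub A m \<sqsubseteq>\<^bsub>Sub A X\<^esub> p \<longleftrightarrow> sub A m \<sqsubseteq>\<^bsub>Sub A X\<^esub> q"
  shows "p = q"
proof -
  obtain m where m: "m \<in> MM_to X" "p = sub A m"
    by (rule Sub_cases[OF assms(1)])
  obtain n where n: "n \<in> MM_to X" "q = sub A n"
    by (rule Sub_cases[OF assms(2)])
  have "factors_through A m n"
    using assms(3)[OF m(1)] m(2) n(2) sub_le_iff[OF m(1) m(1)] sub_le_iff[OF m(1) n(1)]
      factors_through_refl[OF MM_toD[OF m(1)]] by simp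
  moreover have "factors_through A n m"
    using assms(3)[OF n(1)] m(2) n(2) sub_le_iff[OF n(1) n(1)] sub_le_iff[OF n(1) m(1)]
      factors_through_refl[OF MM_toD[OF n(1)]] by simp
  ultimately show ?thesis
    using sub_eq_iff[OF m(1) n(1)] m n by simp
qed

lemma le_inv_image_iff:
  assumes "f \<in> Hom A X Y" "m \<in> MM_to X" "n \<in> MM_to Y"
  shows "sub A m \<sqsubseteq>\<^bsub>Sub A X\<^esub> inv_image_sub A f (sub A n) \<longleftrightarrow> factors_through A (f \<cdot> m) n"
proof -
  obtain k where k: "k \<in> MM_to X" "inv_image_sub A f (sub A n) = sub A k"
    "\<And>W a. a \<in> Hom A W X \<Longrightarrow> factors_through A a k \<longleftrightarrow> factors_through A (f \<cdot> a) n"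
    using inv_image_subE[OF assms(1,3)] by blast
  then show ?thesis
    using sub_le_iff[OF assms(2) k(1)] MM_toD[OF assms(2)] by simp
qed

lemma inv_image_comp:
  assumes f: "f \<in> Hom A X Y" and g: "g \<in> Hom A Y Z" and p: "p \<in> carrier (Sub A Z)"
  shows "inv_image_sub A (g \<cdot> f) p = inv_image_sub A f (inv_image_sub A g p)"
proof -
  obtain n where n: "n \<in> MM_to Z" "p = sub A n"
    by (rule Sub_cases[OF p])
  obtain k where k: "k \<in> MM_to Y" "inv_image_sub A g (sub A n) = sub A k"
    "\<And>W a. a \<in> Hom A W Y \<Longrightarrow> factors_through A a k \<longleftrightarrow> factors_through A (g \<cdot> a) n"
    using inv_image_subE[OF g n(1)] by blast
  show ?thesis
  proof (rule Sub_eqI)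
    show "inv_image_sub A (g \<cdot> f) p \<in> carrier (Sub A X)"
      using inv_image_in_carrier[OF Comp_Hom[OF f g] p] .
    show "inv_image_sub A f (inv_image_sub A g p) \<in> carrier (Sub A X)"
      using inv_image_in_carrier[OF f inv_image_in_carrier[OF g p]] .
    fix m assume m: "m \<in> MM_to X"
    show "sub A m \<sqsubseteq>\<^bsub>Sub A X\<^esub> inv_image_sub A (g \<cdot> f) p \<longleftrightarrow>
      sub A m \<sqsubseteq>\<^bsub>Sub A X\<^esub> inv_image_sub A f (inv_image_sub A g p)"
      using le_inv_image_iff[OF Comp_Hom[OF f g] m n(1)] le_inv_image_iff[OF f m k(1)] n(2) k(2)
        k(3)[OF Comp_Hom[OF MM_toD[OF m] f]] Comp_assoc[OF MM_toD[OF m] f g] by simp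
  qed
qed

lemma inv_image_Id:
  assumes "p \<in> carrier (Sub A X)" "X \<in> Ob A"
  shows "inv_image_sub A (Id A X) p = p"
proof (rule Sub_eqI)
  show "inv_image_sub A (Id A X) p \<in> carrier (Sub A X)"
    using inv_image_in_carrier[OF Id_Hom[OF assms(2)] assms(1)] .
  show "p \<in> carrier (Sub A X)" by fact
  obtain n where n: "n \<in> MM_to X" "p = sub A n"
    by (rule Sub_cases[OF assms(1)])
  fix m assume m: "m \<in> MM_to X"
  show "sub A m \<sqsubseteq>\<^bsub>Sub A X\<^esub> inv_image_sub A (Id A X) p \<longleftrightarrow> sub A m \<sqsubseteq>\<^bsub>Sub A X\<^esub> p"
    using le_inv_image_iff[OF Id_Hom[OF assms(2)] m n(1)] sub_le_iff[OF m n(1)] n(2)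
      Comp_Id_left[OF MM_toD[OF m]] by simp
qed

lemma inv_image_mono:
  assumes f: "f \<in> Hom A X Y" and "p \<in> carrier (Sub A Y)" "q \<in> carrier (Sub A Y)"
    "p \<sqsubseteq>\<^bsub>Sub A Y\<^esub> q"
  shows "inv_image_sub A f p \<sqsubseteq>\<^bsub>Sub A X\<^esub> inv_image_sub A f q"
proof -
  obtain m where m: "m \<in> MM_to Y" "p = sub A m"
    by (rule Sub_cases[OF assms(2)])
  obtain n where n: "n \<in> MM_to Y" "q = sub A n"
    by (rule Sub_cases[OF assms(3)])
  have mn: "factors_through A m n"
    using sub_le_iff[OF m(1) n(1)] assms(4) m(2) n(2) by simp
  obtain k where k: "k \<in> MM_to X" "inv_image_sub A f (sub A m) = sub A k"
    "\<And>W a. a \<in> Hom A W X \<Longrightarrow> factors_through A a k \<longleftrightarrow> factors_through A (f \<cdot> a) m"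
    using inv_image_subE[OF f m(1)] by blast
  note kH = MM_toD[OF k(1)]
  have "factors_through A (f \<cdot> k) m"
    using k(3)[OF kH] factors_through_refl[OF kH] by simp
  then have "factors_through A (f \<cdot> k) n"
    using factors_through_trans[OF Comp_Hom[OF kH f] MM_toD[OF m(1)] MM_toD[OF n(1)]] mn by simp
  then show ?thesis
    using le_inv_image_iff[OF f k(1) n(1)] m(2) n(2) k(2) by simp
qed

section \<open>Direct images along admissible monomorphisms\<close>

lemma comp_sub_eq:
  assumes m: "m \<in> MM_to X" and a: "a \<in> MM_to (Dom A m)"
  shows "m \<cdot> a \<in> MM_to X" and "comp_sub A m (sub A a) = sub A (m \<cdot> a)"
proof -
  note mH = MM_toD[OF m]
  have comp: "m \<cdot> b \<in> MM_to X" if "b \<in> MM_to (Dom A m)" for b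
    using MM_comp[of m b] m that HomD(3)[OF Comp_Hom[OF MM_toD[OF that] mH]] by simp
  then show "m \<cdot> a \<in> MM_to X"
    using a .
  have "sub A (m \<cdot> b) = sub A (m \<cdot> a)" if "b \<in> sub A a" for b
  proof -
    have b: "b \<in> MM_to (Dom A m)" "factors_through A a b" "factors_through A b a"
      using that a by (auto simp: sub_def)
    show ?thesis
      using sub_eq_iff[OF comp[OF b(1)] comp[OF a]] b(2,3)
        factors_through_comp_left[OF MM_toD[OF a] MM_toD[OF b(1)] mH]
        factors_through_comp_left[OF MM_toD[OF b(1)] MM_toD[OF a] mH] by blast
  qed
  then show "comp_sub A m (sub A a) = sub A (m \<cdot> a)"
    using sub_self[OF a] unfolding comp_sub_def by blast
qed

lemma comp_sub_in_carrier:
  assumes "m \<in> MM_to X" "a \<in> carrier (Sub A (Dom A m))"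
  shows "comp_sub A m a \<in> carrier (Sub A X)"
proof -
  obtain b where b: "b \<in> MM_to (Dom A m)" "a = sub A b"
    by (rule Sub_cases[OF assms(2)])
  then show ?thesis
    using comp_sub_eq(2)[OF assms(1) b(1)] sub_in_carrier[OF comp_sub_eq(1)[OF assms(1) b(1)]] by simp
qed

lemma comp_sub_galois:
  assumes m: "m \<in> MM_to X" and a: "a \<in> carrier (Sub A (Dom A m))" and b: "b \<in> carrier (Sub A X)"
  shows "comp_sub A m a \<sqsubseteq>\<^bsub>Sub A X\<^esub> b \<longleftrightarrow> a \<sqsubseteq>\<^bsub>Sub A (Dom A m)\<^esub> inv_image_sub A m b"
proof -
  obtain a0 where a0: "a0 \<in> MM_to (Dom A m)" "a = sub A a0"
    by (rule Sub_cases[OF a])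
  obtain b0 where b0: "b0 \<in> MM_to X" "b = sub A b0"
    by (rule Sub_cases[OF b])
  show ?thesis
    using sub_le_iff[OF comp_sub_eq(1)[OF m a0(1)] b0(1)] comp_sub_eq(2)[OF m a0(1)] a0(2) b0(2)
      le_inv_image_iff[OF MM_toD[OF m] a0(1) b0(1)] by simp
qed

lemma inv_image_comp_sub:
  assumes m: "m \<in> MM_to X" and a: "a \<in> carrier (Sub A (Dom A m))"
  shows "inv_image_sub A m (comp_sub A m a) = a"
proof (rule Sub_eqI)
  show "inv_image_sub A m (comp_sub A m a) \<in> carrier (Sub A (Dom A m))"
    using inv_image_in_carrier[OF MM_toD[OF m] comp_sub_in_carrier[OF m a]] .
  show "a \<in> carrier (Sub A (Dom A m))" by fact
  obtain a0 where a0: "a0 \<in> MM_to (Dom A m)" "a = sub A a0"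
    by (rule Sub_cases[OF a])
  note mH = MM_toD[OF m]
  fix b assume b: "b \<in> MM_to (Dom A m)"
  show "sub A b \<sqsubseteq>\<^bsub>Sub A (Dom A m)\<^esub> inv_image_sub A m (comp_sub A m a) \<longleftrightarrow>
    sub A b \<sqsubseteq>\<^bsub>Sub A (Dom A m)\<^esub> a"
    using le_inv_image_iff[OF mH b comp_sub_eq(1)[OF m a0(1)]] comp_sub_eq(2)[OF m a0(1)] a0
      sub_le_iff[OF b a0(1)] factors_through_comp_left[OF MM_toD[OF b] MM_toD[OF a0(1)] mH]
      factors_through_comp_cancel[OF MM_mono mH MM_toD[OF b] MM_toD[OF a0(1)]] m by auto
qed

text \<open>Together with the two preceding lemmas this identifies \<open>Sub (Dom m)\<close> with the part of
  \<open>Sub X\<close> below \<open>m\<close>.\<close>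

lemma comp_sub_surj:
  assumes m: "m \<in> MM_to X" and b: "b \<in> carrier (Sub A X)" and le: "b \<sqsubseteq>\<^bsub>Sub A X\<^esub> sub A m"
  obtains a where "a \<in> carrier (Sub A (Dom A m))" "b = comp_sub A m a"
proof -
  obtain b0 where b0: "b0 \<in> MM_to X" "b = sub A b0"
    by (rule Sub_cases[OF b])
  then obtain a where a: "a \<in> Hom A (Dom A b0) (Dom A m)" "b0 = m \<cdot> a"
    using le sub_le_iff[OF b0(1) m] factors_through_iff[OF MM_toD[OF b0(1)] MM_toD[OF m]] by auto
  then have "a \<in> MM_to (Dom A m)"
    using MM_cancel[of m a] m b0(1) HomD(3)[OF a(1)] by auto
  then show ?thesis
    using that[OF sub_in_carrier] comp_sub_eq(2)[OF m] a(2) b0(2) by auto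
qed

text \<open>Composing with \<open>m \<in> M\<close> keeps the \<open>M\<close>-part \<open>s\<close> of the arrow from the initial object an
  \<open>M\<close>-arrow, so \<open>m \<cdot> s\<close> is again the \<open>M\<close>-part of an arrow from the initial object.\<close>

lemma comp_sub_bot:
  assumes m: "m \<in> MM_to X"
  shows "comp_sub A m (sub_bot A (Dom A m)) = sub_bot A X"
proof -
  note mH = MM_toD[OF m]
  obtain Z z s where s: "is_initial A Z" "z \<in> EE A" "z \<in> Hom A Z (Dom A s)"
    "s \<in> MM_to (Dom A m)" "sub_bot A (Dom A m) = sub A s"
    by (rule sub_botE[OF HomD(4)[OF mH]])
  note sH = MM_toD[OF s(4)]
  have "sub_bot A X = M_part A (m \<cdot> s \<cdot> z)"
    using sub_bot_M_part[OF s(1) Comp_Hom[OF s(3) Comp_Hom[OF sH mH]]] .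
  also have "\<dots> = sub A (m \<cdot> s)"
    using M_part_eq[OF s(2) _ comp_sub_eq(1)[OF m s(4)]] s(3) HomD(2)[OF Comp_Hom[OF sH mH]] by simp
  finally show ?thesis
    using comp_sub_eq(2)[OF m s(4)] s(5) by simp
qed

section \<open>Closure and closed subobjects\<close>

lemma lless_Sub_iff: "p \<sqsubset>\<^bsub>Sub A X\<^esub> q \<longleftrightarrow> p \<sqsubseteq>\<^bsub>Sub A X\<^esub> q \<and> p \<noteq> q"
  by (simp add: lless_def Sub_def)

lemma Sub_antisym:
  assumes "X \<in> Ob A" "p \<in> carrier (Sub A X)" "q \<in> carrier (Sub A X)"
    "p \<sqsubseteq>\<^bsub>Sub A X\<^esub> q" "q \<sqsubseteq>\<^bsub>Sub A X\<^esub> p"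
  shows "p = q"
proof -
  interpret L: complete_lattice "Sub A X" by (rule Sub_complete[OF assms(1)])
  show ?thesis using assms L.le_antisym by blast
qed

lemma spacesD:
  assumes "S \<in> spaces A"
  shows "fst S \<in> Ob A" "snd S \<in> systems A (fst S)"
  using assms by (auto simp: spaces_def)

lemma systemsD:
  assumes "\<mu> \<in> systems A X" "m \<in> carrier (Sub A X)"
  shows "\<mu> m \<in> Fil A X" and "\<mu> m \<subseteq> carrier (Sub A X)"
    and "\<lbrakk>n \<in> carrier (Sub A X); m \<sqsubseteq>\<^bsub>Sub A X\<^esub> n; p \<in> \<mu> n\<rbrakk> \<Longrightarrow> p \<in> \<mu> m"
    and "p \<in> \<mu> m \<Longrightarrow> m \<sqsubseteq>\<^bsub>Sub A X\<^esub> p"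
    and "\<lbrakk>p \<in> \<mu> m; q \<in> carrier (Sub A X); p \<sqsubseteq>\<^bsub>Sub A X\<^esub> q\<rbrakk> \<Longrightarrow> q \<in> \<mu> m"
proof -
  show F: "\<mu> m \<in> Fil A X"
    using assms unfolding systems_def by blast
  then show "\<mu> m \<subseteq> carrier (Sub A X)"
    unfolding Fil_def by blast
  show "p \<in> \<mu> m" if "n \<in> carrier (Sub A X)" "m \<sqsubseteq>\<^bsub>Sub A X\<^esub> n" "p \<in> \<mu> n"
    using assms that unfolding systems_def by blast
  show "m \<sqsubseteq>\<^bsub>Sub A X\<^esub> p" if "p \<in> \<mu> m"
    using assms that unfolding systems_def by blast
  show "q \<in> \<mu> m" if "p \<in> \<mu> m" "q \<in> carrier (Sub A X)" "p \<sqsubseteq>\<^bsub>Sub A X\<^esub> q"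
    using F that unfolding Fil_def by blast
qed

lemma Far_antimono:
  assumes S: "S \<in> spaces A" and p: "p \<in> carrier (Sub A (fst S))" and q: "q \<in> carrier (Sub A (fst S))"
    and pq: "p \<sqsubseteq>\<^bsub>Sub A (fst S)\<^esub> q"
  shows "Far A S q \<subseteq> Far A S p"
proof
  fix x assume x: "x \<in> Far A S q"
  interpret L: complete_lattice "Sub A (fst S)" by (rule Sub_complete[OF spacesD(1)[OF S]])
  obtain u where xc: "x \<in> carrier (Sub A (fst S))" and u: "u \<in> snd S x"
    "u \<sqinter>\<^bsub>Sub A (fst S)\<^esub> q = sub_bot A (fst S)"
    using x unfolding Far_def by blast
  have uc: "u \<in> carrier (Sub A (fst S))"
    using systemsD(2)[OF spacesD(2)[OF S] xc] u(1) by blast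
  have upc: "u \<sqinter>\<^bsub>Sub A (fst S)\<^esub> p \<in> carrier (Sub A (fst S))"
    using L.meet_closed[OF uc p] .
  have "u \<sqinter>\<^bsub>Sub A (fst S)\<^esub> p \<sqsubseteq>\<^bsub>Sub A (fst S)\<^esub> u \<sqinter>\<^bsub>Sub A (fst S)\<^esub> q"
    using L.meet_le[OF L.meet_left[OF uc p] L.le_trans[OF L.meet_right[OF uc p] pq upc p q] uc q upc] .
  then have "u \<sqinter>\<^bsub>Sub A (fst S)\<^esub> p = sub_bot A (fst S)"
    using Sub_antisym[OF spacesD(1)[OF S] upc sub_bot_in_carrier[OF spacesD(1)[OF S]]] u(2)
      sub_bot_least[OF spacesD(1)[OF S] upc] by simp
  then show "x \<in> Far A S p"
    using xc u(1) unfolding Far_def by blast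
qed

lemma cl_in_carrier:
  assumes "S \<in> spaces A"
  shows "cl A S p \<in> carrier (Sub A (fst S))"
proof -
  interpret L: complete_lattice "Sub A (fst S)" by (rule Sub_complete[OF spacesD(1)[OF assms]])
  show ?thesis
    unfolding cl_def by (rule L.sup_closed) blast
qed

lemma cl_upper:
  assumes "S \<in> spaces A" "x \<in> carrier (Sub A (fst S))" "\<not> p \<sqsubset>\<^bsub>Sub A (fst S)\<^esub> x" "x \<notin> Far A S p"
  shows "x \<sqsubseteq>\<^bsub>Sub A (fst S)\<^esub> cl A S p"
proof -
  interpret L: complete_lattice "Sub A (fst S)" by (rule Sub_complete[OF spacesD(1)[OF assms(1)]])
  show ?thesis
    unfolding cl_def by (rule L.sup_upper) (use assms in blast)+
qed

lemma cl_least: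
  assumes "S \<in> spaces A" "q \<in> carrier (Sub A (fst S))"
    and "\<And>x. \<lbrakk>x \<in> carrier (Sub A (fst S)); \<not> p \<sqsubset>\<^bsub>Sub A (fst S)\<^esub> x; x \<notin> Far A S p\<rbrakk>
      \<Longrightarrow> x \<sqsubseteq>\<^bsub>Sub A (fst S)\<^esub> q"
  shows "cl A S p \<sqsubseteq>\<^bsub>Sub A (fst S)\<^esub> q"
proof -
  interpret L: complete_lattice "Sub A (fst S)" by (rule Sub_complete[OF spacesD(1)[OF assms(1)]])
  show ?thesis
    unfolding cl_def by (rule L.sup_least) (use assms in blast)+
qed

text \<open>A subobject other than \<open>\<sigma>\<close> is not far from itself, since its preneighbourhoods contain it;
  as it is not strictly below itself, it occurs in the join defining its closure.\<close>

lemma cl_increasing: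
  assumes S: "S \<in> spaces A" and p: "p \<in> carrier (Sub A (fst S))"
  shows "p \<sqsubseteq>\<^bsub>Sub A (fst S)\<^esub> cl A S p"
proof (cases "p = sub_bot A (fst S)")
  case True
  then show ?thesis
    using sub_bot_least[OF spacesD(1)[OF S] cl_in_carrier[OF S]] by simp
next
  case False
  interpret L: complete_lattice "Sub A (fst S)" by (rule Sub_complete[OF spacesD(1)[OF S]])
  have "u \<sqinter>\<^bsub>Sub A (fst S)\<^esub> p \<noteq> sub_bot A (fst S)" if u: "u \<in> snd S p" for u
  proof -
    have uc: "u \<in> carrier (Sub A (fst S))" and pu: "p \<sqsubseteq>\<^bsub>Sub A (fst S)\<^esub> u"
      using systemsD(2,4)[OF spacesD(2)[OF S] p] u by auto
    have "p \<sqsubseteq>\<^bsub>Sub A (fst S)\<^esub> u \<sqinter>\<^bsub>Sub A (fst S)\<^esub> p"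
      using L.meet_le[OF pu L.le_refl[OF p] uc p p] .
    then show ?thesis
      using False Sub_antisym[OF spacesD(1)[OF S] p _ _ sub_bot_least[OF spacesD(1)[OF S] p]]
        sub_bot_in_carrier[OF spacesD(1)[OF S]] by auto
  qed
  then have "p \<notin> Far A S p"
    unfolding Far_def by blast
  then show ?thesis
    using cl_upper[OF S p] lless_Sub_iff by blast
qed

text \<open>A subobject \<open>x\<close> in the join for \<open>p\<close> is also in the join for \<open>q \<ge> p\<close>: if \<open>q < x\<close> then
  \<open>p < x\<close>, and farness from \<open>q\<close> implies farness from \<open>p\<close>.\<close>

lemma cl_mono:
  assumes S: "S \<in> spaces A" and p: "p \<in> carrier (Sub A (fst S))" and q: "q \<in> carrier (Sub A (fst S))"
    and pq: "p \<sqsubseteq>\<^bsub>Sub A (fst S)\<^esub> q"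
  shows "cl A S p \<sqsubseteq>\<^bsub>Sub A (fst S)\<^esub> cl A S q"
proof (rule cl_least[OF S cl_in_carrier[OF S]])
  fix x assume x: "x \<in> carrier (Sub A (fst S))" "\<not> p \<sqsubset>\<^bsub>Sub A (fst S)\<^esub> x" "x \<notin> Far A S p"
  interpret L: complete_lattice "Sub A (fst S)" by (rule Sub_complete[OF spacesD(1)[OF S]])
  have "\<not> q \<sqsubset>\<^bsub>Sub A (fst S)\<^esub> x"
  proof
    assume "q \<sqsubset>\<^bsub>Sub A (fst S)\<^esub> x"
    then have qx: "q \<sqsubseteq>\<^bsub>Sub A (fst S)\<^esub> x" "q \<noteq> x"
      using lless_Sub_iff by auto
    have "p \<sqsubseteq>\<^bsub>Sub A (fst S)\<^esub> x"
      using L.le_trans[OF pq qx(1) p q x(1)] .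
    then have "p = x"
      using x(2) lless_Sub_iff by blast
    then show False
      using qx Sub_antisym[OF spacesD(1)[OF S] q x(1)] pq by simp
  qed
  moreover have "x \<notin> Far A S q"
    using Far_antimono[OF S p q pq] x(3) by blast
  ultimately show "x \<sqsubseteq>\<^bsub>Sub A (fst S)\<^esub> cl A S q"
    using cl_upper[OF S x(1)] by blast
qed

lemma closed_subsI:
  assumes "S \<in> spaces A" "p \<in> carrier (Sub A (fst S))" "cl A S p \<sqsubseteq>\<^bsub>Sub A (fst S)\<^esub> p"
  shows "p \<in> closed_subs A S"
  using Sub_antisym[OF spacesD(1)[OF assms(1)] cl_in_carrier[OF assms(1)] assms(2,3)
    cl_increasing[OF assms(1,2)]] assms(2) by (simp add: closed_subs_def)

lemma closed_subs_Id:
  assumes "S \<in> spaces A"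
  shows "sub A (Id A (fst S)) \<in> closed_subs A S"
  by (rule closed_subsI[OF assms sub_in_carrier[OF Id_MM_to] sub_Id_top[OF _ cl_in_carrier]])
    (use assms spacesD in auto)

text \<open>By monotonicity the closure of a meet of closed subobjects lies below each of them, hence below
  the meet.\<close>

lemma closed_subs_Inf:
  assumes S: "S \<in> spaces A" and K: "K \<subseteq> closed_subs A S"
  shows "\<Sqinter>\<^bsub>Sub A (fst S)\<^esub> K \<in> closed_subs A S"
proof -
  interpret L: complete_lattice "Sub A (fst S)" by (rule Sub_complete[OF spacesD(1)[OF S]])
  have Kc: "K \<subseteq> carrier (Sub A (fst S))" and fixed: "\<And>t. t \<in> K \<Longrightarrow> cl A S t = t"
    using K unfolding closed_subs_def by auto
  have Ic: "\<Sqinter>\<^bsub>Sub A (fst S)\<^esub> K \<in> carrier (Sub A (fst S))"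
    using L.inf_closed[OF Kc] .
  have "cl A S (\<Sqinter>\<^bsub>Sub A (fst S)\<^esub> K) \<sqsubseteq>\<^bsub>Sub A (fst S)\<^esub> t" if t: "t \<in> K" for t
    using cl_mono[OF S Ic _ L.inf_lower[OF Kc t]] fixed[OF t] t Kc by auto
  then have "cl A S (\<Sqinter>\<^bsub>Sub A (fst S)\<^esub> K) \<sqsubseteq>\<^bsub>Sub A (fst S)\<^esub> \<Sqinter>\<^bsub>Sub A (fst S)\<^esub> K"
    using L.inf_greatest[OF Kc cl_in_carrier[OF S]] by blast
  then show ?thesis
    using closed_subsI[OF S Ic] by blast
qed

lemma cl_hat:
  assumes S: "S \<in> spaces A" and p: "p \<in> carrier (Sub A (fst S))"
  shows cl_hat_closed: "cl_hat A S p \<in> closed_subs A S"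
    and cl_hat_increasing: "p \<sqsubseteq>\<^bsub>Sub A (fst S)\<^esub> cl_hat A S p"
    and cl_hat_least: "\<lbrakk>t \<in> closed_subs A S; p \<sqsubseteq>\<^bsub>Sub A (fst S)\<^esub> t\<rbrakk>
      \<Longrightarrow> cl_hat A S p \<sqsubseteq>\<^bsub>Sub A (fst S)\<^esub> t"
proof -
  interpret L: complete_lattice "Sub A (fst S)" by (rule Sub_complete[OF spacesD(1)[OF S]])
  let ?K = "{t \<in> closed_subs A S. p \<sqsubseteq>\<^bsub>Sub A (fst S)\<^esub> t}"
  have Kc: "?K \<subseteq> carrier (Sub A (fst S))"
    unfolding closed_subs_def by blast
  show "cl_hat A S p \<in> closed_subs A S"
    unfolding cl_hat_def by (rule closed_subs_Inf[OF S]) blast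
  show "p \<sqsubseteq>\<^bsub>Sub A (fst S)\<^esub> cl_hat A S p"
    unfolding cl_hat_def by (rule L.inf_greatest[OF Kc p]) blast
  show "cl_hat A S p \<sqsubseteq>\<^bsub>Sub A (fst S)\<^esub> t" if "t \<in> closed_subs A S" "p \<sqsubseteq>\<^bsub>Sub A (fst S)\<^esub> t"
    unfolding cl_hat_def by (rule L.inf_lower[OF Kc]) (use that in blast)
qed

section \<open>Restricted systems\<close>

lemma mem_restricted:
  assumes "a \<in> carrier (Sub A (Dom A m))"
  shows "u \<in> restricted A \<mu> m a \<longleftrightarrow> u \<in> carrier (Sub A (Dom A m)) \<and>
    (\<exists>v \<in> \<mu> (comp_sub A m a). inv_image_sub A m v \<sqsubseteq>\<^bsub>Sub A (Dom A m)\<^esub> u)"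
  using assms by (simp add: restricted_def)

lemma restricted_Fil:
  assumes \<mu>: "\<mu> \<in> systems A X" and m: "m \<in> MM_to X" and a: "a \<in> carrier (Sub A (Dom A m))"
  shows "restricted A \<mu> m a \<in> Fil A (Dom A m)"
proof -
  note mH = MM_toD[OF m]
  interpret L: complete_lattice "Sub A (Dom A m)" by (rule Sub_complete[OF HomD(4)[OF mH]])
  interpret K: complete_lattice "Sub A X" by (rule Sub_complete[OF HomD(5)[OF mH]])
  note ma = comp_sub_in_carrier[OF m a]
  have \<mu>c: "\<mu> (comp_sub A m a) \<subseteq> carrier (Sub A X)"
    by (rule systemsD(2)[OF \<mu> ma])
  have "q \<in> restricted A \<mu> m a"
    if p: "p \<in> restricted A \<mu> m a" and q: "q \<in> carrier (Sub A (Dom A m))"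
      and pq: "p \<sqsubseteq>\<^bsub>Sub A (Dom A m)\<^esub> q" for p q
  proof -
    obtain v where v: "p \<in> carrier (Sub A (Dom A m))" "v \<in> \<mu> (comp_sub A m a)"
      "inv_image_sub A m v \<sqsubseteq>\<^bsub>Sub A (Dom A m)\<^esub> p"
      using p mem_restricted[OF a] by blast
    have "inv_image_sub A m v \<sqsubseteq>\<^bsub>Sub A (Dom A m)\<^esub> q"
      using L.le_trans[OF v(3) pq inv_image_in_carrier[OF mH] v(1) q] v(2) \<mu>c by blast
    then show ?thesis
      using mem_restricted[OF a] v(2) q by blast
  qed
  moreover have "\<Sqinter>\<^bsub>Sub A (Dom A m)\<^esub> P \<in> restricted A \<mu> m a"
    if P: "finite P" "P \<subseteq> restricted A \<mu> m a" for P
  proof -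
    have Pc: "P \<subseteq> carrier (Sub A (Dom A m))"
      using P(2) mem_restricted[OF a] by blast
    have "\<forall>p \<in> P. \<exists>v. v \<in> \<mu> (comp_sub A m a) \<and> inv_image_sub A m v \<sqsubseteq>\<^bsub>Sub A (Dom A m)\<^esub> p"
      using P(2) mem_restricted[OF a] by blast
    then obtain v where v: "\<And>p. p \<in> P \<Longrightarrow> v p \<in> \<mu> (comp_sub A m a)"
      "\<And>p. p \<in> P \<Longrightarrow> inv_image_sub A m (v p) \<sqsubseteq>\<^bsub>Sub A (Dom A m)\<^esub> p"
      by metis
    have vP: "v ` P \<subseteq> \<mu> (comp_sub A m a)" "v ` P \<subseteq> carrier (Sub A X)"
      using v(1) \<mu>c by auto
    have meet: "\<Sqinter>\<^bsub>Sub A X\<^esub> (v ` P) \<in> \<mu> (comp_sub A m a)"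
      using systemsD(1)[OF \<mu> ma] finite_imageI[OF P(1)] vP(1) unfolding Fil_def by blast
    note Ic = K.inf_closed[OF vP(2)]
    have "inv_image_sub A m (\<Sqinter>\<^bsub>Sub A X\<^esub> (v ` P)) \<sqsubseteq>\<^bsub>Sub A (Dom A m)\<^esub> p" if p: "p \<in> P" for p
    proof -
      have vp: "v p \<in> carrier (Sub A X)" and pc: "p \<in> carrier (Sub A (Dom A m))"
        using vP(2) Pc p by auto
      have "inv_image_sub A m (\<Sqinter>\<^bsub>Sub A X\<^esub> (v ` P)) \<sqsubseteq>\<^bsub>Sub A (Dom A m)\<^esub> inv_image_sub A m (v p)"
        using inv_image_mono[OF mH Ic vp K.inf_lower[OF vP(2)]] p by blast
      then show ?thesis
        using L.le_trans[OF _ v(2)[OF p] inv_image_in_carrier[OF mH Ic] inv_image_in_carrier[OF mH vp] pc]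
        by blast
    qed
    then have "inv_image_sub A m (\<Sqinter>\<^bsub>Sub A X\<^esub> (v ` P)) \<sqsubseteq>\<^bsub>Sub A (Dom A m)\<^esub>
        \<Sqinter>\<^bsub>Sub A (Dom A m)\<^esub> P"
      using L.inf_greatest[OF Pc inv_image_in_carrier[OF mH Ic]] by blast
    then show ?thesis
      using mem_restricted[OF a] meet L.inf_closed[OF Pc] by blast
  qed
  moreover have "restricted A \<mu> m a \<subseteq> carrier (Sub A (Dom A m))"
    using mem_restricted[OF a] by blast
  ultimately show ?thesis
    unfolding Fil_def by simp
qed

lemma restricted_systems:
  assumes \<mu>: "\<mu> \<in> systems A X" and m: "m \<in> MM_to X"
  shows "restricted A \<mu> m \<in> systems A (Dom A m)"
proof -
  note mH = MM_toD[OF m]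
  note DO = HomD(4)[OF mH] and XO = HomD(5)[OF mH]
  interpret L: complete_lattice "Sub A (Dom A m)" by (rule Sub_complete[OF DO])
  interpret K: complete_lattice "Sub A X" by (rule Sub_complete[OF XO])
  have "restricted A \<mu> m \<in> carrier (Sub A (Dom A m)) \<rightarrow>\<^sub>E Fil A (Dom A m)"
    using restricted_Fil[OF assms] by (auto simp: restricted_def)
  moreover have "restricted A \<mu> m b \<subseteq> restricted A \<mu> m a"
    if a: "a \<in> carrier (Sub A (Dom A m))" and b: "b \<in> carrier (Sub A (Dom A m))"
      and ab: "a \<sqsubseteq>\<^bsub>Sub A (Dom A m)\<^esub> b" for a b
  proof -
    note mb = comp_sub_in_carrier[OF m b]
    have "comp_sub A m a \<sqsubseteq>\<^bsub>Sub A X\<^esub> comp_sub A m b"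
      using comp_sub_galois[OF m a mb] inv_image_comp_sub[OF m b] ab by simp
    then have "\<mu> (comp_sub A m b) \<subseteq> \<mu> (comp_sub A m a)"
      using systemsD(3)[OF \<mu> comp_sub_in_carrier[OF m a] mb] by blast
    then show ?thesis
      unfolding subset_iff mem_restricted[OF a] mem_restricted[OF b] by blast
  qed
  moreover have "restricted A \<mu> m (sub_bot A (Dom A m)) = carrier (Sub A (Dom A m))"
  proof -
    note b = sub_bot_in_carrier[OF DO] and bX = sub_bot_in_carrier[OF XO]
    have "sub_bot A X \<in> \<mu> (comp_sub A m (sub_bot A (Dom A m)))"
      using comp_sub_bot[OF m] \<mu> bX unfolding systems_def by simp
    moreover have "inv_image_sub A m (sub_bot A X) = sub_bot A (Dom A m)"
      using inv_image_comp_sub[OF m b] comp_sub_bot[OF m] by simp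
    ultimately have "u \<in> restricted A \<mu> m (sub_bot A (Dom A m)) \<longleftrightarrow> u \<in> carrier (Sub A (Dom A m))" for u
      using mem_restricted[OF b, of u \<mu>] sub_bot_least[OF DO, of u] by metis
    then show ?thesis
      by blast
  qed
  moreover have "a \<sqsubseteq>\<^bsub>Sub A (Dom A m)\<^esub> u"
    if a: "a \<in> carrier (Sub A (Dom A m))" and u: "u \<in> restricted A \<mu> m a" for a u
  proof -
    note ma = comp_sub_in_carrier[OF m a]
    obtain v where v: "u \<in> carrier (Sub A (Dom A m))" "v \<in> \<mu> (comp_sub A m a)"
      "inv_image_sub A m v \<sqsubseteq>\<^bsub>Sub A (Dom A m)\<^esub> u"
      using u unfolding mem_restricted[OF a] by blast
    have vc: "v \<in> carrier (Sub A X)"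
      using systemsD(2)[OF \<mu> ma] v(2) by blast
    have "a \<sqsubseteq>\<^bsub>Sub A (Dom A m)\<^esub> inv_image_sub A m v"
      using comp_sub_galois[OF m a vc] systemsD(4)[OF \<mu> ma v(2)] by simp
    then show ?thesis
      using L.le_trans[OF _ v(3) a inv_image_in_carrier[OF mH vc] v(1)] by blast
  qed
  ultimately show ?thesis
    unfolding systems_def by blast
qed

lemma restricted_spaces:
  assumes "T \<in> spaces A" "m \<in> MM_to (fst T)"
  shows "(Dom A m, restricted A (snd T) m) \<in> spaces A"
  using restricted_systems[OF spacesD(2)[OF assms(1)] assms(2)] HomD(4)[OF MM_toD[OF assms(2)]]
  by (simp add: spaces_def)

text \<open>The next two lemmas say that the restricted system is the initial structure along \<open>c\<close>: an
  arrow into the restricted space is a preneighbourhood morphism as soon as its composite with \<open>c\<close>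
  is one. Mediating arrows found in the underlying category therefore are preneighbourhood
  morphisms for free.\<close>

lemma restricted_pnbd:
  assumes T: "T \<in> spaces A" and c: "c \<in> MM_to (fst T)"
  shows "pnbd_morphism A (Dom A c, restricted A (snd T) c) c T"
proof -
  note cH = MM_toD[OF c]
  interpret L: complete_lattice "Sub A (Dom A c)" by (rule Sub_complete[OF HomD(4)[OF cH]])
  have "inv_image_sub A c p \<in> restricted A (snd T) c (inv_image_sub A c u)"
    if u: "u \<in> carrier (Sub A (fst T))" and p: "p \<in> snd T u" for u p
  proof -
    note cu = inv_image_in_carrier[OF cH u]
    have pc: "p \<in> carrier (Sub A (fst T))"
      using systemsD(2)[OF spacesD(2)[OF T] u] p by blast
    have "comp_sub A c (inv_image_sub A c u) \<sqsubseteq>\<^bsub>Sub A (fst T)\<^esub> u"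
      using comp_sub_galois[OF c cu u] L.le_refl[OF cu] by simp
    then have "p \<in> snd T (comp_sub A c (inv_image_sub A c u))"
      using systemsD(3)[OF spacesD(2)[OF T] comp_sub_in_carrier[OF c cu] u] p by blast
    then show ?thesis
      unfolding mem_restricted[OF cu] using inv_image_in_carrier[OF cH pc] L.le_refl by blast
  qed
  then show ?thesis
    using cH by (simp add: pnbd_morphism_def)
qed

lemma pnbd_into_restricted:
  assumes S: "S \<in> spaces A" and T: "T \<in> spaces A" and c: "c \<in> MM_to (fst T)"
    and d: "d \<in> Hom A (fst S) (Dom A c)" and cd: "pnbd_morphism A S (c \<cdot> d) T"
  shows "pnbd_morphism A S d (Dom A c, restricted A (snd T) c)"
proof -
  note cH = MM_toD[OF c]
  have "inv_image_sub A d u \<in> snd S (inv_image_sub A d a)"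
    if a: "a \<in> carrier (Sub A (Dom A c))" and u: "u \<in> restricted A (snd T) c a" for a u
  proof -
    note ca = comp_sub_in_carrier[OF c a]
    obtain v where v: "u \<in> carrier (Sub A (Dom A c))" "v \<in> snd T (comp_sub A c a)"
      "inv_image_sub A c v \<sqsubseteq>\<^bsub>Sub A (Dom A c)\<^esub> u"
      using u unfolding mem_restricted[OF a] by blast
    have vc: "v \<in> carrier (Sub A (fst T))"
      using systemsD(2)[OF spacesD(2)[OF T] ca] v(2) by blast
    have "inv_image_sub A (c \<cdot> d) v \<in> snd S (inv_image_sub A (c \<cdot> d) (comp_sub A c a))"
      using cd ca v(2) unfolding pnbd_morphism_def by blast
    then have "inv_image_sub A d (inv_image_sub A c v) \<in> snd S (inv_image_sub A d a)"
      using inv_image_comp[OF d cH vc] inv_image_comp[OF d cH ca] inv_image_comp_sub[OF c a] by simp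
    then show ?thesis
      using systemsD(5)[OF spacesD(2)[OF S] inv_image_in_carrier[OF d a]]
        inv_image_in_carrier[OF d v(1)]
        inv_image_mono[OF d inv_image_in_carrier[OF cH vc] v(1) v(3)] by blast
  qed
  then show ?thesis
    using d by (simp add: pnbd_morphism_def)
qed

lemma pnbd_comp:
  assumes f: "pnbd_morphism A S f T" and g: "pnbd_morphism A T g U" and U: "U \<in> spaces A"
  shows "pnbd_morphism A S (g \<cdot> f) U"
proof -
  have fH: "f \<in> Hom A (fst S) (fst T)" and gH: "g \<in> Hom A (fst T) (fst U)"
    using f g by (auto simp: pnbd_morphism_def)
  have "inv_image_sub A (g \<cdot> f) p \<in> snd S (inv_image_sub A (g \<cdot> f) u)"
    if u: "u \<in> carrier (Sub A (fst U))" and p: "p \<in> snd U u" for u p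
  proof -
    have pc: "p \<in> carrier (Sub A (fst U))"
      using systemsD(2)[OF spacesD(2)[OF U] u] p by blast
    have "inv_image_sub A g p \<in> snd T (inv_image_sub A g u)"
      using g u p unfolding pnbd_morphism_def by blast
    then have "inv_image_sub A f (inv_image_sub A g p) \<in> snd S (inv_image_sub A f (inv_image_sub A g u))"
      using f inv_image_in_carrier[OF gH u] unfolding pnbd_morphism_def by blast
    then show ?thesis
      using inv_image_comp[OF fH gH u] inv_image_comp[OF fH gH pc] by simp
  qed
  then show ?thesis
    using Comp_Hom[OF fH gH] by (simp add: pnbd_morphism_def)
qed

lemma pnbd_Id_iff:
  assumes S: "S \<in> spaces A" and T: "T \<in> spaces A" and eq: "fst S = fst T"
  shows "pnbd_morphism A S (Id A (fst T)) T \<longleftrightarrow> (\<forall>u \<in> carrier (Sub A (fst T)). snd T u \<subseteq> snd S u)"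
proof -
  have "inv_image_sub A (Id A (fst T)) p = p" if "p \<in> carrier (Sub A (fst T))" for p
    using inv_image_Id[OF that spacesD(1)[OF T]] .
  then show ?thesis
    using Id_Hom[OF spacesD(1)[OF T]] systemsD(2)[OF spacesD(2)[OF T]] eq
    unfolding pnbd_morphism_def by (simp add: subset_iff Ball_def)
qed

lemma pnbd_Id: "S \<in> spaces A \<Longrightarrow> pnbd_morphism A S (Id A (fst S)) S"
  using pnbd_Id_iff by blast

text \<open>Both systems on the common underlying object contain each other: one inclusion is the
  hypothesis \<open>id\<close>, the other is initiality of the restricted system.\<close>

lemma restricted_unique:
  assumes S: "S \<in> spaces A" and T: "T \<in> spaces A" and f: "f \<in> MM A" "pnbd_morphism A S f T"
    and id: "pnbd_morphism A (Dom A f, restricted A (snd T) f) (Id A (fst S)) S"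
  shows "S = (Dom A f, restricted A (snd T) f)"
proof -
  have fH: "f \<in> Hom A (fst S) (fst T)"
    using f(2) by (simp add: pnbd_morphism_def)
  have D: "Dom A f = fst S" and fT: "f \<in> MM_to (fst T)"
    using HomD[OF fH] f(1) by auto
  define R where "R = (Dom A f, restricted A (snd T) f)"
  have R: "R \<in> spaces A" "fst R = fst S"
    using restricted_spaces[OF T fT] D by (simp_all add: R_def)
  have "pnbd_morphism A S (Id A (fst S)) R"
    using pnbd_into_restricted[OF S T fT, of "Id A (fst S)"] Id_Hom[OF spacesD(1)[OF S]]
      Comp_Id_right[OF fH] f(2) D by (simp add: R_def)
  then have "snd S u = snd R u" if "u \<in> carrier (Sub A (fst S))" for u
    using pnbd_Id_iff[OF S R(1)] pnbd_Id_iff[OF R(1) S] id that R(2) unfolding R_def[symmetric]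
    by (simp add: subset_antisym)
  moreover have "snd S \<in> carrier (Sub A (fst S)) \<rightarrow>\<^sub>E Fil A (fst S)"
    "snd R \<in> carrier (Sub A (fst S)) \<rightarrow>\<^sub>E Fil A (fst S)"
    using spacesD(2)[OF S] spacesD(2)[OF R(1)] R(2) by (simp_all add: systems_def)
  ultimately have "snd S = snd R"
    using PiE_ext by metis
  then show ?thesis
    using R(2) by (simp add: prod_eq_iff R_def)
qed

text \<open>Transitivity of closedness. A subobject \<open>t\<close> in the join defining the closure of \<open>c \<circ> a\<close> lies
  below \<open>cl c = c\<close> by monotonicity, so it comes from a subobject \<open>s\<close> of the domain of \<open>c\<close>. Both
  conditions on \<open>t\<close> pass to \<open>s\<close> because \<open>c \<circ> _\<close> embeds the subobjects of the domain of \<open>c\<close> and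
  preserves \<open>\<sigma>\<close>, so \<open>s\<close> lies below the closure of \<open>a\<close> for the restricted system, which is \<open>a\<close>.\<close>

lemma closed_subs_comp:
  assumes T: "T \<in> spaces A" and c: "c \<in> MM_to (fst T)" "sub A c \<in> closed_subs A T"
    and a: "a \<in> closed_subs A (Dom A c, restricted A (snd T) c)"
  shows "comp_sub A c a \<in> closed_subs A T"
proof -
  define R where "R = (Dom A c, restricted A (snd T) c)"
  have R: "R \<in> spaces A" "fst R = Dom A c" "snd R = restricted A (snd T) c"
    using restricted_spaces[OF T c(1)] by (simp_all add: R_def)
  note cH = MM_toD[OF c(1)] and TO = spacesD(1)[OF T]
  note DO = HomD(4)[OF cH]
  interpret L: complete_lattice "Sub A (Dom A c)" by (rule Sub_complete[OF DO])
  interpret K: complete_lattice "Sub A (fst T)" by (rule Sub_complete[OF TO])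
  have ac: "a \<in> carrier (Sub A (Dom A c))" and cla: "cl A R a = a"
    using a by (simp_all add: closed_subs_def R_def)
  note cac = comp_sub_in_carrier[OF c(1) ac]
  have ca_le: "comp_sub A c a \<sqsubseteq>\<^bsub>Sub A (fst T)\<^esub> sub A c"
  proof -
    obtain a0 where a0: "a0 \<in> MM_to (Dom A c)" "a = sub A a0"
      by (rule Sub_cases[OF ac])
    have "factors_through A (c \<cdot> a0) c"
      using factors_through_iff[OF Comp_Hom[OF MM_toD[OF a0(1)] cH] cH] MM_toD[OF a0(1)] by blast
    then show ?thesis
      using sub_le_iff[OF comp_sub_eq(1)[OF c(1) a0(1)] c(1)] comp_sub_eq(2)[OF c(1) a0(1)] a0(2) by simp
  qed
  have "cl A T (comp_sub A c a) \<sqsubseteq>\<^bsub>Sub A (fst T)\<^esub> comp_sub A c a"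
  proof (rule cl_least[OF T cac])
    fix t assume t: "t \<in> carrier (Sub A (fst T))" "\<not> comp_sub A c a \<sqsubset>\<^bsub>Sub A (fst T)\<^esub> t"
      "t \<notin> Far A T (comp_sub A c a)"
    have "cl A T (comp_sub A c a) \<sqsubseteq>\<^bsub>Sub A (fst T)\<^esub> sub A c"
      using cl_mono[OF T cac sub_in_carrier[OF c(1)] ca_le] c(2) by (simp add: closed_subs_def)
    then have "t \<sqsubseteq>\<^bsub>Sub A (fst T)\<^esub> sub A c"
      using K.le_trans[OF cl_upper[OF T t] _ t(1) cl_in_carrier[OF T] sub_in_carrier[OF c(1)]] by blast
    then obtain s where s: "s \<in> carrier (Sub A (Dom A c))" "t = comp_sub A c s"
      using comp_sub_surj[OF c(1) t(1)] by blast
    have "\<not> a \<sqsubset>\<^bsub>Sub A (Dom A c)\<^esub> s"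
    proof
      assume "a \<sqsubset>\<^bsub>Sub A (Dom A c)\<^esub> s"
      then have as: "a \<sqsubseteq>\<^bsub>Sub A (Dom A c)\<^esub> s" "a \<noteq> s"
        using lless_Sub_iff by auto
      have "comp_sub A c a \<sqsubseteq>\<^bsub>Sub A (fst T)\<^esub> t"
        using comp_sub_galois[OF c(1) ac t(1)] inv_image_comp_sub[OF c(1) s(1)] s(2) as(1) by simp
      moreover have "comp_sub A c a \<noteq> t"
        using inv_image_comp_sub[OF c(1) s(1)] inv_image_comp_sub[OF c(1) ac] s(2) as(2) by metis
      ultimately show False
        using t(2) lless_Sub_iff by blast
    qed
    moreover have "s \<notin> Far A R a"
    proof
      assume "s \<in> Far A R a"
      then obtain u where u: "u \<in> restricted A (snd T) c s"
        "u \<sqinter>\<^bsub>Sub A (Dom A c)\<^esub> a = sub_bot A (Dom A c)"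
        unfolding Far_def R by blast
      from u(1) obtain v where v: "u \<in> carrier (Sub A (Dom A c))" "v \<in> snd T t"
        "inv_image_sub A c v \<sqsubseteq>\<^bsub>Sub A (Dom A c)\<^esub> u"
        unfolding mem_restricted[OF s(1)] s(2) by blast
      have vc: "v \<in> carrier (Sub A (fst T))"
        using systemsD(2)[OF spacesD(2)[OF T] t(1)] v(2) by blast
      define y where "y = v \<sqinter>\<^bsub>Sub A (fst T)\<^esub> comp_sub A c a"
      have y: "y \<in> carrier (Sub A (fst T))" "y \<sqsubseteq>\<^bsub>Sub A (fst T)\<^esub> v"
        "y \<sqsubseteq>\<^bsub>Sub A (fst T)\<^esub> comp_sub A c a"
        using K.meet_closed[OF vc cac] K.meet_left[OF vc cac] K.meet_right[OF vc cac]
        by (simp_all add: y_def)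
      then obtain x where x: "x \<in> carrier (Sub A (Dom A c))" "y = comp_sub A c x"
        using comp_sub_surj[OF c(1) y(1)] K.le_trans[OF y(3) ca_le y(1) cac sub_in_carrier[OF c(1)]]
        by blast
      have "x \<sqsubseteq>\<^bsub>Sub A (Dom A c)\<^esub> inv_image_sub A c v"
        using comp_sub_galois[OF c(1) x(1) vc] y(2) x(2) by simp
      then have xu: "x \<sqsubseteq>\<^bsub>Sub A (Dom A c)\<^esub> u"
        using L.le_trans[OF _ v(3) x(1) inv_image_in_carrier[OF cH vc] v(1)] by blast
      have xa: "x \<sqsubseteq>\<^bsub>Sub A (Dom A c)\<^esub> a"
        using comp_sub_galois[OF c(1) x(1) cac] inv_image_comp_sub[OF c(1) ac] y(3) x(2) by simp
      have "x \<sqsubseteq>\<^bsub>Sub A (Dom A c)\<^esub> sub_bot A (Dom A c)"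
        using L.meet_le[OF xu xa v(1) ac x(1)] u(2) by simp
      then have "x = sub_bot A (Dom A c)"
        using Sub_antisym[OF DO x(1) sub_bot_in_carrier[OF DO]] sub_bot_least[OF DO x(1)] by blast
      then have "v \<sqinter>\<^bsub>Sub A (fst T)\<^esub> comp_sub A c a = sub_bot A (fst T)"
        using comp_sub_bot[OF c(1)] x(2) y_def by simp
      then show False
        using t(1,3) v(2) unfolding Far_def by blast
    qed
    ultimately have "s \<sqsubseteq>\<^bsub>Sub A (Dom A c)\<^esub> a"
      using cl_upper[OF R(1), of s a] s(1) cla R(2) by simp
    then show "t \<sqsubseteq>\<^bsub>Sub A (fst T)\<^esub> comp_sub A c a"
      using comp_sub_galois[OF c(1) s(1) cac] inv_image_comp_sub[OF c(1) ac] s(2) by simp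
  qed
  then show ?thesis
    using closed_subsI[OF T cac] by blast
qed

end


section \<open>Dense morphisms\<close>

lemma Spc_simps [simp]:
  "Ob (Spc A) = spaces A"
  "Dom (Spc A) (S, f, T) = S"
  "Cod (Spc A) (S, f, T) = T"
  "Id (Spc A) S = (S, Id A (fst S), S)"
  "(T', g, U) \<cdot>\<^bsub>Spc A\<^esub> (S, f, T) = (S, g \<cdot>\<^bsub>A\<^esub> f, U)"
  "(S, f, T) \<in> Ar (Spc A) \<longleftrightarrow> S \<in> spaces A \<and> T \<in> spaces A \<and> f \<in> Hom A (fst S) (fst T)"
  by (simp_all add: Spc_def)

lemma pNbd_simps [simp]:
  "Ob (pNbd A) = spaces A"
  "Dom (pNbd A) (S, f, T) = S"
  "Cod (pNbd A) (S, f, T) = T"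
  "Id (pNbd A) S = (S, Id A (fst S), S)"
  "(T', g, U) \<cdot>\<^bsub>pNbd A\<^esub> (S, f, T) = (S, g \<cdot>\<^bsub>A\<^esub> f, U)"
  "(S, f, T) \<in> Ar (pNbd A) \<longleftrightarrow> S \<in> spaces A \<and> T \<in> spaces A \<and> pnbd_morphism A S f T"
  by (auto simp: pNbd_def pnbd_morphism_def)

lemma Hom_Spc_iff:
  "x \<in> Hom (Spc A) S T \<longleftrightarrow>
    (\<exists>f. x = (S, f, T) \<and> S \<in> spaces A \<and> T \<in> spaces A \<and> f \<in> Hom A (fst S) (fst T))"
  by (cases x) (auto simp: Hom_def[of "Spc A"])

lemma Hom_pNbd_iff:
  "x \<in> Hom (pNbd A) S T \<longleftrightarrow>
    (\<exists>f. x = (S, f, T) \<and> S \<in> spaces A \<and> T \<in> spaces A \<and> pnbd_morphism A S f T)"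
  by (cases x) (auto simp: Hom_def[of "pNbd A"])

lemma Isos_pNbd_iff:
  "(S, m, T) \<in> Isos (pNbd A) \<longleftrightarrow> S \<in> spaces A \<and> T \<in> spaces A \<and> pnbd_morphism A S m T \<and>
    (\<exists>g. pnbd_morphism A T g S \<and> g \<cdot>\<^bsub>A\<^esub> m = Id A (fst S) \<and> m \<cdot>\<^bsub>A\<^esub> g = Id A (fst T))"
proof -
  have "(\<exists>x \<in> Hom (pNbd A) T S. R x) \<longleftrightarrow>
      S \<in> spaces A \<and> T \<in> spaces A \<and> (\<exists>g. pnbd_morphism A T g S \<and> R (T, g, S))" for R
    by (auto simp: Hom_pNbd_iff)
  then show ?thesis
    unfolding Isos_def by auto
qed

context pnbd_context
begin

lemma pnbd_Hom: "pnbd_morphism A S f T \<Longrightarrow> f \<in> Hom A (fst S) (fst T)"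
  by (simp add: pnbd_morphism_def)

lemma closed_arrows_iff:
  "m \<in> closed_arrows A T \<longleftrightarrow> m \<in> MM_to (fst T) \<and> sub A m \<in> closed_subs A T"
  by (auto simp: closed_arrows_def)

lemma closed_arrowsD:
  assumes "m \<in> closed_arrows A T"
  shows "m \<in> MM_to (fst T)" "m \<in> Hom A (Dom A m) (fst T)" "m \<in> Monos A"
    "sub A m \<in> closed_subs A T"
  using assms MM_toD[of m "fst T"] MM_mono by (auto simp: closed_arrows_def)

lemma closed_arrows_comp:
  assumes T: "T \<in> spaces A" and c: "c \<in> closed_arrows A T"
    and m: "m \<in> closed_arrows A (Dom A c, restricted A (snd T) c)"
  shows "c \<cdot> m \<in> closed_arrows A T"
proof -
  have m': "m \<in> MM_to (Dom A c)"
    using closed_arrowsD(1)[OF m] by simp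
  show ?thesis
    using closed_subs_comp[OF T closed_arrowsD(1,4)[OF c] closed_arrowsD(4)[OF m]]
      comp_sub_eq[OF closed_arrowsD(1)[OF c] m'] by (simp add: closed_arrows_iff)
qed

lemma Dense_iff:
  "(S, f, T) \<in> Dense A \<longleftrightarrow> S \<in> spaces A \<and> T \<in> spaces A \<and> f \<in> Hom A (fst S) (fst T) \<and>
    (\<forall>m \<in> closed_arrows A T. factors_through A f m \<longrightarrow> m \<in> Isos A)"
proof (cases "f \<in> Hom A (fst S) (fst T)")
  case True
  have "factors_through A f m \<longleftrightarrow> (\<exists>h \<in> Hom A (fst S) (Dom A m). f = m \<cdot> h)"
    if "m \<in> closed_arrows A T" for m
    using factors_through_iff[OF True closed_arrowsD(2)[OF that]] .
  then show ?thesis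
    by (auto simp: Dense_def)
next
  case False
  then show ?thesis
    by (auto simp: Dense_def)
qed

lemma ClEmb_iff:
  "(S, m, T) \<in> ClEmb A \<longleftrightarrow>
    S \<in> spaces A \<and> T \<in> spaces A \<and> m \<in> Hom A (fst S) (fst T) \<and> m \<in> closed_arrows A T"
  by (auto simp: ClEmb_def)

lemma pDense_iff:
  "(S, f, T) \<in> pDense A \<longleftrightarrow> (S, f, T) \<in> Dense A \<and> pnbd_morphism A S f T"
  by (auto simp: pDense_def Dense_iff)

lemma pClEmb_iff:
  "(S, m, T) \<in> pClEmb A \<longleftrightarrow>
    T \<in> spaces A \<and> m \<in> closed_arrows A T \<and> S = (Dom A m, restricted A (snd T) m)"
proof
  assume "T \<in> spaces A \<and> m \<in> closed_arrows A T \<and> S = (Dom A m, restricted A (snd T) m)"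
  then show "(S, m, T) \<in> pClEmb A"
    using restricted_spaces[of T m] closed_arrowsD(1,2)[of m T]
    by (simp only: pClEmb_def ClEmb_iff) auto
qed (auto simp: pClEmb_def ClEmb_iff)

lemma Isos_closed_arrows:
  assumes "T \<in> spaces A" "m \<in> Isos A" "Cod A m = fst T"
  shows "m \<in> closed_arrows A T"
proof -
  have "m \<in> MM_to (fst T)"
    using MM_Isos assms by simp
  then show ?thesis
    using Isos_iff_sub_Id[OF _ spacesD(1)[OF assms(1)]] assms(2) closed_subs_Id[OF assms(1)]
    by (auto simp: closed_arrows_iff)
qed

text \<open>Closed subobjects being closed under meets, there is a smallest closed arrow \<open>c\<close> through which
  \<open>f\<close> factors, and it represents the hull of the M-part.\<close>

lemma closure_arrowE:
  assumes T: "T \<in> spaces A" and f: "f \<in> Hom A W (fst T)"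
  obtains c where "c \<in> closed_arrows A T" "sub A c = cl_hat A T (M_part A f)" "factors_through A f c"
    "\<forall>n \<in> closed_arrows A T. factors_through A f n \<longrightarrow> factors_through A c n"
proof -
  obtain m where m: "m \<in> MM_to (fst T)" "M_part A f = sub A m"
    "\<And>n. n \<in> MM_to (fst T) \<Longrightarrow> factors_through A f n \<longleftrightarrow> factors_through A m n"
    using M_partE[OF f] by blast
  note p = sub_in_carrier[OF m(1)]
  have "cl_hat A T (sub A m) \<in> carrier (Sub A (fst T))"
    using cl_hat_closed[OF T p] by (simp add: closed_subs_def)
  then obtain c where c: "c \<in> MM_to (fst T)" "cl_hat A T (sub A m) = sub A c"
    by (rule Sub_cases)
  have mc: "factors_through A m c"
    using cl_hat_increasing[OF T p] c(2) sub_le_iff[OF m(1) c(1)] by simp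
  have cn: "factors_through A c n" if n: "n \<in> closed_arrows A T" "factors_through A f n" for n
    using cl_hat_least[OF T p closed_arrowsD(4)[OF n(1)]] sub_le_iff[OF m(1) closed_arrowsD(1)[OF n(1)]]
      m(3)[OF closed_arrowsD(1)[OF n(1)]] n(2) c(2) sub_le_iff[OF c(1) closed_arrowsD(1)[OF n(1)]]
    by simp
  show ?thesis
  proof (rule that[of c])
    show "c \<in> closed_arrows A T"
      unfolding closed_arrows_iff using c(1) cl_hat_closed[OF T p] c(2) by simp
    show "sub A c = cl_hat A T (M_part A f)"
      using c(2) m(2) by simp
    show "factors_through A f c"
      using m(3)[OF c(1)] mc by simp
    show "\<forall>n \<in> closed_arrows A T. factors_through A f n \<longrightarrow> factors_through A c n"
      using cn by blast
  qed
qed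

lemma Dense_iff_cl_hat:
  assumes S: "S \<in> spaces A" and T: "T \<in> spaces A" and f: "f \<in> Hom A (fst S) (fst T)"
  shows "(S, f, T) \<in> Dense A \<longleftrightarrow> cl_hat A T (M_part A f) = sub A (Id A (fst T))"
proof -
  obtain c where c: "c \<in> closed_arrows A T" "sub A c = cl_hat A T (M_part A f)" "factors_through A f c"
    "\<forall>n \<in> closed_arrows A T. factors_through A f n \<longrightarrow> factors_through A c n"
    by (rule closure_arrowE[OF T f])
  note iso = Isos_iff_sub_Id[OF closed_arrowsD(1)[OF c(1)] spacesD(1)[OF T]]
  have "n \<in> Isos A" if ci: "c \<in> Isos A" and n: "n \<in> closed_arrows A T" "factors_through A f n" for n
  proof -
    note cH = closed_arrowsD(2)[OF c(1)] and nH = closed_arrowsD(2)[OF n(1)]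
    have "factors_through A (Id A (fst T)) c"
      using Monos_Isos_iff[OF closed_arrowsD(3)[OF c(1)] cH] ci by simp
    then have "factors_through A (Id A (fst T)) n"
      using factors_through_trans[OF Id_Hom[OF spacesD(1)[OF T]] cH nH] c(4) n by blast
    then show ?thesis
      using Monos_Isos_iff[OF closed_arrowsD(3)[OF n(1)] nH] by simp
  qed
  then have "(S, f, T) \<in> Dense A \<longleftrightarrow> c \<in> Isos A"
    unfolding Dense_iff using S T f c(1,3) by blast
  then show ?thesis
    using iso c(2) by simp
qed

text \<open>A closed \<open>m\<close> through which \<open>d\<close> factors makes \<open>c \<cdot> m\<close> a closed arrow through which \<open>f\<close>
  factors; minimality of \<open>c\<close> then splits \<open>m\<close>. The step from \<open>m\<close> to \<open>c \<cdot> m\<close> is the transitivity of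
  closedness.\<close>

lemma Dense_ClEmb_factorization:
  assumes S: "S \<in> spaces A" and T: "T \<in> spaces A" and f: "f \<in> Hom A (fst S) (fst T)"
  obtains c d where "c \<in> closed_arrows A T" "d \<in> Hom A (fst S) (Dom A c)" "f = c \<cdot> d"
    "(S, d, (Dom A c, restricted A (snd T) c)) \<in> Dense A"
proof -
  obtain c where c: "c \<in> closed_arrows A T" "sub A c = cl_hat A T (M_part A f)" "factors_through A f c"
    "\<forall>n \<in> closed_arrows A T. factors_through A f n \<longrightarrow> factors_through A c n"
    by (rule closure_arrowE[OF T f])
  note cH = closed_arrowsD(2)[OF c(1)]
  obtain d where d: "d \<in> Hom A (fst S) (Dom A c)" "f = c \<cdot> d"
    using c(3) factors_through_iff[OF f cH] by blast
  define R where "R = (Dom A c, restricted A (snd T) c)"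
  have R: "R \<in> spaces A" "fst R = Dom A c"
    using restricted_spaces[OF T closed_arrowsD(1)[OF c(1)]] by (simp_all add: R_def)
  have "m \<in> Isos A" if m: "m \<in> closed_arrows A R" "factors_through A d m" for m
  proof -
    have mH: "m \<in> Hom A (Dom A m) (Dom A c)"
      using closed_arrowsD(2)[OF m(1)] R(2) by simp
    have "factors_through A f (c \<cdot> m)"
      using factors_through_comp_left[OF d(1) mH cH m(2)] d(2) by simp
    then have "factors_through A (c \<cdot> Id A (Dom A c)) (c \<cdot> m)"
      using c(4) closed_arrows_comp[OF T c(1)] m(1) Comp_Id_right[OF cH] by (simp add: R_def)
    then have "factors_through A (Id A (Dom A c)) m"
      using factors_through_comp_cancel[OF closed_arrowsD(3)[OF c(1)] cH Id_Hom[OF HomD(4)[OF cH]] mH]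
      by simp
    then show ?thesis
      using Monos_Isos_iff[OF closed_arrowsD(3)[OF m(1)] mH] by simp
  qed
  then show ?thesis
    using that[OF c(1) d] S R d(1) unfolding R_def[symmetric] by (simp add: Dense_iff)
qed

text \<open>The engine of all consequences of continuity. The inverse image of \<open>m\<close> along \<open>v\<close> is closed by continuity, and \<open>d\<close> factors through it, so it
  is an isomorphism. The composition law, the diagonals of the factorization system and the
  stability under colimits all rest on this lemma.\<close>

lemma Dense_factors_through:
  assumes d: "(S, d, T) \<in> Dense A" and v: "continuous_morphism A T v U"
    and m: "m \<in> closed_arrows A U" and fac: "factors_through A (v \<cdot> d) m"
  shows "factors_through A v m"
proof -
  have dH: "d \<in> Hom A (fst S) (fst T)" and T: "T \<in> spaces A"
    using d Dense_iff by auto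
  have vH: "v \<in> Hom A (fst T) (fst U)"
    using v by (simp add: continuous_morphism_def)
  obtain k where k: "k \<in> MM_to (fst T)" "inv_image_sub A v (sub A m) = sub A k"
    "\<And>W a. a \<in> Hom A W (fst T) \<Longrightarrow> factors_through A a k \<longleftrightarrow> factors_through A (v \<cdot> a) m"
    using inv_image_subE[OF vH closed_arrowsD(1)[OF m]] by blast
  have kc: "k \<in> closed_arrows A T"
    using v closed_arrowsD(4)[OF m] k(1,2) by (auto simp: continuous_morphism_def closed_arrows_iff)
  then have "k \<in> Isos A"
    using d k(3)[OF dH] fac by (simp add: Dense_iff)
  then have "factors_through A (Id A (fst T)) k"
    using Monos_Isos_iff[OF closed_arrowsD(3,2)[OF kc]] by simp
  then show ?thesis
    using k(3)[OF Id_Hom[OF spacesD(1)[OF T]]] Comp_Id_right[OF vH] by simp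
qed

lemma EE_Dense:
  assumes S: "S \<in> spaces A" and T: "T \<in> spaces A" and e: "e \<in> Hom A (fst S) (fst T)" "e \<in> EE A"
  shows "(S, e, T) \<in> Dense A"
proof -
  have "m \<in> Isos A" if m: "m \<in> closed_arrows A T" "factors_through A e m" for m
  proof -
    have "factors_through A (Id A (fst T)) m"
      using MM_diagonal[OF e(2), of m "Id A (fst T)"] closed_arrowsD(1)[OF m(1)] m(2)
        Id_Hom[OF spacesD(1)[OF T]] HomD(3)[OF e(1)] Comp_Id_left[OF e(1)] by simp
    then show ?thesis
      using Monos_Isos_iff[OF closed_arrowsD(3,2)[OF m(1)]] by simp
  qed
  then show ?thesis
    using assms Dense_iff by simp
qed

lemma Dense_ClEmb_Isos: "Dense A \<inter> ClEmb A = {(S, m, T) \<in> Ar (Spc A). m \<in> Isos A}"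
proof -
  have "(S, m, T) \<in> Dense A \<and> (S, m, T) \<in> ClEmb A \<longleftrightarrow> (S, m, T) \<in> Ar (Spc A) \<and> m \<in> Isos A"
    for S m T
  proof
    assume "(S, m, T) \<in> Dense A \<and> (S, m, T) \<in> ClEmb A"
    then show "(S, m, T) \<in> Ar (Spc A) \<and> m \<in> Isos A"
      using factors_through_refl by (auto simp: Dense_iff ClEmb_iff)
  next
    assume a: "(S, m, T) \<in> Ar (Spc A) \<and> m \<in> Isos A"
    then have S: "S \<in> spaces A" and T: "T \<in> spaces A" and m: "m \<in> Hom A (fst S) (fst T)"
      and i: "m \<in> Isos A"
      by auto
    note mc = Isos_closed_arrows[OF T i HomD(3)[OF m]]
    have "n \<in> Isos A" if n: "n \<in> closed_arrows A T" "factors_through A m n" for n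
    proof -
      have "factors_through A (Id A (fst T)) m"
        using Monos_Isos_iff[OF Isos_Monos[OF i] m] i by simp
      then have "factors_through A (Id A (fst T)) n"
        using factors_through_trans[OF Id_Hom[OF spacesD(1)[OF T]] m closed_arrowsD(2)[OF n(1)]] n(2)
        by simp
      then show ?thesis
        using Monos_Isos_iff[OF closed_arrowsD(3,2)[OF n(1)]] by simp
    qed
    then show "(S, m, T) \<in> Dense A \<and> (S, m, T) \<in> ClEmb A"
      using S T m mc by (simp add: Dense_iff ClEmb_iff)
  qed
  then show ?thesis
    by (intro Set.set_eqI) (simp add: split_paired_all del: Spc_simps)
qed

text \<open>The inverse of an isomorphism that is a closed embedding is a preneighbourhood morphism by
  initiality of the restricted system. Conversely, composing an isomorphism of spaces, taken on the
  restricted space, with its inverse gives the identity morphism that \<open>restricted_unique\<close> asks for.\<close>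

lemma pDense_pClEmb_Isos: "pDense A \<inter> pClEmb A = Isos (pNbd A)"
proof -
  have "(S, m, T) \<in> pDense A \<and> (S, m, T) \<in> pClEmb A \<longleftrightarrow> (S, m, T) \<in> Isos (pNbd A)" for S m T
  proof
    assume a: "(S, m, T) \<in> pDense A \<and> (S, m, T) \<in> pClEmb A"
    then have S: "S \<in> spaces A" and T: "T \<in> spaces A" and m: "pnbd_morphism A S m T"
      and mc: "m \<in> closed_arrows A T" and SR: "S = (Dom A m, restricted A (snd T) m)"
      unfolding pDense_iff pClEmb_iff Dense_iff by blast+
    note mH = pnbd_Hom[OF m]
    have "m \<in> Isos A"
      using a mc factors_through_refl[OF mH] by (auto simp: pDense_iff Dense_iff)
    then obtain g where g: "g \<in> Hom A (fst T) (fst S)" "g \<cdot> m = Id A (fst S)" "m \<cdot> g = Id A (fst T)"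
      using IsosE[OF _ mH] by blast
    have "pnbd_morphism A T g (Dom A m, restricted A (snd T) m)"
      using pnbd_into_restricted[OF T T closed_arrowsD(1)[OF mc], of g] g(1,3) pnbd_Id[OF T]
        HomD(2)[OF mH] by simp
    then have "pnbd_morphism A T g S"
      by (simp only: SR[symmetric])
    then show "(S, m, T) \<in> Isos (pNbd A)"
      unfolding Isos_pNbd_iff using S T m g(2,3) by blast
  next
    assume a: "(S, m, T) \<in> Isos (pNbd A)"
    then have S: "S \<in> spaces A" and T: "T \<in> spaces A" and m: "pnbd_morphism A S m T"
      unfolding Isos_pNbd_iff by blast+
    obtain g where g: "pnbd_morphism A T g S" "g \<cdot> m = Id A (fst S)" "m \<cdot> g = Id A (fst T)"
      using a unfolding Isos_pNbd_iff by blast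
    note mH = pnbd_Hom[OF m]
    have i: "m \<in> Isos A"
      using IsosI[OF mH pnbd_Hom[OF g(1)] g(2,3)] .
    have mc: "m \<in> closed_arrows A T"
      using Isos_closed_arrows[OF T i HomD(3)[OF mH]] .
    have "pnbd_morphism A (Dom A m, restricted A (snd T) m) (Id A (fst S)) S"
      using pnbd_comp[OF restricted_pnbd[OF T closed_arrowsD(1)[OF mc]] g(1) S] g(2) by simp
    then have "S = (Dom A m, restricted A (snd T) m)"
      using restricted_unique[OF S T MM_Isos[OF i] m] by simp
    moreover have "(S, m, T) \<in> Dense A \<inter> ClEmb A"
      using Dense_ClEmb_Isos S T mH i by auto
    ultimately show "(S, m, T) \<in> pDense A \<and> (S, m, T) \<in> pClEmb A"
      using T m mc by (simp add: pDense_iff pClEmb_iff)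
  qed
  then show ?thesis
    by (intro Set.set_eqI) (simp only: split_paired_all Int_iff)
qed

lemma Dense_comp:
  assumes g: "(T, g, U) \<in> Dense A" "continuous_morphism A T g U" and f: "(S, f, T) \<in> Dense A"
  shows "(S, g \<cdot> f, U) \<in> Dense A"
  using Dense_factors_through[OF f g(2)] f g(1) Comp_Hom unfolding Dense_iff by blast

lemma Dense_cancel:
  assumes gf: "(S, g \<cdot> f, U) \<in> Dense A" and f: "f \<in> Hom A (fst S) (fst T)"
    and g: "g \<in> Hom A (fst T) (fst U)" and T: "T \<in> spaces A"
  shows "(T, g, U) \<in> Dense A"
  using factors_through_comp_right[OF g closed_arrowsD(2) f] gf g T unfolding Dense_iff by blast

section \<open>Orthogonality of dense morphisms and closed embeddings\<close>

lemma orthogonal_Spc_iff: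
  assumes "(S, f, T) \<in> Ar (Spc A)" "(P, g, Q) \<in> Ar (Spc A)"
  shows "orthogonal (Spc A) (S, f, T) (P, g, Q) \<longleftrightarrow> orthogonal A f g"
proof -
  have 1: "Dom A f = fst S" "Cod A f = fst T" "Dom A g = fst P" "Cod A g = fst Q"
    and sp: "S \<in> spaces A" "T \<in> spaces A" "P \<in> spaces A" "Q \<in> spaces A"
    using assms by (auto dest: HomD)
  have all: "(\<forall>x \<in> Hom (Spc A) U V. R x) \<longleftrightarrow> (\<forall>u \<in> Hom A (fst U) (fst V). R (U, u, V))"
    if "U \<in> spaces A" "V \<in> spaces A" for U V R
    using that by (auto simp: Hom_Spc_iff)
  have ex: "(\<exists>!x. x \<in> Hom (Spc A) U V \<and> R x) \<longleftrightarrow> (\<exists>!u. u \<in> Hom A (fst U) (fst V) \<and> R (U, u, V))"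
    if "U \<in> spaces A" "V \<in> spaces A" for U V R
    using that unfolding Hom_Spc_iff by blast
  show ?thesis
    unfolding orthogonal_def Spc_simps all[OF sp(1,3)] all[OF sp(2,4)] ex[OF sp(2,3)] 1 by simp
qed

lemma orthogonal_pNbd_iff:
  assumes "(S, f, T) \<in> Ar (pNbd A)" "(P, g, Q) \<in> Ar (pNbd A)"
  shows "orthogonal (pNbd A) (S, f, T) (P, g, Q) \<longleftrightarrow>
    (\<forall>u v. pnbd_morphism A S u P \<longrightarrow> pnbd_morphism A T v Q \<longrightarrow> v \<cdot> f = g \<cdot> u \<longrightarrow>
      (\<exists>!w. pnbd_morphism A T w P \<and> v = g \<cdot> w \<and> u = w \<cdot> f))"
proof -
  have sp: "S \<in> spaces A" "T \<in> spaces A" "P \<in> spaces A" "Q \<in> spaces A"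
    using assms by auto
  have all: "(\<forall>x \<in> Hom (pNbd A) U V. R x) \<longleftrightarrow> (\<forall>u. pnbd_morphism A U u V \<longrightarrow> R (U, u, V))"
    if "U \<in> spaces A" "V \<in> spaces A" for U V R
    using that by (auto simp: Hom_pNbd_iff)
  have ex: "(\<exists>!x. x \<in> Hom (pNbd A) U V \<and> R x) \<longleftrightarrow> (\<exists>!u. pnbd_morphism A U u V \<and> R (U, u, V))"
    if "U \<in> spaces A" "V \<in> spaces A" for U V R
    using that unfolding Hom_pNbd_iff by blast
  show ?thesis
    unfolding orthogonal_def pNbd_simps all[OF sp(1,3)] all[OF sp(2,4)] ex[OF sp(2,3)] by auto
qed

text \<open>The situation produced by orthogonality of the dense part \<open>d\<close> of \<open>f = c \<cdot> d\<close> to \<open>f\<close> itself: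
  the diagonal \<open>w\<close> is a left inverse of \<open>d\<close>, and a two-sided one because \<open>c\<close> is monic.\<close>

lemma inverse_of_Mono_factor:
  assumes "c \<in> Monos A" "c \<in> Hom A C Y" "f \<in> Hom A X Y" "w \<in> Hom A C X" "d \<in> Hom A X C"
    "f = c \<cdot> d" "c = f \<cdot> w" "w \<cdot> d = Id A X"
  shows "d \<in> Isos A"
proof -
  have "c \<cdot> (d \<cdot> w) = c \<cdot> Id A C"
    using Comp_assoc[OF assms(4,5,2)] Comp_Id_right[OF assms(2)] assms(6,7) by metis
  then have dw: "d \<cdot> w = Id A C"
    using Monos_cancel[OF assms(1,2) Comp_Hom[OF assms(4,5)] Id_Hom[OF HomD(4)[OF assms(2)]]] by simp
  then show "d \<in> Isos A"
    using IsosI[OF assms(5,4,8)] by blast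
qed

lemma closed_arrows_Isos_comp:
  assumes "T \<in> spaces A" "c \<in> closed_arrows A T" "d \<in> Isos A" "Cod A d = Dom A c"
  shows "c \<cdot> d \<in> closed_arrows A T"
  using closed_arrows_comp[OF assms(1,2)] Isos_closed_arrows[of "(Dom A c, restricted A (snd T) c)" d]
    restricted_spaces[OF assms(1) closed_arrowsD(1)[OF assms(2)]] assms(3,4) by simp

text \<open>Factor \<open>f = c \<cdot> d\<close> with \<open>d\<close> dense and fill the square with sides \<open>d\<close>, \<open>c\<close>, \<open>f\<close> and the
  identity; the diagonal shows \<open>d\<close> to be an isomorphism, so \<open>f\<close> represents the same closed subobject
  as \<open>c\<close>.\<close>

lemma orth_down_Dense: "orth_down (Spc A) (Dense A) \<subseteq> ClEmb A"
proof
  fix x assume x: "x \<in> orth_down (Spc A) (Dense A)"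
  obtain S f T where xf: "x = (S, f, T)"
    by (cases x)
  have S: "S \<in> spaces A" and T: "T \<in> spaces A" and f: "f \<in> Hom A (fst S) (fst T)"
    using x xf by (auto simp: orth_down_def)
  obtain c d where c: "c \<in> closed_arrows A T" and d: "d \<in> Hom A (fst S) (Dom A c)" "f = c \<cdot> d"
    "(S, d, (Dom A c, restricted A (snd T) c)) \<in> Dense A"
    by (rule Dense_ClEmb_factorization[OF S T f])
  have "orthogonal (Spc A) (S, d, (Dom A c, restricted A (snd T) c)) (S, f, T)"
    using x xf d(3) by (simp add: orth_down_def)
  moreover have "(S, d, (Dom A c, restricted A (snd T) c)) \<in> Ar (Spc A)" "(S, f, T) \<in> Ar (Spc A)"
    using S T d f by (simp_all add: Dense_iff)
  ultimately have "orthogonal A d f"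
    using orthogonal_Spc_iff by blast
  moreover have "c \<cdot> d = f \<cdot> Id A (fst S)"
    using d(2) Comp_Id_right[OF f] by simp
  ultimately obtain w where w: "w \<in> Hom A (Dom A c) (fst S)" "c = f \<cdot> w" "w \<cdot> d = Id A (fst S)"
    using closed_arrowsD(2)[OF c] Id_Hom[OF spacesD(1)[OF S]]
    unfolding orthogonal_def HomD(2,3)[OF f] HomD(2,3)[OF d(1)] by metis
  have "d \<in> Isos A"
    using inverse_of_Mono_factor[OF closed_arrowsD(3,2)[OF c] f w(1) d(1,2) w(2,3)] .
  then show "x \<in> ClEmb A"
    using closed_arrows_Isos_comp[OF T c] HomD(3)[OF d(1)] S T f d(2) xf by (simp add: ClEmb_iff)
qed

text \<open>Beyond the previous argument, the domain of \<open>f\<close> must carry the restricted system. This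
  follows from \<open>restricted_unique\<close>: the diagonal \<open>w\<close> is a preneighbourhood morphism, so is \<open>d\<close> out
  of the restricted space by initiality, and their composite is the identity from the restricted
  space to the given one.\<close>

lemma orth_down_pDense: "orth_down (pNbd A) (pDense A) \<subseteq> pClEmb A"
proof
  fix x assume x: "x \<in> orth_down (pNbd A) (pDense A)"
  obtain S f T where xf: "x = (S, f, T)"
    by (cases x)
  have S: "S \<in> spaces A" and T: "T \<in> spaces A" and f: "pnbd_morphism A S f T"
    using x xf by (auto simp: orth_down_def)
  note fH = pnbd_Hom[OF f]
  obtain c d where c: "c \<in> closed_arrows A T" and d: "d \<in> Hom A (fst S) (Dom A c)" "f = c \<cdot> d"
    "(S, d, (Dom A c, restricted A (snd T) c)) \<in> Dense A"
    by (rule Dense_ClEmb_factorization[OF S T fH])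
  define R where "R = (Dom A c, restricted A (snd T) c)"
  note cT = closed_arrowsD(1)[OF c]
  have R: "R \<in> spaces A" "fst R = Dom A c"
    using restricted_spaces[OF T cT] by (simp_all add: R_def)
  have cp: "pnbd_morphism A R c T"
    using restricted_pnbd[OF T cT] by (simp add: R_def)
  have dp: "pnbd_morphism A S d R"
    using pnbd_into_restricted[OF S T cT d(1)] f d(2) by (simp add: R_def)
  have "orthogonal (pNbd A) (S, d, R) (S, f, T)"
    using x xf d(3) dp by (simp add: orth_down_def pDense_iff R_def)
  moreover have "(S, d, R) \<in> Ar (pNbd A)" "(S, f, T) \<in> Ar (pNbd A)"
    using S T R dp f by simp_all
  moreover have "c \<cdot> d = f \<cdot> Id A (fst S)"
    using d(2) Comp_Id_right[OF fH] by simp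
  ultimately obtain w where w: "pnbd_morphism A R w S" "c = f \<cdot> w" "w \<cdot> d = Id A (fst S)"
    using orthogonal_pNbd_iff[of S d R S f T] cp pnbd_Id[OF S] by metis
  have wH: "w \<in> Hom A (Dom A c) (fst S)"
    using pnbd_Hom[OF w(1)] R(2) by simp
  have "d \<in> Isos A"
    using inverse_of_Mono_factor[OF closed_arrowsD(3,2)[OF c] fH wH d(1,2) w(2,3)] .
  then have fc: "f \<in> closed_arrows A T"
    using closed_arrows_Isos_comp[OF T c] HomD(3)[OF d(1)] d(2) by simp
  note fT = closed_arrowsD(1)[OF fc]
  have Q: "(Dom A f, restricted A (snd T) f) \<in> spaces A"
    by (rule restricted_spaces[OF T fT])
  have "pnbd_morphism A (Dom A f, restricted A (snd T) f) d R"
    using pnbd_into_restricted[OF Q T cT] d(1,2) HomD(2)[OF fH] restricted_pnbd[OF T fT]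
    by (simp add: R_def)
  then have "pnbd_morphism A (Dom A f, restricted A (snd T) f) (Id A (fst S)) S"
    using pnbd_comp[OF _ w(1) S] w(3) by metis
  then have "S = (Dom A f, restricted A (snd T) f)"
    using restricted_unique[OF S T _ f] fT by simp
  then show "x \<in> pClEmb A"
    using T fc xf by (simp add: pClEmb_iff)
qed

lemma orth_up_ClEmb: "orth_up (Spc A) (ClEmb A) \<subseteq> Dense A"
proof
  fix x assume x: "x \<in> orth_up (Spc A) (ClEmb A)"
  obtain S f T where xf: "x = (S, f, T)"
    by (cases x)
  have S: "S \<in> spaces A" and T: "T \<in> spaces A" and f: "f \<in> Hom A (fst S) (fst T)"
    using x xf by (auto simp: orth_up_def)
  have "m \<in> Isos A" if m: "m \<in> closed_arrows A T" "factors_through A f m" for m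
  proof -
    note mH = closed_arrowsD(2)[OF m(1)]
    \<comment> \<open>some system on the domain is needed to see \<open>m\<close> as an arrow between spaces\<close>
    define R where "R = (Dom A m, restricted A (snd T) m)"
    have R: "R \<in> spaces A" "fst R = Dom A m"
      using restricted_spaces[OF T closed_arrowsD(1)[OF m(1)]] by (simp_all add: R_def)
    have "(R, m, T) \<in> ClEmb A"
      using R T mH m(1) by (simp add: ClEmb_iff)
    then have "orthogonal (Spc A) (S, f, T) (R, m, T)"
      using x xf by (simp add: orth_up_def)
    then have "orthogonal A f m"
      using orthogonal_Spc_iff[of S f T R m T] S T f R mH by simp
    then have "factors_through A (Id A (fst T)) m"
      using orthogonal_Monos_iff[OF f mH closed_arrowsD(3)[OF m(1)]] Id_Hom[OF spacesD(1)[OF T]]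
        Comp_Id_left[OF f] m(2) by metis
    then show ?thesis
      using Monos_Isos_iff[OF closed_arrowsD(3)[OF m(1)] mH] by simp
  qed
  then show "x \<in> Dense A"
    using S T f xf by (simp add: Dense_iff)
qed

lemma orth_up_pClEmb: "orth_up (pNbd A) (pClEmb A) \<subseteq> pDense A"
proof
  fix x assume x: "x \<in> orth_up (pNbd A) (pClEmb A)"
  obtain S f T where xf: "x = (S, f, T)"
    by (cases x)
  have S: "S \<in> spaces A" and T: "T \<in> spaces A" and f: "pnbd_morphism A S f T"
    using x xf by (auto simp: orth_up_def)
  note fH = pnbd_Hom[OF f]
  have "m \<in> Isos A" if m: "m \<in> closed_arrows A T" "factors_through A f m" for m
  proof -
    note mH = closed_arrowsD(2)[OF m(1)] and mT = closed_arrowsD(1)[OF m(1)]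
    define R where "R = (Dom A m, restricted A (snd T) m)"
    have R: "R \<in> spaces A"
      using restricted_spaces[OF T mT] by (simp add: R_def)
    obtain h where h: "h \<in> Hom A (fst S) (Dom A m)" "f = m \<cdot> h"
      using m(2) factors_through_iff[OF fH mH] by blast
    have hp: "pnbd_morphism A S h R"
      using pnbd_into_restricted[OF S T mT h(1)] f h(2) by (simp add: R_def)
    have "(R, m, T) \<in> pClEmb A"
      using T m(1) by (simp add: pClEmb_iff R_def)
    then have "orthogonal (pNbd A) (S, f, T) (R, m, T)"
      using x xf by (simp add: orth_up_def)
    moreover have "pnbd_morphism A R m T"
      using restricted_pnbd[OF T mT] by (simp add: R_def)
    moreover have "Id A (fst T) \<cdot> f = m \<cdot> h"
      using Comp_Id_left[OF fH] h(2) by simp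
    ultimately obtain w where w: "pnbd_morphism A T w R" "Id A (fst T) = m \<cdot> w"
      using orthogonal_pNbd_iff[of S f T R m T] S T f R hp pnbd_Id[OF T]
      by (metis pNbd_simps(6))
    have "factors_through A (Id A (fst T)) m"
      using factors_through_iff[OF Id_Hom[OF spacesD(1)[OF T]] mH] pnbd_Hom[OF w(1)] w(2)
      by (auto simp: R_def)
    then show ?thesis
      using Monos_Isos_iff[OF closed_arrowsD(3)[OF m(1)] mH] by simp
  qed
  then show "x \<in> pDense A"
    using S T f fH xf by (simp add: pDense_iff Dense_iff)
qed

section \<open>Factorization and stability when preneighbourhood morphisms are continuous\<close>

lemma all_pnbd_continuousD:
  assumes "all_pnbd_continuous A" "S \<in> spaces A" "T \<in> spaces A" "pnbd_morphism A S f T"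
  shows "continuous_morphism A S f T"
proof -
  have "(S, f, T) \<in> Ar (pNbd A)"
    using assms by simp
  then show ?thesis
    using assms(1) unfolding all_pnbd_continuous_def by blast
qed

lemma pDense_pClEmb_orthogonal:
  assumes cont: "all_pnbd_continuous A" and d: "x \<in> pDense A" and c: "y \<in> pClEmb A"
  shows "orthogonal (pNbd A) x y"
proof -
  obtain S d T where x: "x = (S, d, T)"
    by (cases x)
  obtain P c Q where y: "y = (P, c, Q)"
    by (cases y)
  have S: "S \<in> spaces A" and T: "T \<in> spaces A" and dp: "pnbd_morphism A S d T"
    and dd: "(S, d, T) \<in> Dense A"
    using d x by (auto simp: pDense_iff Dense_iff)
  have Q: "Q \<in> spaces A" and cc: "c \<in> closed_arrows A Q"
    and P: "P = (Dom A c, restricted A (snd Q) c)"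
    using c y by (auto simp: pClEmb_iff)
  note cQ = closed_arrowsD(1)[OF cc] and cH = closed_arrowsD(2)[OF cc] and dH = pnbd_Hom[OF dp]
  have PS: "P \<in> spaces A" "fst P = Dom A c" and cp: "pnbd_morphism A P c Q"
    using restricted_spaces[OF Q cQ] restricted_pnbd[OF Q cQ] P by simp_all
  have "\<exists>!w. pnbd_morphism A T w P \<and> v = c \<cdot> w \<and> u = w \<cdot> d"
    if u: "pnbd_morphism A S u P" and v: "pnbd_morphism A T v Q" and eq: "v \<cdot> d = c \<cdot> u" for u v
  proof -
    note vH = pnbd_Hom[OF v]
    have uH: "u \<in> Hom A (fst S) (Dom A c)"
      using pnbd_Hom[OF u] PS(2) by simp
    have "factors_through A (v \<cdot> d) c"
      using factors_through_iff[OF Comp_Hom[OF dH vH] cH] uH eq by blast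
    then have "factors_through A v c"
      using Dense_factors_through[OF dd all_pnbd_continuousD[OF cont T Q v] cc] by simp
    then obtain w where w: "w \<in> Hom A (fst T) (Dom A c)" "v = c \<cdot> w"
      using factors_through_iff[OF vH cH] by blast
    have "pnbd_morphism A T w P"
      using pnbd_into_restricted[OF T Q cQ w(1)] v w(2) P by simp
    moreover have "c \<cdot> u = c \<cdot> (w \<cdot> d)"
      using Comp_assoc[OF dH w(1) cH] eq w(2) by simp
    then have "u = w \<cdot> d"
      using Monos_cancel[OF closed_arrowsD(3)[OF cc] cH uH Comp_Hom[OF dH w(1)]] by simp
    moreover have "w' = w" if "pnbd_morphism A T w' P" "v = c \<cdot> w'" for w'
      using Monos_cancel[OF closed_arrowsD(3)[OF cc] cH _ w(1), of w'] pnbd_Hom[OF that(1)] PS(2)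
        that(2) w(2) by simp
    ultimately show ?thesis
      using w(2) by blast
  qed
  then show ?thesis
    using orthogonal_pNbd_iff[of S d T P c Q] S T dp PS(1) Q cp x y by simp
qed

lemma pDense_pClEmb_factorization_system:
  assumes cont: "all_pnbd_continuous A"
  shows "pDense A \<subseteq> orth_up (pNbd A) (pClEmb A)"
    and "factorization_system (pNbd A) (pDense A) (pClEmb A)"
proof -
  have Ar1: "pDense A \<subseteq> Ar (pNbd A)"
    by (simp add: pDense_def)
  have Ar2: "pClEmb A \<subseteq> Ar (pNbd A)"
  proof
    fix y assume "y \<in> pClEmb A"
    then show "y \<in> Ar (pNbd A)"
      using restricted_spaces[OF _ closed_arrowsD(1)] restricted_pnbd[OF _ closed_arrowsD(1)]
      by (cases y) (auto simp: pClEmb_iff)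
  qed
  show up: "pDense A \<subseteq> orth_up (pNbd A) (pClEmb A)"
    using pDense_pClEmb_orthogonal[OF cont] Ar1 unfolding orth_up_def by blast
  have down: "pClEmb A \<subseteq> orth_down (pNbd A) (pDense A)"
    using pDense_pClEmb_orthogonal[OF cont] Ar2 unfolding orth_down_def by blast
  have fac: "\<exists>e \<in> pDense A. \<exists>m \<in> pClEmb A. Cod (pNbd A) e = Dom (pNbd A) m \<and> x = m \<cdot>\<^bsub>pNbd A\<^esub> e"
    if x: "x \<in> Ar (pNbd A)" for x
  proof -
    obtain S f T where xf: "x = (S, f, T)"
      by (cases x)
    have S: "S \<in> spaces A" and T: "T \<in> spaces A" and f: "pnbd_morphism A S f T"
      using x xf by auto
    obtain c d where c: "c \<in> closed_arrows A T" and d: "d \<in> Hom A (fst S) (Dom A c)" "f = c \<cdot> d"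
      "(S, d, (Dom A c, restricted A (snd T) c)) \<in> Dense A"
      by (rule Dense_ClEmb_factorization[OF S T pnbd_Hom[OF f]])
    define R where "R = (Dom A c, restricted A (snd T) c)"
    have "(S, d, R) \<in> pDense A"
      using pnbd_into_restricted[OF S T closed_arrowsD(1)[OF c] d(1)] f d(2,3)
      by (simp add: pDense_iff R_def)
    moreover have "(R, c, T) \<in> pClEmb A"
      using T c by (simp add: pClEmb_iff R_def)
    ultimately show ?thesis
      using xf d(2) by (intro bexI[of _ "(S, d, R)"] bexI[of _ "(R, c, T)"]) simp_all
  qed
  show "factorization_system (pNbd A) (pDense A) (pClEmb A)"
    unfolding factorization_system_def
    using up down fac orth_up_pClEmb orth_down_pDense by blast
qed

text \<open>If \<open>p\<close> factors through a closed \<open>m\<close> then so does \<open>q \<cdot> d = p \<cdot> h\<close>, hence \<open>q\<close>, since \<open>q\<close> is a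
  preneighbourhood morphism for the final system and so continuous. Both legs thus factor through
  \<open>m\<close>, which splits \<open>m\<close> by the universal property.\<close>

lemma Dense_pushout:
  assumes cont: "all_pnbd_continuous A" and d: "(S, d, T) \<in> Dense A"
    and U: "U \<in> spaces A"
    and h: "h \<in> Hom A (fst S) (fst U)" and po: "is_pushout A d h q p" and P: "Cod A p = P"
    and fin: "final_system A P {(T, q), (U, p)} \<pi>"
  shows "(U, p, (P, \<pi>)) \<in> Dense A"
proof -
  have dH: "d \<in> Hom A (fst S) (fst T)" and T: "T \<in> spaces A"
    using d by (auto simp: Dense_iff)
  have qp: "pnbd_morphism A T q (P, \<pi>)" and pp: "pnbd_morphism A U p (P, \<pi>)"
    and \<pi>: "\<pi> \<in> systems A P"
    using fin by (auto simp: final_system_def)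
  have qH: "q \<in> Hom A (fst T) P" and pH: "p \<in> Hom A (fst U) P"
    using pnbd_Hom[OF qp] pnbd_Hom[OF pp] by simp_all
  have PS: "(P, \<pi>) \<in> spaces A"
    using \<pi> HomD(5)[OF pH] by (simp add: spaces_def)
  have sq: "q \<cdot> d = p \<cdot> h"
    using po by (simp add: is_pushout_def)
  have univ: "\<exists>!w. w \<in> Hom A P W \<and> w \<cdot> q = a \<and> w \<cdot> p = b"
    if "a \<in> Hom A (fst T) W" "b \<in> Hom A (fst U) W" "a \<cdot> d = b \<cdot> h" for W a b
    using po that HomD[OF dH] HomD[OF h] HomD[OF qH] unfolding is_pushout_def by simp
  have "m \<in> Isos A" if m: "m \<in> closed_arrows A (P, \<pi>)" "factors_through A p m" for m
  proof -
    have mH: "m \<in> Hom A (Dom A m) P" and mm: "m \<in> Monos A"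
      using closed_arrowsD(2,3)[OF m(1)] by simp_all
    have "factors_through A (q \<cdot> d) m"
      using factors_through_comp_right[OF pH mH h m(2)] sq by simp
    then have "factors_through A q m"
      using Dense_factors_through[OF d all_pnbd_continuousD[OF cont T PS qp] m(1)] by simp
    then obtain a where a: "a \<in> Hom A (fst T) (Dom A m)" "q = m \<cdot> a"
      using factors_through_iff[OF qH mH] by blast
    obtain b where b: "b \<in> Hom A (fst U) (Dom A m)" "p = m \<cdot> b"
      using m(2) factors_through_iff[OF pH mH] by blast
    have "m \<cdot> (a \<cdot> d) = m \<cdot> (b \<cdot> h)"
      using Comp_assoc[OF dH a(1) mH] Comp_assoc[OF h b(1) mH] sq a(2) b(2) by simp
    then have "a \<cdot> d = b \<cdot> h"
      using Monos_cancel[OF mm mH Comp_Hom[OF dH a(1)] Comp_Hom[OF h b(1)]] by simp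
    then obtain w where w: "w \<in> Hom A P (Dom A m)" "w \<cdot> q = a" "w \<cdot> p = b"
      using univ[OF a(1) b(1)] by blast
    have "(m \<cdot> w) \<cdot> q = q" "(m \<cdot> w) \<cdot> p = p"
      using Comp_assoc[OF qH w(1) mH] Comp_assoc[OF pH w(1) mH] w(2,3) a(2) b(2) by simp_all
    then have "m \<cdot> w = Id A P"
      using univ[OF qH pH sq] Comp_Hom[OF w(1) mH] Id_Hom[OF HomD(5)[OF pH]] Comp_Id_left[OF qH]
        Comp_Id_left[OF pH] by blast
    then have "factors_through A (Id A P) m"
      using factors_through_iff[OF Id_Hom[OF HomD(5)[OF pH]] mH] w(1) by metis
    then show ?thesis
      using Monos_Isos_iff[OF mm mH] by simp
  qed
  then show ?thesis
    using U PS pH by (simp add: Dense_iff)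
qed

text \<open>The same argument with the colimiting cocone \<open>\<kappa>\<close> in place of the two legs: every \<open>\<kappa> i\<close> is
  continuous and \<open>\<kappa> i \<cdot> \<alpha> i\<close> factors through \<open>m\<close>, hence so does \<open>\<kappa> i\<close>.\<close>

lemma Dense_colim:
  assumes cont: "all_pnbd_continuous A"
    and Fun: "is_functor J A Fo Fa" and Gun: "is_functor J A Go Ga" and J: "category J"
    and nat: "is_nat_trans J A Fo Fa Go Ga \<alpha>"
    and dense: "\<And>i. i \<in> Ob J \<Longrightarrow> ((Fo i, \<mu>F i), \<alpha> i, (Go i, \<mu>G i)) \<in> Dense A"
    and L: "is_colimit J A Fo Fa L \<iota>" "final_system A L {((Fo i, \<mu>F i), \<iota> i) | i. i \<in> Ob J} \<nu>L"
    and K: "is_colimit J A Go Ga K \<kappa>" "final_system A K {((Go i, \<mu>G i), \<kappa> i) | i. i \<in> Ob J} \<nu>K"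
  shows "((L, \<nu>L), colim_map J A L \<iota> K \<kappa> \<alpha>, (K, \<nu>K)) \<in> Dense A"
proof -
  have Lc: "is_cocone J A Fo Fa L \<iota>" and Kc: "is_cocone J A Go Ga K \<kappa>"
    using L(1) K(1) by (simp_all add: is_colimit_def)
  have LO: "L \<in> Ob A" and KO: "K \<in> Ob A"
    using Lc Kc by (simp_all add: is_cocone_def)
  have LS: "(L, \<nu>L) \<in> spaces A" and KS: "(K, \<nu>K) \<in> spaces A"
    using L(2) K(2) LO KO by (simp_all add: final_system_def spaces_def)
  have iH: "\<iota> i \<in> Hom A (Fo i) L" and kH: "\<kappa> i \<in> Hom A (Go i) K"
    and aH: "\<alpha> i \<in> Hom A (Fo i) (Go i)" if "i \<in> Ob J" for i
    using Lc Kc nat that by (simp_all add: is_cocone_def is_nat_trans_def)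
  have kp: "pnbd_morphism A (Go i, \<mu>G i) (\<kappa> i) (K, \<nu>K)" if "i \<in> Ob J" for i
    using K(2) that unfolding final_system_def by blast
  have univK: "\<exists>!w. w \<in> Hom A K W \<and> (\<forall>i \<in> Ob J. w \<cdot> \<kappa> i = \<beta> i)" if "is_cocone J A Go Ga W \<beta>" for W \<beta>
    using K(1) that unfolding is_colimit_def by blast
  have "is_cocone J A Fo Fa K (\<lambda>i. \<kappa> i \<cdot> \<alpha> i)"
    unfolding is_cocone_def
  proof (intro conjI ballI KO)
    show "\<kappa> i \<cdot> \<alpha> i \<in> Hom A (Fo i) K" if "i \<in> Ob J" for i
      using Comp_Hom[OF aH kH] that by simp
    fix a assume a: "a \<in> Ar J"
    have ob: "Dom J a \<in> Ob J" "Cod J a \<in> Ob J"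
      using category.Dom_Ob[OF J a] category.Cod_Ob[OF J a] by simp_all
    have Fa: "Fa a \<in> Hom A (Fo (Dom J a)) (Fo (Cod J a))"
      and Ga: "Ga a \<in> Hom A (Go (Dom J a)) (Go (Cod J a))"
      using Fun Gun a by (simp_all add: is_functor_def)
    have "(\<kappa> (Cod J a) \<cdot> \<alpha> (Cod J a)) \<cdot> Fa a = \<kappa> (Cod J a) \<cdot> (Ga a \<cdot> \<alpha> (Dom J a))"
      using Comp_assoc[OF Fa aH[OF ob(2)] kH[OF ob(2)]] nat a by (simp add: is_nat_trans_def)
    also have "\<dots> = \<kappa> (Dom J a) \<cdot> \<alpha> (Dom J a)"
      using Comp_assoc[OF aH[OF ob(1)] Ga kH[OF ob(2)]] Kc a by (simp add: is_cocone_def)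
    finally show "(\<kappa> (Cod J a) \<cdot> \<alpha> (Cod J a)) \<cdot> Fa a = \<kappa> (Dom J a) \<cdot> \<alpha> (Dom J a)" .
  qed
  then have "\<exists>!w. w \<in> Hom A L K \<and> (\<forall>i \<in> Ob J. w \<cdot> \<iota> i = \<kappa> i \<cdot> \<alpha> i)"
    using L(1) unfolding is_colimit_def by blast
  then have "colim_map J A L \<iota> K \<kappa> \<alpha> \<in> Hom A L K \<and>
      (\<forall>i \<in> Ob J. colim_map J A L \<iota> K \<kappa> \<alpha> \<cdot> \<iota> i = \<kappa> i \<cdot> \<alpha> i)"
    unfolding colim_map_def by (rule theI')
  then obtain w where w: "w = colim_map J A L \<iota> K \<kappa> \<alpha>" "w \<in> Hom A L K"
    "\<And>i. i \<in> Ob J \<Longrightarrow> w \<cdot> \<iota> i = \<kappa> i \<cdot> \<alpha> i"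
    by blast
  have "m \<in> Isos A" if m: "m \<in> closed_arrows A (K, \<nu>K)" "factors_through A w m" for m
  proof -
    have mH: "m \<in> Hom A (Dom A m) K" and mm: "m \<in> Monos A"
      using closed_arrowsD(2,3)[OF m(1)] by simp_all
    have "\<exists>b \<in> Hom A (Go i) (Dom A m). \<kappa> i = m \<cdot> b" if i: "i \<in> Ob J" for i
    proof -
      have "(Go i, \<mu>G i) \<in> spaces A"
        using dense[OF i] by (simp add: Dense_iff)
      then have "continuous_morphism A (Go i, \<mu>G i) (\<kappa> i) (K, \<nu>K)"
        using all_pnbd_continuousD[OF cont _ KS kp[OF i]] by simp
      moreover have "factors_through A (\<kappa> i \<cdot> \<alpha> i) m"
        using factors_through_comp_right[OF w(2) mH iH[OF i] m(2)] w(3)[OF i] by simp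
      ultimately have "factors_through A (\<kappa> i) m"
        using Dense_factors_through[OF dense[OF i] _ m(1)] by simp
      then show ?thesis
        using factors_through_iff[OF kH[OF i] mH] by simp
    qed
    then obtain b where b: "\<And>i. i \<in> Ob J \<Longrightarrow> b i \<in> Hom A (Go i) (Dom A m)"
      "\<And>i. i \<in> Ob J \<Longrightarrow> \<kappa> i = m \<cdot> b i"
      by metis
    have "is_cocone J A Go Ga (Dom A m) b"
      unfolding is_cocone_def
    proof (intro conjI ballI HomD(4)[OF mH] b(1))
      fix a assume a: "a \<in> Ar J"
      have ob: "Dom J a \<in> Ob J" "Cod J a \<in> Ob J"
        using category.Dom_Ob[OF J a] category.Cod_Ob[OF J a] by simp_all
      have Ga: "Ga a \<in> Hom A (Go (Dom J a)) (Go (Cod J a))"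
        using Gun a by (simp add: is_functor_def)
      have "\<kappa> (Cod J a) \<cdot> Ga a = \<kappa> (Dom J a)"
        using Kc a by (simp add: is_cocone_def)
      then have "m \<cdot> (b (Cod J a) \<cdot> Ga a) = m \<cdot> b (Dom J a)"
        using Comp_assoc[OF Ga b(1)[OF ob(2)] mH] b(2)[OF ob(1)] b(2)[OF ob(2)] by simp
      then show "b (Cod J a) \<cdot> Ga a = b (Dom J a)"
        using Monos_cancel[OF mm mH Comp_Hom[OF Ga b(1)[OF ob(2)]] b(1)[OF ob(1)]] by simp
    qed
    then obtain v where v: "v \<in> Hom A K (Dom A m)" "\<And>i. i \<in> Ob J \<Longrightarrow> v \<cdot> \<kappa> i = b i"
      using univK by blast
    have "(m \<cdot> v) \<cdot> \<kappa> i = \<kappa> i" if i: "i \<in> Ob J" for i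
      using Comp_assoc[OF kH[OF i] v(1) mH] v(2)[OF i] b(2)[OF i] by simp
    then have "m \<cdot> v = Id A K"
      using univK[OF Kc] Comp_Hom[OF v(1) mH] Id_Hom[OF KO] Comp_Id_left[OF kH] by blast
    then have "factors_through A (Id A K) m"
      using factors_through_iff[OF Id_Hom[OF KO] mH] v(1) by metis
    then show ?thesis
      using Monos_Isos_iff[OF mm mH] by simp
  qed
  then show ?thesis
    using LS KS w(1,2) by (simp add: Dense_iff)
qed

end


theorem mainTheorem13:
  fixes A :: "('o, 'm) fact_cat"
    and X Y Z :: 'o and \<mu> \<phi> \<psi> :: "'m system" and f g :: 'm
    and J :: "('i, 'j) cat" and Fo Go :: "'i \<Rightarrow> 'o" and Fa Ga :: "'j \<Rightarrow> 'm" and \<alpha> :: "'i \<Rightarrow> 'm"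
  assumes "pnbd_context A"
    and "(X, \<mu>) \<in> spaces A" and "(Y, \<phi>) \<in> spaces A" and "(Z, \<psi>) \<in> spaces A"
    and "f \<in> Hom A X Y" and "g \<in> Hom A Y Z"
  shows
    \<comment> \<open>(a)\<close>
    "(((X, \<mu>), f, (Y, \<phi>)) \<in> Dense A \<longleftrightarrow> cl_hat A (Y, \<phi>) (M_part A f) = sub A (Id A Y))
    \<and> \<comment> \<open>(b), for arrows of A between spaces and for preneighbourhood morphisms\<close>
      ({(S, e, T) \<in> Ar (Spc A). e \<in> EE A} \<subseteq> Dense A \<and>
       Dense A \<inter> ClEmb A = {(S, m, T) \<in> Ar (Spc A). m \<in> Isos A} \<and>
       pDense A \<inter> pClEmb A = Isos (pNbd A))
    \<and> \<comment> \<open>(c)\<close>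
      (((Y, \<phi>), g, (Z, \<psi>)) \<in> Dense A \<and> continuous_morphism A (Y, \<phi>) g (Z, \<psi>) \<and>
       ((X, \<mu>), f, (Y, \<phi>)) \<in> Dense A \<longrightarrow> ((X, \<mu>), g \<cdot>\<^bsub>A\<^esub> f, (Z, \<psi>)) \<in> Dense A)
    \<and> \<comment> \<open>(d)\<close>
      (((X, \<mu>), g \<cdot>\<^bsub>A\<^esub> f, (Z, \<psi>)) \<in> Dense A \<longrightarrow> ((Y, \<phi>), g, (Z, \<psi>)) \<in> Dense A)
    \<and> \<comment> \<open>(e), for arrows of A between spaces and for preneighbourhood morphisms\<close>
      (orth_down (Spc A) (Dense A) \<subseteq> ClEmb A \<and>
       orth_up (Spc A) (ClEmb A) \<subseteq> Dense A \<and>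
       orth_down (pNbd A) (pDense A) \<subseteq> pClEmb A \<and>
       orth_up (pNbd A) (pClEmb A) \<subseteq> pDense A)
    \<and> \<comment> \<open>(f)\<close>
      (all_pnbd_continuous A \<longrightarrow>
       pDense A \<subseteq> orth_up (pNbd A) (pClEmb A) \<and>
       factorization_system (pNbd A) (pDense A) (pClEmb A))
    \<and> \<comment> \<open>(g): the pushout p of a dense d along an arbitrary h is dense\<close>
      (all_pnbd_continuous A \<longrightarrow>
       (\<forall>S T U d h P p q \<pi>.
          (S, d, T) \<in> Dense A \<and> (S, h, U) \<in> Ar (Spc A) \<and>
          is_pushout A d h q p \<and> Cod A p = P \<and> final_system A P {(T, q), (U, p)} \<pi> \<longrightarrow>
          (U, p, (P, \<pi>)) \<in> Dense A))
    \<and> \<comment> \<open>(h)\<close>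
      (all_pnbd_continuous A \<and>
       category J \<and> is_functor J A Fo Fa \<and> is_functor J A Go Ga \<and>
       is_nat_trans J A Fo Fa Go Ga \<alpha> \<longrightarrow>
       (\<forall>\<mu>F \<mu>G L \<iota> \<nu>L K \<kappa> \<nu>K.
          (\<forall>i \<in> Ob J. ((Fo i, \<mu>F i), \<alpha> i, (Go i, \<mu>G i)) \<in> Dense A) \<and>
          is_colimit J A Fo Fa L \<iota> \<and>
          final_system A L {((Fo i, \<mu>F i), \<iota> i) | i. i \<in> Ob J} \<nu>L \<and>
          is_colimit J A Go Ga K \<kappa> \<and>
          final_system A K {((Go i, \<mu>G i), \<kappa> i) | i. i \<in> Ob J} \<nu>K \<longrightarrow>
          ((L, \<nu>L), colim_map J A L \<iota> K \<kappa> \<alpha>, (K, \<nu>K)) \<in> Dense A))"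
proof -
  interpret pnbd_context A
    by fact
  note sp = assms(2,3,4) and fg = assms(5,6)
  show ?thesis
  proof (intro conjI)
    show "((X, \<mu>), f, (Y, \<phi>)) \<in> Dense A \<longleftrightarrow> cl_hat A (Y, \<phi>) (M_part A f) = sub A (Id A Y)"
      using Dense_iff_cl_hat[OF sp(1,2)] fg(1) by simp
    show "{(S, e, T) \<in> Ar (Spc A). e \<in> EE A} \<subseteq> Dense A"
      using EE_Dense by auto
    show "Dense A \<inter> ClEmb A = {(S, m, T) \<in> Ar (Spc A). m \<in> Isos A}"
      by (rule Dense_ClEmb_Isos)
    show "pDense A \<inter> pClEmb A = Isos (pNbd A)"
      by (rule pDense_pClEmb_Isos)
    show "((Y, \<phi>), g, (Z, \<psi>)) \<in> Dense A \<and> continuous_morphism A (Y, \<phi>) g (Z, \<psi>) \<and>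
        ((X, \<mu>), f, (Y, \<phi>)) \<in> Dense A \<longrightarrow> ((X, \<mu>), g \<cdot>\<^bsub>A\<^esub> f, (Z, \<psi>)) \<in> Dense A"
      using Dense_comp by blast
    show "((X, \<mu>), g \<cdot>\<^bsub>A\<^esub> f, (Z, \<psi>)) \<in> Dense A \<longrightarrow> ((Y, \<phi>), g, (Z, \<psi>)) \<in> Dense A"
      using Dense_cancel[of "(X, \<mu>)" g f "(Z, \<psi>)" "(Y, \<phi>)"] sp(2) fg by simp
    show "orth_down (Spc A) (Dense A) \<subseteq> ClEmb A"
      by (rule orth_down_Dense)
    show "orth_up (Spc A) (ClEmb A) \<subseteq> Dense A"
      by (rule orth_up_ClEmb)
    show "orth_down (pNbd A) (pDense A) \<subseteq> pClEmb A"
      by (rule orth_down_pDense)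
    show "orth_up (pNbd A) (pClEmb A) \<subseteq> pDense A"
      by (rule orth_up_pClEmb)
    show "all_pnbd_continuous A \<longrightarrow>
       pDense A \<subseteq> orth_up (pNbd A) (pClEmb A) \<and>
       factorization_system (pNbd A) (pDense A) (pClEmb A)"
      using pDense_pClEmb_factorization_system by simp
    show "all_pnbd_continuous A \<longrightarrow>
       (\<forall>S T U d h P p q \<pi>.
          (S, d, T) \<in> Dense A \<and> (S, h, U) \<in> Ar (Spc A) \<and>
          is_pushout A d h q p \<and> Cod A p = P \<and> final_system A P {(T, q), (U, p)} \<pi> \<longrightarrow>
          (U, p, (P, \<pi>)) \<in> Dense A)"
    proof (intro impI allI, elim conjE)
      fix S T U d h P p q \<pi>
      assume "all_pnbd_continuous A" "(S, d, T) \<in> Dense A" "(S, h, U) \<in> Ar (Spc A)"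
        "is_pushout A d h q p" "Cod A p = P" "final_system A P {(T, q), (U, p)} \<pi>"
      then show "(U, p, (P, \<pi>)) \<in> Dense A"
        by (intro Dense_pushout[of S d T U h q p P \<pi>]) simp_all
    qed
    show "all_pnbd_continuous A \<and>
       category J \<and> is_functor J A Fo Fa \<and> is_functor J A Go Ga \<and>
       is_nat_trans J A Fo Fa Go Ga \<alpha> \<longrightarrow>
       (\<forall>\<mu>F \<mu>G L \<iota> \<nu>L K \<kappa> \<nu>K.
          (\<forall>i \<in> Ob J. ((Fo i, \<mu>F i), \<alpha> i, (Go i, \<mu>G i)) \<in> Dense A) \<and>
          is_colimit J A Fo Fa L \<iota> \<and>
          final_system A L {((Fo i, \<mu>F i), \<iota> i) | i. i \<in> Ob J} \<nu>L \<and>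
          is_colimit J A Go Ga K \<kappa> \<and>
          final_system A K {((Go i, \<mu>G i), \<kappa> i) | i. i \<in> Ob J} \<nu>K \<longrightarrow>
          ((L, \<nu>L), colim_map J A L \<iota> K \<kappa> \<alpha>, (K, \<nu>K)) \<in> Dense A)"
    proof (intro impI allI, elim conjE)
      fix \<mu>F \<mu>G L \<iota> \<nu>L K \<kappa> \<nu>K
      assume h: "all_pnbd_continuous A" "category J" "is_functor J A Fo Fa" "is_functor J A Go Ga"
        "is_nat_trans J A Fo Fa Go Ga \<alpha>"
        "\<forall>i \<in> Ob J. ((Fo i, \<mu>F i), \<alpha> i, (Go i, \<mu>G i)) \<in> Dense A"
        "is_colimit J A Fo Fa L \<iota>" "final_system A L {((Fo i, \<mu>F i), \<iota> i) | i. i \<in> Ob J} \<nu>L"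
        "is_colimit J A Go Ga K \<kappa>" "final_system A K {((Go i, \<mu>G i), \<kappa> i) | i. i \<in> Ob J} \<nu>K"
      show "((L, \<nu>L), colim_map J A L \<iota> K \<kappa> \<alpha>, (K, \<nu>K)) \<in> Dense A"
        by (rule Dense_colim[OF h(1,3,4,2,5) bspec[OF h(6)] h(7-10)])
    qed
  qed
qed

end
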